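(* Let $n\ge1$ and let $\Bbbk$ be a field. Let $Q$ be the quiver of $\Bbbk\,\mathcal{PF}_n\simeq\Bbbk\,\mathcal{EF}_n$: its vertices are the subsets of $[n]$, and its arrows are the morphisms $d_{i,j}^A:A\to A_{i,j}$, one for each $A\subseteq[n]$, $j\in A$ and $i\in[n]$ with $i\vartriangleleft_A j$. Then a quiver presentation of these algebras is given by $Q$ together with the relations \begin{align*} d_{i,j}^{A_{s,t}}d_{s,t}^{A}&=d_{s,t}^{A_{i,j}}d_{i,j}^{A}&&(s>j,\ t,j\in A)\\ d_{i,j}^{A_{s,t}}d_{s,t}^{A}&=d_{i,j}^{A_{i,t}}d_{j,t}^{A_{i,j}}d_{i,j}^{A}&&(s=j,\ t,j\in A)\\ d_{i,j}^{A_{s,t}}d_{s,t}^{A}&=d_{s,j}^{A_{i,t}}d_{j,t}^{A_{i,j}}d_{i,j}^{A}&&(i<s<j,\ s,t,j\in A)\\ d_{i,j}^{A_{s,t}}d_{s,t}^{A}&=d_{s,j}^{A_{i,t}}d_{j,t}^{A_{i,j}}d_{i,j}^{A}&&(s\le i,\ t,j\in A)\\ d_{i,j}^{A_{s,t}}d_{s,t}^{A}&=d_{s,j}^{A_{i,t}}d_{j,t}^{A_{i,j}}d_{i,s}^{A_{s,j}}d_{s,j}^{A}&&(i<s<j,\ t,j\in A,\ s\notin A)\\ d_{i,j}^{(A_{i,t})_{s,i}}d_{s,i}^{A_{i,t}}d_{i,t}^{A}&=d_{s,j}^{A_{i,t}}d_{j,t}^{A_{i,j}}d_{i,j}^{A}&&(s<i<j<t,\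 t,j\in A,\ i\notin A) \end{align*} for $j<t$ and every $A\subseteq[n]$ (and all indices for which the arrows occurring in the relation are defined).
   Context: $[n]=\{1,\dots,n\}$. $\mathcal{PF}_n$ is the monoid (under composition) of all order-decreasing partial functions $f$ on $[n]$, i.e. $f(x)\le x$ for every $x$ in the domain; $\Bbbk\mathcal{PF}_n$ is its monoid algebra. $\mathcal{EF}_n$ is the category whose objects are all subsets of $[n]$ and whose morphisms $A\to B$ are the order-decreasing onto functions with domain $A$ and range $B$. It is known that $\Bbbk\mathcal{PF}_n\simeq\Bbbk\mathcal{EF}_n$ as algebras. For $A\subseteq[n]$ and distinct $i,j\in[n]$, write $i\vartriangleleft_A j$ if $i<j$ and every $x$ with $i<x\le j$ lies in $A$. For $i\vartriangleleft_A j$ put $A_{i,j}=(A\cup\{i\})\setminus\{j\}$ and let $d_{i,j}^A:A\to A_{i,j}$ be the morphism of $\mathcal{EF}_n$ with $d_{i,j}^A(j)=i$ and $d_{i,j}^A(x)=x$ for $x\in A\setminus\{j\}$. The symbol $d_{i,j}^A$ is defined only when $i\vartriangleleft_A j$. These are exactly the irreducible morphisms of $\mathcal{EF}_n$ (non-isomorphisms $m$ such that $m=m'm''$ implies that $m'$ or $m''$ is an isomorphism). For a finite category $E$, the category algebra $\Bbbk E$ has basis the morphisms of $E$, with $m'\cdot m=m'm$ if the composition is defined and $0$ otherwise. Composition, also of paths, is from right to left. For a graph $Q$, $Q^*$ is the free category on $Q$ (morphisms are paths, including one empty path per vertex). $L_\Bbbk[E]$ is the $\Bbbk$-linear category with the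 same objects as $E$ whose hom-spaces have bases the hom-sets of $E$, with bilinearly extended composition. For a relation $R$ on morphisms of $L_\Bbbk[Q^*]$ (relating only morphisms with the same domain and range), $\rho_R$ is the smallest congruence containing $R$ that is both a category congruence and a vector space congruence on each hom-space. An algebra $A$ is split basic if $A/\mathrm{Rad}\,A\simeq\Bbbk^r$ for some $r$. For such $A$ with complete set of primitive orthogonal idempotents $\{e_1,\dots,e_r\}$, $\mathscr{L}(A)$ is the $\Bbbk$-linear category with objects $e_1,\dots,e_r$ and $\mathscr{L}(A)(e_i,e_j)=e_jAe_i$, composition being multiplication in $A$. The quiver of $A$ has vertices $e_1,\dots,e_r$ and, as arrows from $e_k$ to $e_l$, a basis of $e_l(\mathrm{Rad}A/\mathrm{Rad}^2A)e_k$. A quiver presentation of $A$ is a pair $(Q,R)$ where $Q$ is the quiver of $A$ and $L_\Bbbk[Q^*]/\rho_R\simeq\mathscr{L}(A)$. *)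

theory Defs
  imports
    "HOL-Library.Poly_Mapping"
    "HOL-Algebra.Ideal_Product"
    "HOL-Algebra.QuotRing"
    "Graph_Theory.Arc_Walk"
    "Jordan_Normal_Form.VS_Connect"
begin

section \<open>Algebras over a field\<close>

text \<open>
  The ground field is a type \<open>'k\<close> of class \<open>field\<close>; \<open>class_ring\<close> is the same field as a
  record. An algebra is a record of type \<open>('k, 'a) module\<close>, whose ring part need not be
  commutative (unlike in the locale \<open>algebra\<close> of the library).
\<close>

definition k_algebra :: "('k::field, 'a) module \<Rightarrow> bool" where
  "k_algebra A \<longleftrightarrow> ring A \<and> vectorspace class_ring A \<and>
     (\<forall>c. \<forall>x\<in>carrier A. \<forall>y\<in>carrier A.
        (c \<odot>\<^bsub>A\<^esub> x) \<otimes>\<^bsub>A\<^esub> y = c \<odot>\<^bsub>A\<^esub> (x \<otimes>\<^bsub>A\<^esub> y) \<and>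
        x \<otimes>\<^bsub>A\<^esub> (c \<odot>\<^bsub>A\<^esub> y) = c \<odot>\<^bsub>A\<^esub> (x \<otimes>\<^bsub>A\<^esub> y))"

definition alg_isomorphic :: "('k, 'a) module \<Rightarrow> ('k, 'b) module \<Rightarrow> bool" where
  "alg_isomorphic A B \<longleftrightarrow>
     (\<exists>h \<in> ring_iso A B. \<forall>c. \<forall>x\<in>carrier A. h (c \<odot>\<^bsub>A\<^esub> x) = c \<odot>\<^bsub>B\<^esub> h x)"

text \<open>\<open>A Quot I\<close> with the induced scalar multiplication.\<close>

definition alg_quot :: "('k, 'a) module \<Rightarrow> 'a set \<Rightarrow> ('k, 'a set) module" where
  "alg_quot A I =
     \<lparr>carrier = carrier (A Quot I), mult = mult (A Quot I), one = one (A Quot I),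
      zero = zero (A Quot I), add = add (A Quot I),
      smult = (\<lambda>c X. \<Union>x\<in>X. I +>\<^bsub>A\<^esub> (c \<odot>\<^bsub>A\<^esub> x))\<rparr>"

definition left_ideal :: "'a set \<Rightarrow> ('a, 'm) ring_scheme \<Rightarrow> bool" where
  "left_ideal I A \<longleftrightarrow>
     additive_subgroup I A \<and> (\<forall>a\<in>carrier A. \<forall>x\<in>I. a \<otimes>\<^bsub>A\<^esub> x \<in> I)"

definition maximal_left_ideal :: "'a set \<Rightarrow> ('a, 'm) ring_scheme \<Rightarrow> bool" where
  "maximal_left_ideal I A \<longleftrightarrow> left_ideal I A \<and> I \<noteq> carrier A \<and>
     (\<forall>J. left_ideal J A \<and> I \<subseteq> J \<longrightarrow> J = I \<or> J = carrier A)"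

text \<open>The Jacobson radical.\<close>

definition Rad :: "('a, 'm) ring_scheme \<Rightarrow> 'a set" where
  "Rad A = {x \<in> carrier A. \<forall>I. maximal_left_ideal I A \<longrightarrow> x \<in> I}"

definition Rad2 :: "('a, 'm) ring_scheme \<Rightarrow> 'a set" where
  "Rad2 A = ideal_prod A (Rad A) (Rad A)"

definition field_power :: "nat \<Rightarrow> ('k::field, nat \<Rightarrow> 'k) module" where
  "field_power r =
     \<lparr>carrier = {..<r} \<rightarrow>\<^sub>E UNIV,
      mult = (\<lambda>f g. \<lambda>i\<in>{..<r}. f i * g i), one = (\<lambda>i\<in>{..<r}. 1),
      zero = (\<lambda>i\<in>{..<r}. 0), add = (\<lambda>f g. \<lambda>i\<in>{..<r}. f i + g i),
      smult = (\<lambda>c f. \<lambda>i\<in>{..<r}. c * f i)\<rparr>"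

definition split_basic :: "('k::field, 'a) module \<Rightarrow> bool" where
  "split_basic A \<longleftrightarrow> (\<exists>r. alg_isomorphic (alg_quot A (Rad A)) (field_power r))"

definition idempotent_in :: "('a, 'm) ring_scheme \<Rightarrow> 'a \<Rightarrow> bool" where
  "idempotent_in A e \<longleftrightarrow> e \<in> carrier A \<and> e \<otimes>\<^bsub>A\<^esub> e = e"

definition primitive_idempotent :: "('a, 'm) ring_scheme \<Rightarrow> 'a \<Rightarrow> bool" where
  "primitive_idempotent A e \<longleftrightarrow> idempotent_in A e \<and> e \<noteq> \<zero>\<^bsub>A\<^esub> \<and>
     (\<forall>f g. idempotent_in A f \<and> idempotent_in A g \<and>
        f \<otimes>\<^bsub>A\<^esub> g = \<zero>\<^bsub>A\<^esub> \<and> g \<otimes>\<^bsub>A\<^esub> f = \<zero>\<^bsub>A\<^esub> \<and> e = f \<oplus>\<^bsub>A\<^esub> g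
        \<longrightarrow> f = \<zero>\<^bsub>A\<^esub> \<or> g = \<zero>\<^bsub>A\<^esub>)"

definition complete_primitive_orthogonal :: "('a, 'm) ring_scheme \<Rightarrow> 'a set \<Rightarrow> bool" where
  "complete_primitive_orthogonal A E \<longleftrightarrow>
     finite E \<and> (\<forall>e\<in>E. primitive_idempotent A e) \<and>
     (\<forall>e\<in>E. \<forall>f\<in>E. e \<noteq> f \<longrightarrow> e \<otimes>\<^bsub>A\<^esub> f = \<zero>\<^bsub>A\<^esub>) \<and>
     (\<Oplus>\<^bsub>A\<^esub>e\<in>E. e) = \<one>\<^bsub>A\<^esub>"

section \<open>Categories and linear categories\<close>

text \<open>\<open>cmp E m' m\<close> is $m'm$ (first $m$, then $m'$), defined when \<open>src E m' = tgt E m\<close>.\<close>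

record ('o, 'm) cat =
  obj :: "'o set"
  mor :: "'m set"
  src :: "'m \<Rightarrow> 'o"
  tgt :: "'m \<Rightarrow> 'o"
  cmp :: "'m \<Rightarrow> 'm \<Rightarrow> 'm"
  idm :: "'o \<Rightarrow> 'm"

text \<open>
  Hom-spaces of different pairs of objects may overlap (for instance in \<open>0\<close>), so all operations
  are indexed by objects: \<open>lcomp C u v w g f\<close> is $gf$ for $f : u \to v$ and $g : v \to w$.
\<close>

record ('o, 'k, 'h) lincat =
  lobj :: "'o set"
  lhom :: "'o \<Rightarrow> 'o \<Rightarrow> 'h set"
  ladd :: "'o \<Rightarrow> 'o \<Rightarrow> 'h \<Rightarrow> 'h \<Rightarrow> 'h"
  lscale :: "'o \<Rightarrow> 'o \<Rightarrow> 'k \<Rightarrow> 'h \<Rightarrow> 'h"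
  lcomp :: "'o \<Rightarrow> 'o \<Rightarrow> 'o \<Rightarrow> 'h \<Rightarrow> 'h \<Rightarrow> 'h"
  lid :: "'o \<Rightarrow> 'h"

definition pm_scale :: "'k::field \<Rightarrow> ('m \<Rightarrow>\<^sub>0 'k) \<Rightarrow> ('m \<Rightarrow>\<^sub>0 'k)" where
  "pm_scale c f = Poly_Mapping.map ((*) c) f"

definition bilinear_ext :: "('m \<Rightarrow> 'm \<Rightarrow> ('m \<Rightarrow>\<^sub>0 'k::field)) \<Rightarrow>
    ('m \<Rightarrow>\<^sub>0 'k) \<Rightarrow> ('m \<Rightarrow>\<^sub>0 'k) \<Rightarrow> ('m \<Rightarrow>\<^sub>0 'k)" where
  "bilinear_ext b f g =
     (\<Sum>x\<in>Poly_Mapping.keys f. \<Sum>y\<in>Poly_Mapping.keys g.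
        pm_scale (Poly_Mapping.lookup f x * Poly_Mapping.lookup g y) (b x y))"

definition monoid_algebra :: "'m monoid \<Rightarrow> ('k::field, 'm \<Rightarrow>\<^sub>0 'k) module" where
  "monoid_algebra M =
     \<lparr>carrier = {f. Poly_Mapping.keys f \<subseteq> carrier M},
      mult = bilinear_ext (\<lambda>x y. Poly_Mapping.single (x \<otimes>\<^bsub>M\<^esub> y) 1),
      one = Poly_Mapping.single \<one>\<^bsub>M\<^esub> 1, zero = 0, add = (+), smult = pm_scale\<rparr>"

definition cat_prod :: "('o, 'm) cat \<Rightarrow>
    ('m \<Rightarrow>\<^sub>0 'k::field) \<Rightarrow> ('m \<Rightarrow>\<^sub>0 'k) \<Rightarrow> ('m \<Rightarrow>\<^sub>0 'k)" where
  "cat_prod E = bilinear_ext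
     (\<lambda>m' m. if src E m' = tgt E m then Poly_Mapping.single (cmp E m' m) 1 else 0)"

text \<open>For a category with finitely many objects.\<close>

definition category_algebra :: "('o, 'm) cat \<Rightarrow> ('k::field, 'm \<Rightarrow>\<^sub>0 'k) module" where
  "category_algebra E =
     \<lparr>carrier = {f. Poly_Mapping.keys f \<subseteq> mor E}, mult = cat_prod E,
      one = (\<Sum>u\<in>obj E. Poly_Mapping.single (idm E u) 1),
      zero = 0, add = (+), smult = pm_scale\<rparr>"

definition linearization :: "('o, 'm) cat \<Rightarrow> ('o, 'k::field, 'm \<Rightarrow>\<^sub>0 'k) lincat" where
  "linearization E =
     \<lparr>lobj = obj E,
      lhom = (\<lambda>u v. {f. Poly_Mapping.keys f \<subseteq> {m \<in> mor E. src E m = u \<and> tgt E m = v}}),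
      ladd = (\<lambda>u v. (+)), lscale = (\<lambda>u v. pm_scale),
      lcomp = (\<lambda>u v w. cat_prod E),
      lid = (\<lambda>u. Poly_Mapping.single (idm E u) 1)\<rparr>"

text \<open>
  A path from \<open>u\<close> to \<open>v\<close> is a triple \<open>(u, p, v)\<close>, where the arc list \<open>p\<close> is in order of
  travel; hence the path $qp$ has the arc list \<open>p @ q\<close>.
\<close>

definition free_cat :: "('v, 'x) pre_digraph \<Rightarrow> ('v, 'v \<times> 'x list \<times> 'v) cat" where
  "free_cat Q =
     \<lparr>obj = verts Q, mor = {(u, p, v). pre_digraph.awalk Q u p v},
      src = (\<lambda>(u, p, v). u), tgt = (\<lambda>(u, p, v). v),
      cmp = (\<lambda>(v', q, w) (u, p, v). (u, p @ q, w)), idm = (\<lambda>u. (u, [], u))\<rparr>"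

inductive gen_cong ::
    "('o, 'k, 'h) lincat \<Rightarrow> ('o \<Rightarrow> 'o \<Rightarrow> ('h \<times> 'h) set) \<Rightarrow> 'o \<Rightarrow> 'o \<Rightarrow> 'h \<Rightarrow> 'h \<Rightarrow> bool"
  for C R where
  base: "u \<in> lobj C \<Longrightarrow> v \<in> lobj C \<Longrightarrow> (f, g) \<in> R u v \<Longrightarrow> gen_cong C R u v f g"
| refl: "u \<in> lobj C \<Longrightarrow> v \<in> lobj C \<Longrightarrow> f \<in> lhom C u v \<Longrightarrow> gen_cong C R u v f f"
| sym: "gen_cong C R u v f g \<Longrightarrow> gen_cong C R u v g f"
| trans: "gen_cong C R u v f g \<Longrightarrow> gen_cong C R u v g h \<Longrightarrow> gen_cong C R u v f h"
| add: "gen_cong C R u v f f' \<Longrightarrow> gen_cong C R u v g g' \<Longrightarrow>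
    gen_cong C R u v (ladd C u v f g) (ladd C u v f' g')"
| scale: "gen_cong C R u v f g \<Longrightarrow>
    gen_cong C R u v (lscale C u v c f) (lscale C u v c g)"
| comp: "gen_cong C R u v f f' \<Longrightarrow> gen_cong C R v w g g' \<Longrightarrow>
    gen_cong C R u w (lcomp C u v w g f) (lcomp C u v w g' f')"

definition cong_rel :: "('o, 'k, 'h) lincat \<Rightarrow> ('o \<Rightarrow> 'o \<Rightarrow> ('h \<times> 'h) set) \<Rightarrow>
    'o \<Rightarrow> 'o \<Rightarrow> ('h \<times> 'h) set" where
  "cong_rel C R u v = {(f, g). gen_cong C R u v f g}"

text \<open>
  The quotient by the congruence $\rho$. Each operation returns the $\rho$-class of the results on
  representatives, written as the image of the set of all such results under $\rho$.
\<close>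

definition lincat_quot :: "('o, 'k, 'h) lincat \<Rightarrow> ('o \<Rightarrow> 'o \<Rightarrow> ('h \<times> 'h) set) \<Rightarrow>
    ('o, 'k, 'h set) lincat" where
  "lincat_quot C \<rho> =
     \<lparr>lobj = lobj C,
      lhom = (\<lambda>u v. lhom C u v // \<rho> u v),
      ladd = (\<lambda>u v X Y. \<rho> u v `` {ladd C u v f g | f g. f \<in> X \<and> g \<in> Y}),
      lscale = (\<lambda>u v c X. \<rho> u v `` {lscale C u v c f | f. f \<in> X}),
      lcomp = (\<lambda>u v w Y X. \<rho> u w `` {lcomp C u v w g f | g f. g \<in> Y \<and> f \<in> X}),
      lid = (\<lambda>u. \<rho> u u `` {lid C u})\<rparr>"

text \<open>Isomorphism of linear categories with prescribed object map \<open>\<phi>\<close>.\<close>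

definition lincat_iso :: "('o, 'k, 'h) lincat \<Rightarrow> ('p, 'k, 'i) lincat \<Rightarrow> ('o \<Rightarrow> 'p) \<Rightarrow> bool" where
  "lincat_iso C D \<phi> \<longleftrightarrow> bij_betw \<phi> (lobj C) (lobj D) \<and>
     (\<exists>F. (\<forall>u\<in>lobj C. F u u (lid C u) = lid D (\<phi> u)) \<and>
       (\<forall>u\<in>lobj C. \<forall>v\<in>lobj C.
          bij_betw (F u v) (lhom C u v) (lhom D (\<phi> u) (\<phi> v)) \<and>
          (\<forall>f\<in>lhom C u v. \<forall>g\<in>lhom C u v.
             F u v (ladd C u v f g) = ladd D (\<phi> u) (\<phi> v) (F u v f) (F u v g)) \<and>
          (\<forall>c. \<forall>f\<in>lhom C u v.
             F u v (lscale C u v c f) = lscale D (\<phi> u) (\<phi> v) c (F u v f)) \<and>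
          (\<forall>w\<in>lobj C. \<forall>f\<in>lhom C u v. \<forall>g\<in>lhom C v w.
             F u w (lcomp C u v w g f) =
               lcomp D (\<phi> u) (\<phi> v) (\<phi> w) (F v w g) (F u v f))))"

section \<open>Quiver presentations\<close>

definition idem_cat :: "('k, 'a) module \<Rightarrow> 'a set \<Rightarrow> ('a, 'k, 'a) lincat" where
  "idem_cat A E =
     \<lparr>lobj = E,
      lhom = (\<lambda>e e'. {e' \<otimes>\<^bsub>A\<^esub> a \<otimes>\<^bsub>A\<^esub> e | a. a \<in> carrier A}),
      ladd = (\<lambda>e e'. add A), lscale = (\<lambda>e e'. smult A),
      lcomp = (\<lambda>e e' e''. mult A), lid = (\<lambda>e. e)\<rparr>"

text \<open>\<open>arrow_space A e e'\<close> is $e'(\mathrm{Rad} A/\mathrm{Rad}^2 A)e$.\<close>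

definition arrow_space :: "('k, 'a) module \<Rightarrow> 'a \<Rightarrow> 'a \<Rightarrow> ('k, 'a set) module" where
  "arrow_space A e e' = (alg_quot A (Rad2 A))
     \<lparr>carrier := {Rad2 A +>\<^bsub>A\<^esub> (e' \<otimes>\<^bsub>A\<^esub> x \<otimes>\<^bsub>A\<^esub> e) | x. x \<in> Rad A}\<rparr>"

text \<open>
  \<open>Q\<close> is, via \<open>\<phi>\<close> on vertices and \<open>b\<close> on arrows, the quiver of \<open>A\<close> formed with the idempotents
  \<open>E\<close>: for any two vertices, \<open>b\<close> identifies the arrows between them with a basis of the
  corresponding arrow space.
\<close>

definition quiver_via ::
    "('k::field, 'a) module \<Rightarrow> 'a set \<Rightarrow> ('v, 'x) pre_digraph \<Rightarrow> ('v \<Rightarrow> 'a) \<Rightarrow> bool" where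
  "quiver_via A E Q \<phi> \<longleftrightarrow> wf_digraph Q \<and> bij_betw \<phi> (verts Q) E \<and>
     (\<exists>b. \<forall>u\<in>verts Q. \<forall>v\<in>verts Q.
        inj_on b {a \<in> arcs Q. tail Q a = u \<and> head Q a = v} \<and>
        vectorspace.basis class_ring (arrow_space A (\<phi> u) (\<phi> v))
          (b ` {a \<in> arcs Q. tail Q a = u \<and> head Q a = v}))"

definition quiver_presentation :: "('k::field, 'a) module \<Rightarrow> ('v, 'x) pre_digraph \<Rightarrow>
    ('v \<Rightarrow> 'v \<Rightarrow> (('v \<times> 'x list \<times> 'v \<Rightarrow>\<^sub>0 'k) \<times> ('v \<times> 'x list \<times> 'v \<Rightarrow>\<^sub>0 'k)) set) \<Rightarrow> bool" where
  "quiver_presentation A Q R \<longleftrightarrow>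
     k_algebra A \<and> split_basic A \<and>
     (\<forall>u v. R u v \<subseteq> lhom (linearization (free_cat Q)) u v \<times> lhom (linearization (free_cat Q)) u v) \<and>
     (\<exists>E \<phi>. complete_primitive_orthogonal A E \<and> quiver_via A E Q \<phi> \<and>
        lincat_iso
          (lincat_quot (linearization (free_cat Q)) (cong_rel (linearization (free_cat Q)) R))
          (idem_cat A E) \<phi>)"

section \<open>Order-decreasing partial functions\<close>

definition PF :: "nat \<Rightarrow> (nat \<rightharpoonup> nat) set" where
  "PF n = {f. dom f \<subseteq> {1..n} \<and> ran f \<subseteq> {1..n} \<and> (\<forall>x y. f x = Some y \<longrightarrow> y \<le> x)}"

definition PF_monoid :: "nat \<Rightarrow> (nat \<rightharpoonup> nat) monoid" where
  "PF_monoid n = \<lparr>carrier = PF n, mult = (\<circ>\<^sub>m), one = Some |` {1..n}\<rparr>"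

text \<open>
  A morphism $A \to B$ is an onto function with domain $A$ and range $B$, hence it is a partial
  function from which $A$ and $B$ can be read off.
\<close>

definition EF_cat :: "nat \<Rightarrow> (nat set, nat \<rightharpoonup> nat) cat" where
  "EF_cat n = \<lparr>obj = Pow {1..n}, mor = PF n, src = dom, tgt = ran, cmp = (\<circ>\<^sub>m),
     idm = (\<lambda>A. Some |` A)\<rparr>"

definition tri :: "nat set \<Rightarrow> nat \<Rightarrow> nat \<Rightarrow> bool" where
  "tri A i j \<longleftrightarrow> i < j \<and> (\<forall>x. i < x \<and> x \<le> j \<longrightarrow> x \<in> A)"

definition swap_in :: "nat set \<Rightarrow> nat \<Rightarrow> nat \<Rightarrow> nat set"  (\<open>_\<langle>_,_\<rangle>\<close> [1000, 0, 0] 1000) where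
  "A\<langle>i,j\<rangle> = (A \<union> {i}) - {j}"

text \<open>
  A symbol \<open>(i, j, A)\<close> stands for $d_{i,j}^A$, and \<open>arrow_defined n\<close> tells whether it is defined;
  \<open>d_map\<close> sends it to the morphism it denotes (and to a meaningless map if it is undefined).
\<close>

definition arrow_defined :: "nat \<Rightarrow> nat \<times> nat \<times> nat set \<Rightarrow> bool" where
  "arrow_defined n = (\<lambda>(i, j, A). A \<subseteq> {1..n} \<and> i \<in> {1..n} \<and> j \<in> {1..n} \<and> tri A i j)"

definition d_map :: "nat \<times> nat \<times> nat set \<Rightarrow> (nat \<rightharpoonup> nat)" where
  "d_map = (\<lambda>(i, j, A) x. if x \<in> A then Some (if x = j then i else x) else None)"

lemma d_map_dom: "dom (d_map (i, j, A)) = A"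
  by (auto simp: d_map_def dom_def)

lemma d_map_ran: "arrow_defined n (i, j, A) \<Longrightarrow> ran (d_map (i, j, A)) = A\<langle>i,j\<rangle>"
  unfolding d_map_def arrow_defined_def ran_def swap_in_def tri_def
  by (auto split: if_splits)

definition EF_quiver :: "nat \<Rightarrow> (nat set, nat \<rightharpoonup> nat) pre_digraph" where
  "EF_quiver n = \<lparr>verts = Pow {1..n}, arcs = d_map ` {a. arrow_defined n a},
     tail = dom, head = ran\<rparr>"

text \<open>
  The two sides of the relations, as words in the symbols written from right to left: the last
  symbol of a word starts at \<open>A\<close> and is applied first.
\<close>

inductive EF_rel :: "nat set \<Rightarrow> (nat \<times> nat \<times> nat set) list \<Rightarrow> (nat \<times> nat \<times> nat set) list \<Rightarrow> bool"
  for A where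
  "j < t \<Longrightarrow> s > j \<Longrightarrow> t \<in> A \<Longrightarrow> j \<in> A \<Longrightarrow>
    EF_rel A [(i, j, A\<langle>s,t\<rangle>), (s, t, A)]
             [(s, t, A\<langle>i,j\<rangle>), (i, j, A)]"
| "j < t \<Longrightarrow> s = j \<Longrightarrow> t \<in> A \<Longrightarrow> j \<in> A \<Longrightarrow>
    EF_rel A [(i, j, A\<langle>s,t\<rangle>), (s, t, A)]
             [(i, j, A\<langle>i,t\<rangle>), (j, t, A\<langle>i,j\<rangle>), (i, j, A)]"
| "j < t \<Longrightarrow> i < s \<Longrightarrow> s < j \<Longrightarrow> s \<in> A \<Longrightarrow> t \<in> A \<Longrightarrow> j \<in> A \<Longrightarrow>
    EF_rel A [(i, j, A\<langle>s,t\<rangle>), (s, t, A)]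
             [(s, j, A\<langle>i,t\<rangle>), (j, t, A\<langle>i,j\<rangle>), (i, j, A)]"
| "j < t \<Longrightarrow> s \<le> i \<Longrightarrow> t \<in> A \<Longrightarrow> j \<in> A \<Longrightarrow>
    EF_rel A [(i, j, A\<langle>s,t\<rangle>), (s, t, A)]
             [(s, j, A\<langle>i,t\<rangle>), (j, t, A\<langle>i,j\<rangle>), (i, j, A)]"
| "j < t \<Longrightarrow> i < s \<Longrightarrow> s < j \<Longrightarrow> t \<in> A \<Longrightarrow> j \<in> A \<Longrightarrow> s \<notin> A \<Longrightarrow>
    EF_rel A [(i, j, A\<langle>s,t\<rangle>), (s, t, A)]
             [(s, j, A\<langle>i,t\<rangle>), (j, t, A\<langle>i,j\<rangle>), (i, s, A\<langle>s,j\<rangle>), (s, j, A)]"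
| "s < i \<Longrightarrow> i < j \<Longrightarrow> j < t \<Longrightarrow> t \<in> A \<Longrightarrow> j \<in> A \<Longrightarrow> i \<notin> A \<Longrightarrow>
    EF_rel A [(i, j, A\<langle>i,t\<rangle>\<langle>s,i\<rangle>), (s, i, A\<langle>i,t\<rangle>), (i, t, A)]
             [(s, j, A\<langle>i,t\<rangle>), (j, t, A\<langle>i,j\<rangle>), (i, j, A)]"

text \<open>
  The same relations between basis elements of the path spaces, for words in which every symbol is
  defined; \<open>B\<close> is the range of the leftmost arrow.
\<close>

definition EF_relations :: "nat \<Rightarrow> nat set \<Rightarrow> nat set \<Rightarrow>
    ((nat set \<times> (nat \<rightharpoonup> nat) list \<times> nat set \<Rightarrow>\<^sub>0 'k::field) \<times>
     (nat set \<times> (nat \<rightharpoonup> nat) list \<times> nat set \<Rightarrow>\<^sub>0 'k)) set" where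
  "EF_relations n A B =
     {(Poly_Mapping.single (A, rev (map d_map l), B) 1,
       Poly_Mapping.single (A, rev (map d_map r), B) 1) | l r.
        A \<subseteq> {1..n} \<and> EF_rel A l r \<and> (\<forall>a \<in> set l \<union> set r. arrow_defined n a) \<and>
        B = ran (d_map (hd l))}"

end

theory Submission
  imports Defs
begin

text \<open>
  Think of a morphism as moving tokens placed on the points of $A$ downwards. The relations allow
  any path to be rewritten so that the tokens move one after another, from the smallest to the
  largest. The path of a token over the final positions of the smaller ones is unique, so parallel
  paths with the same composite are congruent, by induction on the largest token; the same routes
  show that every morphism is a composite of arrows.

  A non-identity morphism of $\mathcal{EF}_n$ decreases the sum of the points of the object. Hence
  the elements of the category algebra without identity terms are quasi-regular and form the
  radical; by irreducibility of the arrows, the elements of its square are those without identity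
  and arrow terms. The monoid algebra is carried to the category algebra by sending a partial
  function to the sum of its restrictions.
\<close>

section \<open>Words and their congruence\<close>

text \<open>On its left side every relation moves the larger token \<open>t\<close> first; on its
  right side the smaller token at \<open>j\<close> reaches its goal \<open>i\<close> before
  \<open>t\<close> starts. So each relation is a rule for interchanging a large token with a later
  move of a smaller one. Several shapes are needed because tokens interact through holes: a move
  passes over occupied points only, and merged tokens move together. The large token may rest in a
  hole that the smaller one passes over (\<open>across\<close>), may be carried along after merging
  (\<open>merged\<close>), or, if the smaller one goes first, finds \<open>j\<close> empty and must
  stop there (\<open>below\<close>, \<open>through\<close>); only \<open>commute\<close> is free of
  interaction. The same constraint makes routes unique, so normal forms are compared directly,
  without a confluence argument. All this is combinatorics of words. The linear part adds that the
  generated congruence is the kernel of the map taking a path to its composite. The two algebras are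
  treated together: a linear bijection \<open>h\<close> to the category algebra is a parameter of
  one locale.\<close>

text \<open>A path of the quiver is given by its source \<open>A\<close> and its word: the list, in order of travel,
  of the moves \<open>(i, j)\<close> standing for $d_{i,j}$. The upper index of each arrow is the set of
  points occupied when the move is made, so it need not be stored.\<close>

fun word_arrows :: "nat set \<Rightarrow> (nat \<times> nat) list \<Rightarrow> (nat \<times> nat \<times> nat set) list" where
  "word_arrows A [] = []"
| "word_arrows A ((i, j) # w) = (i, j, A) # word_arrows (A\<langle>i,j\<rangle>) w"

fun valid_word :: "nat set \<Rightarrow> (nat \<times> nat) list \<Rightarrow> bool" where
  "valid_word A [] = True"
| "valid_word A ((i, j) # w) \<longleftrightarrow> 1 \<le> i \<and> tri A i j \<and> valid_word (A\<langle>i,j\<rangle>) w"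

fun endpoint :: "nat set \<Rightarrow> (nat \<times> nat) list \<Rightarrow> nat set" where
  "endpoint A [] = A"
| "endpoint A ((i, j) # w) = endpoint (A\<langle>i,j\<rangle>) w"

fun word_act :: "(nat \<times> nat) list \<Rightarrow> nat \<Rightarrow> nat" where
  "word_act [] x = x"
| "word_act ((i, j) # w) x = word_act w (if x = j then i else x)"

lemma valid_word_append: "valid_word A (u @ v) \<longleftrightarrow> valid_word A u \<and> valid_word (endpoint A u) v"
  by (induction u arbitrary: A) auto

lemma endpoint_append: "endpoint A (u @ v) = endpoint (endpoint A u) v"
  by (induction u arbitrary: A) auto

lemma word_act_append: "word_act (u @ v) x = word_act v (word_act u x)"
  by (induction u arbitrary: x) auto

lemma word_arrows_append: "word_arrows A (u @ v) = word_arrows A u @ word_arrows (endpoint A u) v"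
  by (induction u arbitrary: A) auto

lemma tri_less: "tri A i j \<Longrightarrow> i < j" and tri_mem: "tri A i j \<Longrightarrow> j \<in> A"
  by (auto simp: tri_def)

lemma swap_in_image: "j \<in> A \<Longrightarrow> i \<noteq> j \<Longrightarrow> A\<langle>i,j\<rangle> = (\<lambda>x. if x = j then i else x) ` A"
  by (auto simp: swap_in_def)

lemma endpoint_eq_image: "valid_word A w \<Longrightarrow> endpoint A w = word_act w ` A"
proof (induction w arbitrary: A)
  case (Cons m w)
  obtain i j where m: "m = (i, j)" by force
  have "endpoint A (m # w) = word_act w ` (A\<langle>i,j\<rangle>)"
    using Cons by (simp add: m)
  also have "\<dots> = word_act (m # w) ` A"
    using Cons.prems tri_less[of A i j] tri_mem[of A i j]
    by (auto simp: m swap_in_image image_image simp del: if_image_distrib)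
  finally show ?case .
qed auto

lemma word_act_bounds: "valid_word A w \<Longrightarrow> x \<in> A \<Longrightarrow> word_act w x \<le> x \<and> (1 \<le> x \<longrightarrow> 1 \<le> word_act w x)"
proof (induction w arbitrary: A x)
  case (Cons m w)
  obtain i j where m: "m = (i, j)" by force
  have *: "i < j" "j \<in> A" "1 \<le> i" "valid_word (A\<langle>i,j\<rangle>) w" using Cons.prems tri_less[of A i j] tri_mem[of A i j]
    by (auto simp: m)
  have "(if x = j then i else x) \<in> A\<langle>i,j\<rangle>" using * Cons.prems by (auto simp: swap_in_def)
  from Cons.IH[OF *(4) this] show ?case using * Cons.prems by (auto simp: m split: if_splits)
qed auto

lemma endpoint_subset: "valid_word A w \<Longrightarrow> A \<subseteq> {1..n} \<Longrightarrow> endpoint A w \<subseteq> {1..n}"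
  using word_act_bounds by (fastforce simp: endpoint_eq_image)

text \<open>\<open>below\<close> covers the third and the fourth relation, which have the same sides.\<close>

inductive word_rel :: "nat set \<Rightarrow> (nat \<times> nat) list \<Rightarrow> (nat \<times> nat) list \<Rightarrow> bool" for A where
  commute: "j < t \<Longrightarrow> j < s \<Longrightarrow> t \<in> A \<Longrightarrow> j \<in> A \<Longrightarrow> word_rel A [(s, t), (i, j)] [(i, j), (s, t)]"
| merged: "j < t \<Longrightarrow> t \<in> A \<Longrightarrow> j \<in> A \<Longrightarrow> word_rel A [(j, t), (i, j)] [(i, j), (j, t), (i, j)]"
| below: "j < t \<Longrightarrow> i < s \<and> s < j \<and> s \<in> A \<or> s \<le> i \<Longrightarrow> t \<in> A \<Longrightarrow> j \<in> A \<Longrightarrow>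
    word_rel A [(s, t), (i, j)] [(i, j), (j, t), (s, j)]"
| across: "j < t \<Longrightarrow> i < s \<Longrightarrow> s < j \<Longrightarrow> t \<in> A \<Longrightarrow> j \<in> A \<Longrightarrow> s \<notin> A \<Longrightarrow>
    word_rel A [(s, t), (i, j)] [(s, j), (i, s), (j, t), (s, j)]"
| through: "s < i \<Longrightarrow> i < j \<Longrightarrow> j < t \<Longrightarrow> t \<in> A \<Longrightarrow> j \<in> A \<Longrightarrow> i \<notin> A \<Longrightarrow>
    word_rel A [(i, t), (s, i), (i, j)] [(i, j), (j, t), (s, j)]"

text \<open>Definedness of the left arrows forces that of the right ones, since each point passed
  over on the right is in \<open>A\<close> or has been filled by then. Hence
  \<open>word_cong.rel\<close> asks for validity of \<open>l\<close> only.\<close>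

lemma word_rel_EF_rel:
  assumes "word_rel A l r" "valid_word A l"
  shows "EF_rel A (rev (word_arrows A l)) (rev (word_arrows A r)) \<and> valid_word A r \<and> endpoint A l = endpoint A r \<and>
     (\<forall>x\<in>A. word_act l x = word_act r x)"
  using assms
proof cases
  case (commute j t s i)
  have *: "valid_word A r" "endpoint A l = endpoint A r" "\<forall>x\<in>A. word_act l x = word_act r x"
    using assms(2) commute unfolding commute(1,2) by (auto simp: tri_def swap_in_def)
  show ?thesis using * commute by (auto intro: EF_rel.intros(1))
next
  case (merged j t i)
  have *: "valid_word A r" "endpoint A l = endpoint A r" "\<forall>x\<in>A. word_act l x = word_act r x" "A\<langle>i,j\<rangle>\<langle>j,t\<rangle> = A\<langle>i,t\<rangle>"
    using assms(2) merged unfolding merged(1,2) by (auto simp: tri_def swap_in_def)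
  show ?thesis using * merged by (auto intro: EF_rel.intros(2))
next
  case (below j t i s)
  have *: "valid_word A r" "endpoint A l = endpoint A r" "\<forall>x\<in>A. word_act l x = word_act r x" "A\<langle>i,j\<rangle>\<langle>j,t\<rangle> = A\<langle>i,t\<rangle>"
    using assms(2) below unfolding below(1,2) by (auto simp: tri_def swap_in_def)
  show ?thesis using * below by (auto intro: EF_rel.intros(3,4))
next
  case (across j t i s)
  have *: "valid_word A r" "endpoint A l = endpoint A r" "\<forall>x\<in>A. word_act l x = word_act r x"
     "A\<langle>s,j\<rangle>\<langle>i,s\<rangle> = A\<langle>i,j\<rangle>" "A\<langle>i,j\<rangle>\<langle>j,t\<rangle> = A\<langle>i,t\<rangle>"
    using assms(2) across unfolding across(1,2) by (auto simp: tri_def swap_in_def)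
  show ?thesis using * across by (auto intro: EF_rel.intros(5))
next
  case (through s i j t)
  have f: "A\<langle>i,t\<rangle>\<langle>s,i\<rangle>\<langle>i,j\<rangle> = A\<langle>i,j\<rangle>\<langle>j,t\<rangle>\<langle>s,j\<rangle>" "A\<langle>i,j\<rangle>\<langle>j,t\<rangle> = A\<langle>i,t\<rangle>"
    using through(3-8) by (auto simp: swap_in_def)
  have t: "tri A i t" "tri (A\<langle>i,t\<rangle>) s i" using assms(2) through by auto
  have "tri A i j" using t through(3-8) by (auto simp: tri_def)
  moreover have "tri (A\<langle>i,j\<rangle>) j t" using t through(3-8) by (auto simp: tri_def swap_in_def)
  \<comment> \<open>The interval is cut at \<open>i\<close>: up to \<open>i\<close> it is covered by
    the move \<open>(s, i)\<close>, and above \<open>i\<close> by the move \<open>(i, t)\<close>, as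
    \<open>j < t\<close>.\<close>
  moreover have "tri (A\<langle>i,t\<rangle>) s j"
    unfolding tri_def
  proof safe
    fix x assume "s < x" "x \<le> j"
    then show "x \<in> A\<langle>i,t\<rangle>" using t through(3-8) by (cases "x \<le> i") (auto simp: tri_def swap_in_def)
  qed (use through(3-8) in simp)
  ultimately have *: "valid_word A r" "endpoint A l = endpoint A r" "\<forall>x\<in>A. word_act l x = word_act r x"
    using assms(2) f through(3-8) unfolding through(1,2) by auto
  show ?thesis using * f through by (auto intro: EF_rel.intros(6))
qed

text \<open>Forgetting the upper indices loses nothing: along a word they are composites of swaps,
  and the indices written in \<open>EF_rel\<close> agree with these by identities such as
  \<open>A\<langle>i,j\<rangle>\<langle>j,t\<rangle> = A\<langle>i,t\<rangle>\<close>.\<close>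

lemma EF_rel_word_rel:
  assumes "EF_rel A L R" "\<forall>a \<in> set L \<union> set R. arrow_defined n a"
  obtains l r where "word_rel A l r" "valid_word A l" "L = rev (word_arrows A l)" "R = rev (word_arrows A r)"
  using assms
proof cases
  case (1 j t s i)
  show ?thesis using assms(2) 1 
    by (intro that[OF word_rel.commute[of j t s A i]]) (auto simp: arrow_defined_def tri_def swap_in_def)
next
  case (2 j t s i)
  have "A\<langle>i,j\<rangle>\<langle>j,t\<rangle> = A\<langle>i,t\<rangle>"
    using assms(2) 2 by (auto simp: arrow_defined_def tri_def swap_in_def)
  then show ?thesis using assms(2) 2 
    by (intro that[OF word_rel.merged[of j t A i]]) (auto simp: arrow_defined_def)
next
  case (3 j t i s)
  have "A\<langle>i,j\<rangle>\<langle>j,t\<rangle> = A\<langle>i,t\<rangle>"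
    using assms(2) 3 by (auto simp: arrow_defined_def tri_def swap_in_def)
  then show ?thesis using assms(2) 3 
    by (intro that[OF word_rel.below[of j t i s A]]) (auto simp: arrow_defined_def)
next
  case (4 j t s i)
  have "A\<langle>i,j\<rangle>\<langle>j,t\<rangle> = A\<langle>i,t\<rangle>"
    using assms(2) 4 by (auto simp: arrow_defined_def tri_def swap_in_def)
  then show ?thesis using assms(2) 4 
    by (intro that[OF word_rel.below[of j t i s A]]) (auto simp: arrow_defined_def)
next
  case (5 j t i s)
  have "A\<langle>i,j\<rangle>\<langle>j,t\<rangle> = A\<langle>i,t\<rangle>" "A\<langle>s,j\<rangle>\<langle>i,s\<rangle> = A\<langle>i,j\<rangle>"
    using assms(2) 5 by (auto simp: arrow_defined_def tri_def swap_in_def)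
  then show ?thesis using assms(2) 5 
    by (intro that[OF word_rel.across[of j t i s A]]) (auto simp: arrow_defined_def)
next
  case (6 s i j t)
  have "A\<langle>i,j\<rangle>\<langle>j,t\<rangle> = A\<langle>i,t\<rangle>"
    using assms(2) 6 by (auto simp: arrow_defined_def tri_def swap_in_def)
  then show ?thesis using assms(2) 6 
    by (intro that[OF word_rel.through[of s i j t A]]) (auto simp: arrow_defined_def)
qed

section \<open>Congruence of words and its stability under adding a larger token\<close>

inductive word_cong :: "nat set \<Rightarrow> (nat \<times> nat) list \<Rightarrow> (nat \<times> nat) list \<Rightarrow> bool" where
  rel: "word_rel A l r \<Longrightarrow> valid_word A l \<Longrightarrow> word_cong A l r"
| refl: "valid_word A w \<Longrightarrow> word_cong A w w"
| sym: "word_cong A v w \<Longrightarrow> word_cong A w v"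
| trans: "word_cong A u v \<Longrightarrow> word_cong A v w \<Longrightarrow> word_cong A u w"
| app: "word_cong A u v \<Longrightarrow> word_cong (endpoint A u) u' v' \<Longrightarrow> word_cong A (u @ u') (v @ v')"

text \<open>The easy half; the converse is \<open>word_cong_complete\<close>. Actions are compared
  on \<open>A\<close> only, because \<open>word_act\<close> is total and means nothing
  elsewhere.\<close>

lemma word_cong_sound:
  assumes "word_cong A w v"
  shows "valid_word A w \<and> valid_word A v \<and> endpoint A w = endpoint A v \<and> (\<forall>x\<in>A. word_act w x = word_act v x)"
  using assms
proof induction
  case (app A u v u' v')
  then have "\<forall>x\<in>A. word_act u x \<in> endpoint A u" by (auto simp: endpoint_eq_image)
  with app show ?case by (auto simp: valid_word_append endpoint_append word_act_append)
qed (use word_rel_EF_rel in auto)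

lemma word_cong_append_right: "word_cong A u v \<Longrightarrow> valid_word (endpoint A u) w \<Longrightarrow> word_cong A (u @ w) (v @ w)"
  by (blast intro: word_cong.app word_cong.refl)

lemma word_cong_append_left: "valid_word A u \<Longrightarrow> word_cong (endpoint A u) v w \<Longrightarrow> word_cong A (u @ v) (u @ w)"
  by (blast intro: word_cong.app word_cong.refl)

lemma word_cong_Cons: "1 \<le> i \<Longrightarrow> tri A i j \<Longrightarrow> word_cong (A\<langle>i,j\<rangle>) v w \<Longrightarrow> word_cong A ((i, j) # v) ((i, j) # w)"
  using word_cong_append_left[of A "[(i, j)]" v w] by simp

text \<open>The only conditions that a new token could spoil are \<open>s \<notin> A\<close> in
  \<open>across\<close> and \<open>i \<notin> A\<close> in \<open>through\<close>, and there both
  points lie below \<open>j < a\<close>.\<close>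

lemma word_rel_insert: "word_rel A l r \<Longrightarrow> \<forall>x\<in>A. x < a \<Longrightarrow> word_rel (insert a A) l r"
proof (induction rule: word_rel.induct)
  case (across j t i s)
  then have "j < a" by blast
  with across show ?case by (intro word_rel.across) auto
next
  case (through s i j t)
  then have "j < a" by blast
  with through show ?case by (intro word_rel.through) auto
qed (auto intro: word_rel.intros)

lemma swap_in_insert: "i < a \<Longrightarrow> j < a \<Longrightarrow> (insert a A)\<langle>i,j\<rangle> = insert a (A\<langle>i,j\<rangle>)"
  by (auto simp: swap_in_def)

lemma endpoint_less:
  assumes "valid_word A w" "\<forall>x\<in>A. x < a"
  shows "\<forall>x\<in>endpoint A w. x < (a :: nat)"
  using assms word_act_bounds[OF assms(1)] le_less_trans by (auto simp: endpoint_eq_image) blast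

lemma valid_word_insert:
  "valid_word A w \<Longrightarrow> \<forall>x\<in>A. x < a \<Longrightarrow> valid_word (insert a A) w \<and> endpoint (insert a A) w = insert a (endpoint A w)"
proof (induction w arbitrary: A)
  case (Cons m w)
  obtain i j where m: "m = (i, j)" by force
  have *: "i < j" "j \<in> A" using Cons.prems tri_less[of A i j] tri_mem[of A i j] by (auto simp: m)
  have lt: "i < a" "j < a" using * Cons.prems by auto
  have "\<forall>x\<in>A\<langle>i,j\<rangle>. x < a" using lt Cons.prems by (auto simp: swap_in_def)
  from Cons.IH[OF _ this] Cons.prems have
    "valid_word (insert a (A\<langle>i,j\<rangle>)) w \<and> endpoint (insert a (A\<langle>i,j\<rangle>)) w = insert a (endpoint (A\<langle>i,j\<rangle>) w)"
    by (simp add: m)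
  then show ?case using Cons.prems lt by (simp add: m swap_in_insert) (simp add: tri_def)
qed auto

text \<open>Allows the induction on the largest token to reuse congruences between words on the
  smaller tokens.\<close>

lemma word_cong_insert: "word_cong A w v \<Longrightarrow> \<forall>x\<in>A. x < a \<Longrightarrow> word_cong (insert a A) w v"
proof (induction rule: word_cong.induct)
  case (app A u v u' v')
  then have "valid_word A u" using word_cong_sound by blast
  then show ?case using app endpoint_less[of A u a] valid_word_insert[of A u a] by (auto intro: word_cong.app)
qed (use word_rel_insert valid_word_insert in \<open>auto intro: word_cong.intros\<close>)

text \<open>Iterates \<open>commute\<close>, where the larger token has to land above the source of
  the smaller one; this is the condition \<open>y < i\<close> on the moves of
  \<open>w\<close>.\<close>

lemma word_cong_commute:
  assumes "valid_word A w" "\<forall>(x, y)\<in>set w. y < i" "1 \<le> i" "tri A i j"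
  shows "word_cong A ((i, j) # w) (w @ [(i, j)])"
  using assms
proof (induction w arbitrary: A)
  case Nil
  then show ?case by (auto intro: word_cong.refl)
next
  case (Cons m w)
  obtain x y where m: "m = (x, y)" by force
  have xy: "1 \<le> x" "tri A x y" "y < i" "x < y" "y \<in> A" and ij: "i < j" "j \<in> A" "tri A i j" "1 \<le> i"
    using Cons.prems tri_less[of A] tri_mem[of A] by (auto simp: m)
  have v: "valid_word A [(i, j), (x, y)]" "tri (A\<langle>x,y\<rangle>) i j"
    and s: "A\<langle>i,j\<rangle>\<langle>x,y\<rangle> = A\<langle>x,y\<rangle>\<langle>i,j\<rangle>"
    using xy ij by (auto simp: tri_def swap_in_def)
  have IH: "word_cong (A\<langle>x,y\<rangle>) ((i, j) # w) (w @ [(i, j)])"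
    using Cons v by (auto simp: m)
  have w: "valid_word (A\<langle>x,y\<rangle>\<langle>i,j\<rangle>) w" using word_cong_sound[OF IH] by simp
  have "word_cong A [(i, j), (x, y)] [(x, y), (i, j)]"
    by (intro word_cong.rel word_rel.commute v) (use xy ij in auto)
  from word_cong_append_right[OF this, of w] have "word_cong A ((i, j) # (x, y) # w) ((x, y) # (i, j) # w)"
    using w by (simp add: s)
  moreover have "word_cong A ((x, y) # (i, j) # w) ((x, y) # w @ [(i, j)])"
    using IH xy by (intro word_cong_Cons) auto
  ultimately show ?case by (auto simp: m intro: word_cong.trans)
qed

section \<open>Routes\<close>

text \<open>The only way in which a single token can go from the free position \<open>q\<close> to \<open>p\<close> over the
  occupied positions \<open>P\<close>: it jumps to the next hole until it can reach \<open>p\<close>, and it merges with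
  another token at the last move only, since merged tokens would move together.\<close>

inductive route :: "nat set \<Rightarrow> nat \<Rightarrow> nat \<Rightarrow> (nat \<times> nat) list \<Rightarrow> bool" for P where
  stop: "route P q q []"
| merge: "p < q \<Longrightarrow> {p..<q} \<subseteq> P \<Longrightarrow> route P q p [(p, q)]"
| jump: "h < q \<Longrightarrow> {h<..<q} \<subseteq> P \<Longrightarrow> h \<notin> P \<Longrightarrow> route P h p w \<Longrightarrow> route P q p ((h, q) # w)"

lemma route_le: "route P q p w \<Longrightarrow> p \<le> q"
  by (induction rule: route.induct) auto

lemma route_sources: "route P q p w \<Longrightarrow> (x, y) \<in> set w \<Longrightarrow> y \<le> q"
  by (induction rule: route.induct) auto

text \<open>A token only moves downwards, so its route sees nothing of \<open>P\<close> at or above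
  its starting point.\<close>

lemma route_agree: "route P q p w \<Longrightarrow> (\<And>x. x < q \<Longrightarrow> x \<in> P \<longleftrightarrow> x \<in> P') \<Longrightarrow> route P' q p w"
proof (induction rule: route.induct)
  case (merge p q)
  then show ?case by (intro route.merge) auto
next
  case (jump h q p w)
  then show ?case by (intro route.jump) auto
qed (auto intro: route.stop)

text \<open>If the route ends by merging then \<open>p\<close> is in \<open>P\<close> and
  \<open>insert p P\<close> is just \<open>P\<close>, so one formula covers both endings.\<close>

lemma route_valid:
  assumes "route P q p w" "q \<notin> P" "1 \<le> p"
  shows "valid_word (insert q P) w \<and> endpoint (insert q P) w = insert p P \<and> word_act w q = p \<and> (\<forall>x\<in>P. word_act w x = x)"
  using assms
proof (induction rule: route.induct)
  case (merge p q)
  then have "p \<in> P" by auto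
  moreover have "tri (insert q P) p q" using merge by (auto simp: tri_def subset_iff le_less)
  ultimately show ?case using merge by (auto simp: swap_in_def)
next
  case (jump h q p w)
  have "(insert q P)\<langle>h,q\<rangle> = insert h P" using jump by (auto simp: swap_in_def)
  moreover have "1 \<le> h" using jump route_le[of P h p w] by simp
  moreover have "tri (insert q P) h q" using jump by (auto simp: tri_def subset_iff le_less)
  ultimately show ?case using jump by auto
qed auto

text \<open>A hole in \<open>{p..<q}\<close> excludes \<open>merge\<close>, its absence excludes
  \<open>jump\<close>, and the hole used by a jump is forced to be the highest one below
  \<open>q\<close>.\<close>

lemma route_unique: "route P q p w \<Longrightarrow> route P q p w' \<Longrightarrow> w = w'"
proof (induction arbitrary: w' rule: route.induct)
  case (stop q)
  then show ?case by (cases rule: route.cases) (auto dest: route_le)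
next
  case (merge p q)
  from merge(3) show ?case
  proof (cases rule: route.cases)
    case (jump h w)
    then have "p \<le> h" using route_le by blast
    then show ?thesis using merge jump by fastforce
  qed (use merge in auto)
next
  case (jump h q p w)
  have le: "p \<le> h" using jump.hyps route_le by blast
  from jump.prems show ?case
  proof (cases rule: route.cases)
    case stop
    then show ?thesis using \<open>h < q\<close> le by simp
  next
    case merge
    then have "h \<in> P" using \<open>h < q\<close> le by auto
    then show ?thesis using \<open>h \<notin> P\<close> by simp
  next
    case (jump h' w')
    have "h' = h" using jump \<open>h < q\<close> \<open>h \<notin> P\<close> \<open>{h<..<q} \<subseteq> P\<close>
      by (metis greaterThanLessThan_iff in_mono linorder_neqE_nat)
    then show ?thesis using jump \<open>\<And>w'. route P h p w' \<Longrightarrow> w = w'\<close> by blast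
  qed
qed

lemma route_exists:
  assumes "p \<le> q"
  shows "\<exists>w. route P q p w"
  using assms
proof (induction q rule: less_induct)
  case (less q)
  show ?case
  proof (cases "{p..<q} \<subseteq> P")
    case True
    then show ?thesis using less.prems by (cases "p = q") (auto intro: route.stop route.merge simp: le_less)
  next
    case False
    \<comment> \<open>The highest hole not below \<open>p\<close> is the landing point that
      \<open>jump\<close> prescribes.\<close>
    define h where "h = Max ({p..<q} - P)"
    have "h \<in> {p..<q} - P" unfolding h_def using False by (intro Max_in) auto
    moreover have "{h<..<q} \<subseteq> P"
    proof
      fix x assume x: "x \<in> {h<..<q}"
      have "x \<le> h" if "x \<notin> P" unfolding h_def
        by (rule Max_ge) (use that x \<open>h \<in> _\<close> in auto)
      then show "x \<in> P" using x by auto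
    qed
    moreover obtain w where "route P h p w" using less calculation by force
    ultimately show ?thesis by (auto intro: route.jump)
  qed
qed

text \<open>As \<open>p\<close> is free, the route has not ended by merging and can go on; the new
  last move is a merge or a jump according to whether \<open>i\<close> is occupied.\<close>

lemma route_extend:
  assumes "route P q p w" "p \<notin> P" "i < p" "{i<..<p} \<subseteq> P"
  shows "route P q i (w @ [(i, p)])"
  using assms
proof (induction rule: route.induct)
  case (stop q)
  show ?case
  proof (cases "i \<in> P")
    case True
    then have "{i..<q} \<subseteq> P" using stop by (metis atLeastLessThan_iff greaterThanLessThan_iff nat_less_le subset_iff)
    then show ?thesis using stop by (auto intro: route.merge)
  next
    case False
    then show ?thesis using stop by (auto intro: route.intros)
  qed
next
  case (merge p q)
  then show ?case by fastforce
next
  case (jump h q p w)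
  then show ?case by (auto intro: route.jump)
qed

section \<open>Interchanging a route with a later move of a smaller token\<close>

lemma tri_mono: "tri A i j \<Longrightarrow> A \<subseteq> B \<Longrightarrow> tri B i j"
  by (auto simp: tri_def)

text \<open>What is left of the move \<open>(i, j)\<close> when the token at \<open>p\<close> is removed: if that token was filling
  a hole between \<open>i\<close> and \<open>j\<close>, then \<open>j\<close> has to stop there.\<close>

definition hop :: "nat set \<Rightarrow> nat \<Rightarrow> nat \<Rightarrow> nat \<Rightarrow> (nat \<times> nat) list" where
  "hop P p i j = (if i < p \<and> p < j \<and> p \<notin> P then [(p, j), (i, p)] else [(i, j)])"

text \<open>Taking the token away can open a hole at \<open>p\<close> only, and the detour stops
  exactly there.\<close>

lemma hop_valid:
  assumes "j \<in> P" "1 \<le> i" "tri (insert p P) i j"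
  shows "valid_word P (hop P p i j) \<and> endpoint P (hop P p i j) = P\<langle>i,j\<rangle>"
proof (cases "i < p \<and> p < j \<and> p \<notin> P")
  case True
  have "P\<langle>p,j\<rangle>\<langle>i,p\<rangle> = P\<langle>i,j\<rangle>" using True by (auto simp: swap_in_def)
  moreover have "x \<in> P" if "p < x" "x \<le> j" for x
    using that True assms(3)[unfolded tri_def] by (metis insert_iff less_irrefl less_trans)
  then have "tri P p j" using True by (auto simp: tri_def)
  moreover have "tri (P\<langle>p,j\<rangle>) i p" using True assms by (auto simp: tri_def swap_in_def)
  ultimately show ?thesis using True assms by (simp add: hop_def)
next
  case False
  have "x \<in> P" if "i < x" "x \<le> j" for x
    using that assms False by (cases "x = j") (auto simp: tri_def)
  then have "tri P i j" using assms(3) by (auto simp: tri_def)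
  moreover have "hop P p i j = [(i, j)]" using False by (auto simp: hop_def)
  ultimately show ?thesis using assms by simp
qed

text \<open>The heart of the rewriting, and the place where all shapes of relation are applied: the
  move of the smaller token is pulled in front of the route of the larger one. If
  \<open>p = j\<close> the two have merged, so the large token is carried along and its new goal is
  \<open>i\<close>.\<close>

lemma route_step:
  assumes "route P q p w" "q \<notin> P" "j \<in> P" "j < q" "1 \<le> i" "1 \<le> p" "tri (insert p P) i j"
  shows "\<exists>r. route (P\<langle>i,j\<rangle>) q (if p = j then i else p) r \<and>
    word_cong (insert q P) (w @ [(i, j)]) (hop P p i j @ r)"
  using assms
proof (induction rule: route.induct)
  case (stop q)
  have "tri (insert q P) i j" using stop by simp
  then show ?case using stop
    by (auto simp: hop_def intro!: exI[of _ "[]"] route.stop word_cong.refl)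
next
  case (merge p q)
  have p: "p \<in> P" using merge by auto
  have ij: "i < j" using merge tri_less by blast
  have A: "valid_word (insert q P) [(p, q), (i, j)]"
    using merge p by (auto simp: tri_def swap_in_def subset_iff le_less)
  \<comment> \<open>Since \<open>p\<close> is occupied, \<open>hop\<close> is a single move. The
    cases \<open>j < p\<close>, \<open>p = j\<close> and \<open>p < j\<close> are
    \<open>commute\<close>, \<open>merged\<close> and \<open>below\<close>; in the last two,
    \<open>j\<close> has become a hole at which the large token must stop.\<close>
  have w: "word_rel (insert q P) [(p, q), (i, j)]
    (hop P p i j @ (if j < p then [(p, q)] else if p = j then [(j, q), (i, j)] else [(j, q), (p, j)]))"
    using merge p by (auto simp: hop_def intro: word_rel.intros)
  have P: "i \<in> P\<langle>i,j\<rangle>" "p \<noteq> j \<Longrightarrow> p \<in> P\<langle>i,j\<rangle>" "j \<notin> P\<langle>i,j\<rangle>"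
    "\<And>x. i < x \<Longrightarrow> x < j \<Longrightarrow> x \<in> P\<langle>i,j\<rangle>" "\<And>x. p < x \<Longrightarrow> x \<noteq> j \<Longrightarrow> x < q \<Longrightarrow> x \<in> P\<langle>i,j\<rangle>"
    using p ij merge by (auto simp: swap_in_def tri_def subset_iff)
  have "route (P\<langle>i,j\<rangle>) q (if p = j then i else p)
    (if j < p then [(p, q)] else if p = j then [(j, q), (i, j)] else [(j, q), (p, j)])"
    using P merge.hyps merge.prems ij
    by (auto intro!: route.merge route.jump simp: subset_iff le_less)
  moreover have "word_cong (insert q P) ([(p, q)] @ [(i, j)]) (hop P p i j @ (if j < p then [(p, q)] else if p = j then [(j, q), (i, j)] else [(j, q), (p, j)]))"
    using w A by (auto intro: word_cong.rel)
  ultimately show ?case by blast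
next
  case (jump h q p w)
  have ph: "p \<le> h" and h: "1 \<le> h" using jump route_le[of P h p w] by auto
  have ij: "i < j" using jump tri_less by blast
  have swap_h: "(insert q P)\<langle>h,q\<rangle> = insert h P" using jump by (auto simp: swap_in_def)
  have tri_h: "tri (insert q P) h q" using jump by (auto simp: tri_def subset_iff le_less)
  have w: "valid_word (insert h P) w" "endpoint (insert h P) w = insert p P"
    using route_valid[OF jump(4)] jump by auto
  show ?case
  proof (cases "j < h")
    case True
    then obtain r where r: "route (P\<langle>i,j\<rangle>) h (if p = j then i else p) r"
      "word_cong (insert h P) (w @ [(i, j)]) (hop P p i j @ r)"
      using jump by blast
    have hp: "valid_word P (hop P p i j)" "endpoint P (hop P p i j) = P\<langle>i,j\<rangle>"
      using hop_valid jump by auto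
    \<comment> \<open>Both possible moves of \<open>hop\<close> start below \<open>h\<close>, so the
      first jump commutes with them; the rest of the route is left to the induction
      hypothesis.\<close>
    have "word_cong (insert q P) ((h, q) # hop P p i j) (hop P p i j @ [(h, q)])"
    proof (rule word_cong_commute)
      show "valid_word (insert q P) (hop P p i j)"
      proof -
        have "tri (insert p (insert q P)) i j" using jump by (auto intro: tri_mono)
        moreover have "hop (insert q P) p i j = hop P p i j" using ph \<open>h < q\<close> by (simp add: hop_def)
        ultimately show ?thesis using hop_valid[of j "insert q P" i p] jump by simp
      qed
      show "\<forall>(x, y)\<in>set (hop P p i j). y < h" using True by (auto simp: hop_def)
    qed (use h tri_h in auto)
    then have 1: "word_cong (insert q P) ((h, q) # hop P p i j @ r) (hop P p i j @ (h, q) # r)"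
      using word_cong_append_right[of "insert q P" "(h, q) # hop P p i j" "hop P p i j @ [(h, q)]" r]
        word_cong_sound[OF r(2)] by (simp add: swap_h valid_word_append)
    have 2: "word_cong (insert q P) ((h, q) # w @ [(i, j)]) ((h, q) # hop P p i j @ r)"
      using h tri_h swap_h r(2) by (intro word_cong_Cons) auto
    have "route (P\<langle>i,j\<rangle>) q (if p = j then i else p) ((h, q) # r)"
      using jump True ij r(1) by (intro route.jump) (auto simp: swap_in_def)
    then show ?thesis using word_cong.trans[OF 2 1] by auto
  next
    case False
    \<comment> \<open>The first jump has passed over \<open>j\<close>. When \<open>j\<close> moves
      earlier, its place becomes the first hole below \<open>q\<close>, so from here on every new
      route begins with \<open>(j, q)\<close>.\<close>
    then have hj: "h < j" using jump by (metis linorder_neqE_nat)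
    have pj: "p \<noteq> j" using hj ph by simp
    have jq: "{j<..<q} \<subseteq> P\<langle>i,j\<rangle>" "j \<notin> P\<langle>i,j\<rangle>"
      using hj ij jump by (auto simp: swap_in_def subset_iff)
    have v: "valid_word (insert q P) ((h, q) # w @ [(i, j)])"
      using jump h tri_h swap_h w by (simp add: valid_word_append)
    show ?thesis
    proof (cases "p = h")
      case True
      have "w = []" using jump True route_unique route.stop by blast
      \<comment> \<open>This is \<open>below\<close> if \<open>h \<le> i\<close>. Otherwise the
        token resting at \<open>h\<close> fills a hole between \<open>i\<close> and
        \<open>j\<close>, and \<open>across\<close> applies.\<close>
      have R: "word_rel (insert q P) [(h, q), (i, j)] (hop P p i j @ [(j, q), (h, j)])"
        using True hj jump by (auto simp: hop_def intro: word_rel.intros)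
      have "route (P\<langle>i,j\<rangle>) j h [(h, j)]"
      proof (cases "i = h")
        case True
        then show ?thesis using hj jump(2) \<open>j < q\<close> by (intro route.merge) (auto simp: swap_in_def subset_iff le_less)
      next
        case False
        then show ?thesis using hj jump(2,3) \<open>j < q\<close>
          by (intro route.jump route.stop) (auto simp: swap_in_def subset_iff le_less)
      qed
      then have "route (P\<langle>i,j\<rangle>) q h [(j, q), (h, j)]"
        using jq \<open>j < q\<close> by (metis route.jump)
      moreover have "word_cong (insert q P) [(h, q), (i, j)] (hop P p i j @ [(j, q), (h, j)])"
        using R v \<open>w = []\<close> by (auto intro: word_cong.rel)
      ultimately show ?thesis using True pj \<open>w = []\<close> by (auto intro!: exI[of _ "[(j, q), (h, j)]"])
    next
      case False
      then have lt: "p < h" using ph by simp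
      \<comment> \<open>The large token has gone on from \<open>h\<close>, which is a hole again;
        the move \<open>(i, j)\<close> cannot pass over it.\<close>
      have hi: "h \<le> i" 
      proof (rule ccontr)
        assume "\<not> h \<le> i"
        then have "h \<in> insert p P" using \<open>tri (insert p P) i j\<close> hj by (simp add: tri_def)
        then show False using \<open>h \<notin> P\<close> lt by simp
      qed
      have hop: "hop P p i j = [(i, j)]" using lt hi by (simp add: hop_def)
      \<comment> \<open>The last fact lets the route start at \<open>j\<close> instead of
        \<open>h\<close> once the positions from \<open>h\<close> up to \<open>j\<close> are filled.
        It serves the case \<open>i = h\<close>.\<close>
      obtain x w2 where x: "w = (x, h) # w2" "x < h" "\<forall>(a, b)\<in>set w2. b < h"
        "\<And>Q. (\<And>y. y < h \<Longrightarrow> y \<in> P \<longleftrightarrow> y \<in> Q) \<Longrightarrow> {h..<j} \<subseteq> Q \<Longrightarrow> route Q j p ((x, j) # w2)"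
        using jump(4)
      proof (cases rule: route.cases)
        case stop
        then show ?thesis using lt by simp
      next
        case merge
        show ?thesis
        proof (rule that[OF merge(1)])
          fix Q assume Q: "\<And>y. y < h \<Longrightarrow> y \<in> P \<longleftrightarrow> y \<in> Q" "{h..<j} \<subseteq> Q"
          have "y \<in> Q" if "y \<in> {p..<j}" for y
            using that Q merge by (cases "y < h") (auto simp: subset_iff)
          then show "route Q j p [(p, j)]" using lt hj by (intro route.merge) auto
        qed (use lt in auto)
      next
        case (jump x w2)
        show ?thesis
        proof (rule that[OF jump(1,2)])
          show "\<forall>(a, b)\<in>set w2. b < h" using route_sources[OF jump(5)] jump(2) by fastforce
          fix Q assume Q: "\<And>y. y < h \<Longrightarrow> y \<in> P \<longleftrightarrow> y \<in> Q" "{h..<j} \<subseteq> Q"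
          have "y \<in> Q" if "y \<in> {x<..<j}" for y
            using that Q jump(3) by (cases "y < h") (auto simp: subset_iff)
          moreover have "route Q x p w2" using jump(2) Q(1) by (intro route_agree[OF jump(5)]) auto
          ultimately show "route Q j p ((x, j) # w2)" using jump(2,4) Q(1) hj
            by (intro route.jump) auto
        qed
      qed
      have agree: "y \<in> P \<longleftrightarrow> y \<in> P\<langle>i,j\<rangle>" if "y < h" for y
        using that hi hj by (auto simp: swap_in_def)
      have run: "{h<..<j} \<subseteq> P\<langle>i,j\<rangle>" using \<open>{h<..<q} \<subseteq> P\<close> \<open>j < q\<close> by (auto simp: swap_in_def subset_iff)
      show ?thesis
      proof (cases "h < i")
        case True
        have "tri (insert h P) i j" using \<open>tri (insert p P) i j\<close> lt True by (auto simp: tri_def)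
        then have "word_cong (insert h P) ((i, j) # w) (w @ [(i, j)])"
          using w jump True x(1,3) by (intro word_cong_commute) auto
        then have 1: "word_cong (insert q P) ((h, q) # w @ [(i, j)]) ([(h, q), (i, j)] @ w)"
          using h tri_h swap_h word_cong.sym by (auto intro: word_cong_Cons)
        have v1: "valid_word (insert q P) [(h, q), (i, j)]" "valid_word (endpoint (insert q P) [(h, q), (i, j)]) w"
          using word_cong_sound[OF 1] unfolding valid_word_append by blast+
        \<comment> \<open>The hole \<open>h\<close> lies below \<open>i\<close> and survives the
          move, so the large token stops at \<open>j\<close>, then at \<open>h\<close>, and
          continues by the old \<open>w\<close>.\<close>
        have "word_rel (insert q P) [(h, q), (i, j)] [(i, j), (j, q), (h, j)]"
          using hj jump hi by (intro word_rel.below) auto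
        then have 2: "word_cong (insert q P) ([(h, q), (i, j)] @ w) ([(i, j), (j, q), (h, j)] @ w)"
          using v1 by (intro word_cong_append_right word_cong.rel)
        have "route (P\<langle>i,j\<rangle>) q p ((j, q) # (h, j) # w)"
          using jq \<open>j < q\<close> hj run True \<open>h \<notin> P\<close> agree
          by (intro route.jump route_agree[OF jump(4)]) (auto simp: swap_in_def)
        then show ?thesis using word_cong.trans[OF 1 2] pj hop by auto
      next
        case False
        then have i: "i = h" using hi by simp
        have xw: "1 \<le> x" "tri (insert h P) x h" "valid_word ((insert h P)\<langle>x,h\<rangle>) w2" using w(1) x(1) by auto
        have "tri ((insert h P)\<langle>x,h\<rangle>) i j"
          using \<open>tri (insert p P) i j\<close> lt i by (auto simp: tri_def swap_in_def)
        then have "word_cong ((insert h P)\<langle>x,h\<rangle>) ((i, j) # w2) (w2 @ [(i, j)])"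
          using xw jump i x(3) by (intro word_cong_commute) auto
        then have "word_cong (insert h P) (w @ [(i, j)]) ((x, h) # (i, j) # w2)"
          using xw x(1) word_cong.sym by (auto intro: word_cong_Cons)
        then have 1: "word_cong (insert q P) ((h, q) # w @ [(i, j)]) ([(h, q), (x, h), (i, j)] @ w2)"
          using h tri_h swap_h by (auto intro: word_cong_Cons)
        have v1: "valid_word (insert q P) [(h, q), (x, h), (i, j)]"
          "valid_word (endpoint (insert q P) [(h, q), (x, h), (i, j)]) w2"
          using word_cong_sound[OF 1] unfolding valid_word_append by blast+
        \<comment> \<open>Here \<open>(i, j)\<close> fills the hole \<open>h = i\<close>, so the new
          route passes over it, from \<open>j\<close> straight to \<open>x\<close>.\<close>
        have "word_rel (insert q P) [(h, q), (x, h), (i, j)] [(i, j), (j, q), (x, j)]"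
          unfolding i using hj x(2) \<open>h \<notin> P\<close> \<open>h < q\<close> \<open>j \<in> P\<close> \<open>j < q\<close> by (intro word_rel.through) auto
        then have 2: "word_cong (insert q P) ([(h, q), (x, h), (i, j)] @ w2) ([(i, j), (j, q), (x, j)] @ w2)"
          using v1 by (intro word_cong_append_right word_cong.rel)
        have "y \<in> P\<langle>i,j\<rangle>" if "y \<in> {h..<j}" for y
          using that run i by (cases "y = h") (auto simp: swap_in_def subset_iff)
        then have "route (P\<langle>i,j\<rangle>) j p ((x, j) # w2)"
          using agree by (intro x(4)) auto
        then have "route (P\<langle>i,j\<rangle>) q p ((j, q) # (x, j) # w2)"
          using jq \<open>j < q\<close> by (metis route.jump)
        then show ?thesis using word_cong.trans[OF 1 2] pj hop by auto
      qed
    qed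
  qed
qed

section \<open>Normal form of words and completeness of the relations\<close>

lemma word_act_outside: "valid_word A w \<Longrightarrow> \<forall>x\<in>A. x < a \<Longrightarrow> word_act w a = a"
proof (induction w arbitrary: A)
  case (Cons m w)
  obtain i j where m: "m = (i, j)" by force
  have "i < j" "j \<in> A" using Cons.prems tri_less[of A i j] tri_mem[of A i j] by (auto simp: m)
  then have lt: "i < a" "j < a" using Cons.prems by auto
  then have "\<forall>x\<in>A\<langle>i,j\<rangle>. x < a" using Cons.prems by (auto simp: swap_in_def)
  then show ?case using Cons lt by (auto simp: m)
qed auto

text \<open>By induction on the word, one move is appended to a word already in the form
  \<open>w1 @ r\<close>. A move starting in \<open>P\<close> is one of the smaller tokens, possibly
  taking the merged large one along, and is pulled forward by \<open>route_step\<close>; any other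
  move is made by the large token alone and extends its route.\<close>

lemma word_factor:
  assumes "valid_word (insert a A) w" "\<forall>x\<in>A. x < a" "1 \<le> a"
  shows "\<exists>w1 p r. valid_word A w1 \<and> 1 \<le> p \<and> route (endpoint A w1) a p r \<and> word_cong (insert a A) w (w1 @ r)"
  using assms(1)
proof (induction w rule: rev_induct)
  case Nil
  then show ?case using assms(3)
    by (intro exI[of _ "[]"] exI[of _ a]) (auto intro: route.stop word_cong.refl)
next
  case (snoc m w)
  obtain i j where m: "m = (i, j)" by force
  from snoc obtain w1 p r where w1: "valid_word A w1" "1 \<le> p" "route (endpoint A w1) a p r"
    "word_cong (insert a A) w (w1 @ r)" by (auto simp: valid_word_append)
  define P where "P = endpoint A w1"
  have P: "\<forall>x\<in>P. x < a" unfolding P_def using endpoint_less w1(1) assms(2) by blast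
  then have aP: "a \<notin> P" by blast
  have w1': "valid_word (insert a A) w1" "endpoint (insert a A) w1 = insert a P"
    using valid_word_insert[OF w1(1) assms(2)] P_def by auto
  have r: "valid_word (insert a P) r" "endpoint (insert a P) r = insert p P"
    using route_valid[of P a p r] w1 aP by (auto simp: P_def)
  have "endpoint (insert a A) w = insert p P"
    using word_cong_sound[OF w1(4)] w1' r by (simp add: endpoint_append)
  then have ij: "1 \<le> i" "tri (insert p P) i j"
    using snoc.prems by (auto simp: valid_word_append m)
  have 1: "word_cong (insert a A) (w @ [m]) (w1 @ r @ [(i, j)])"
    using word_cong_append_right[OF w1(4), of "[m]"] snoc.prems by (simp add: valid_word_append m)
  show ?case
  proof (cases "j \<in> P")
    case True
    obtain r' where r': "route (P\<langle>i,j\<rangle>) a (if p = j then i else p) r'"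
      "word_cong (insert a P) (r @ [(i, j)]) (hop P p i j @ r')"
      using route_step[of P a p r j i] w1 aP True P ij by (auto simp: P_def)
    have h: "valid_word P (hop P p i j)" "endpoint P (hop P p i j) = P\<langle>i,j\<rangle>"
      using hop_valid[OF True ij] by auto
    have "word_cong (insert a A) (w1 @ r @ [(i, j)]) (w1 @ hop P p i j @ r')"
      using r'(2) w1' by (intro word_cong_append_left) auto
    then have "word_cong (insert a A) (w @ [m]) ((w1 @ hop P p i j) @ r')"
      using 1 word_cong.trans by fastforce
    moreover have "valid_word A (w1 @ hop P p i j)" "endpoint A (w1 @ hop P p i j) = P\<langle>i,j\<rangle>"
      using w1 h by (auto simp: valid_word_append endpoint_append P_def)
    ultimately show ?thesis using r'(1) ij(1) w1(2) by (metis (full_types))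
  next
    case False
    then have "p = j" using tri_mem[OF ij(2)] by simp
    moreover have "{i<..<p} \<subseteq> P" "i < p" using ij(2) \<open>p = j\<close> by (auto simp: tri_def)
    ultimately have "route P a i (r @ [(i, j)])"
      using route_extend[of P a p r i] w1(3) False by (simp add: P_def)
    then show ?thesis using w1 1 ij by (auto simp: P_def)
  qed
qed

text \<open>Two parallel words with the same action factor, up to congruence, through the same route of
  the largest token, so the words on the smaller tokens may be compared by induction.\<close>

theorem word_cong_complete:
  assumes "finite A" "\<forall>x\<in>A. 1 \<le> x" "valid_word A w" "valid_word A v" "\<forall>x\<in>A. word_act w x = word_act v x"
  shows "word_cong A w v"
  using assms
proof (induction A arbitrary: w v rule: finite_linorder_max_induct)
  case empty
  have "w = []" if "valid_word {} w" for w
    using that by (cases w) (auto simp: tri_def)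
  then show ?case using empty by (auto intro: word_cong.refl)
next
  case (insert a A)
  have a: "1 \<le> a" "\<forall>x\<in>A. x < a" "a \<notin> A" using insert by auto
  \<comment> \<open>The word \<open>w1\<close> fixes \<open>a\<close>, and \<open>r\<close> fixes
    the endpoint of \<open>w1\<close> pointwise. So the goal of the route and the action of
    \<open>w1\<close> on \<open>A\<close> are both read off from the action of
    \<open>w\<close>.\<close>
  have fac: "\<exists>w1 r. valid_word A w1 \<and> route (endpoint A w1) a (word_act w a) r \<and> word_cong (insert a A) w (w1 @ r)
     \<and> (\<forall>x\<in>A. word_act w1 x = word_act w x)" if wv: "valid_word (insert a A) w" for w
  proof -
    obtain w1 p r where w1: "valid_word A w1" "1 \<le> p" "route (endpoint A w1) a p r" "word_cong (insert a A) w (w1 @ r)"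
      using word_factor[OF wv a(2,1)] by blast
    have "a \<notin> endpoint A w1" using endpoint_less[OF w1(1) a(2)] by blast
    then have r: "word_act r a = p" "\<forall>x\<in>endpoint A w1. word_act r x = x" using route_valid[OF w1(3) _ w1(2)] by auto
    have s: "\<forall>x\<in>insert a A. word_act w x = word_act r (word_act w1 x)" using word_cong_sound[OF w1(4)] by (simp add: word_act_append)
    have "word_act w1 a = a" using word_act_outside w1(1) a(2) by blast
    then have "word_act w a = p" using s r by auto
    moreover have "\<forall>x\<in>A. word_act w1 x = word_act w x" using s r w1(1) by (auto simp: endpoint_eq_image)
    ultimately show ?thesis using w1 by blast
  qed
  obtain w1 r where w1: "valid_word A w1" "route (endpoint A w1) a (word_act w a) r" "word_cong (insert a A) w (w1 @ r)"
    "\<forall>x\<in>A. word_act w1 x = word_act w x" using fac insert.prems by blast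
  obtain v1 r' where v1: "valid_word A v1" "route (endpoint A v1) a (word_act v a) r'" "word_cong (insert a A) v (v1 @ r')"
    "\<forall>x\<in>A. word_act v1 x = word_act v x" using fac insert.prems by blast
  have "word_cong A w1 v1" using insert w1 v1 by auto
  then have e: "word_cong (insert a A) w1 v1" using a word_cong_insert by blast
  have "endpoint A w1 = endpoint A v1" using word_cong_sound[OF \<open>word_cong A w1 v1\<close>] by blast
  then have "r = r'" using w1 v1 insert.prems route_unique by auto
  moreover have "valid_word (endpoint (insert a A) w1) r" using word_cong_sound[OF w1(3)] by (auto simp: valid_word_append)
  ultimately have "word_cong (insert a A) (w1 @ r) (v1 @ r')" using e word_cong_append_right by blast
  then show ?case using w1(3) v1(3) word_cong.trans word_cong.sym by blast
qed

text \<open>The smaller tokens go to their goals first; then \<open>a\<close> follows by a route,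
  which leaves them in place.\<close>

theorem word_exists:
  assumes "finite A" "\<forall>x\<in>A. 1 \<le> f x \<and> f x \<le> x"
  shows "\<exists>w. valid_word A w \<and> (\<forall>x\<in>A. word_act w x = f x)"
  using assms
proof (induction A rule: finite_linorder_max_induct)
  case empty
  then show ?case by (intro exI[of _ "[]"]) auto
next
  case (insert a A)
  then obtain w where w: "valid_word A w" "\<forall>x\<in>A. word_act w x = f x" by auto
  have a: "\<forall>x\<in>A. x < a" using insert by auto
  obtain r where r: "route (endpoint A w) a (f a) r" using route_exists insert.prems by blast
  have "a \<notin> endpoint A w" using endpoint_less[OF w(1) a] by blast
  then have r': "valid_word (insert a (endpoint A w)) r" "word_act r a = f a" "\<forall>x\<in>endpoint A w. word_act r x = x"
    using route_valid[OF r] insert.prems by auto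
  have "word_act w a = a" using word_act_outside w(1) a by blast
  then show ?case using w r' valid_word_insert[OF w(1) a]
    by (intro exI[of _ "w @ r"]) (auto simp: valid_word_append word_act_append endpoint_eq_image)
qed

section \<open>Linear maps on finitely supported functions\<close>

lemma lookup_pm_scale [simp]: "Poly_Mapping.lookup (pm_scale c f) x = c * Poly_Mapping.lookup f x"
  by (simp add: pm_scale_def Poly_Mapping.map.rep_eq when_def)

lemma pm_scale_simps [simp]:
  "pm_scale c 0 = 0" "pm_scale 0 f = 0" "pm_scale 1 f = f"
  "pm_scale c (pm_scale d f) = pm_scale (c * d) f"
  "pm_scale c (Poly_Mapping.single x a) = Poly_Mapping.single x (c * a)"
  by (auto intro!: poly_mapping_eqI simp: lookup_single when_def)

lemma pm_scale_add: "pm_scale c (f + g) = pm_scale c f + pm_scale c g"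
  by (auto intro!: poly_mapping_eqI simp: lookup_add algebra_simps)

lemma pm_scale_add_left: "pm_scale (c + d) f = pm_scale c f + pm_scale d f"
  by (auto intro!: poly_mapping_eqI simp: lookup_add algebra_simps)

lemma pm_scale_minus1: "pm_scale (-1) f = - f"
  by (auto intro!: poly_mapping_eqI)

lemma pm_scale_sum: "pm_scale c (sum f S) = (\<Sum>x\<in>S. pm_scale c (f x))"
  by (induction S rule: infinite_finite_induct) (auto simp: pm_scale_add)

lemma keys_pm_scale: "Poly_Mapping.keys (pm_scale c f) \<subseteq> Poly_Mapping.keys f"
  by (auto simp: in_keys_iff)

lemma keys_sum_subset: "(\<And>x. x \<in> S \<Longrightarrow> Poly_Mapping.keys (f x) \<subseteq> T) \<Longrightarrow> Poly_Mapping.keys (sum f S) \<subseteq> T"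
proof (induction S rule: infinite_finite_induct)
  case (insert x S)
  then have "Poly_Mapping.keys (f x) \<union> Poly_Mapping.keys (sum f S) \<subseteq> T" by auto
  then show ?case using insert Poly_Mapping.keys_add[of "f x" "sum f S"] by auto
qed auto

lemma lookup_sum: "Poly_Mapping.lookup (sum f S) x = (\<Sum>y\<in>S. Poly_Mapping.lookup (f y) x)"
  by (induction S rule: infinite_finite_induct) (auto simp: lookup_add)

lemma pm_expand:
  assumes "finite S" "Poly_Mapping.keys f \<subseteq> S"
  shows "f = (\<Sum>x\<in>S. Poly_Mapping.single x (Poly_Mapping.lookup f x))"
  using assms by (intro poly_mapping_eqI)
    (auto simp: lookup_sum lookup_single when_def in_keys_iff subset_iff)

definition pm_linear :: "(('m \<Rightarrow>\<^sub>0 'k::field) \<Rightarrow> ('l \<Rightarrow>\<^sub>0 'k)) \<Rightarrow> bool" where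
  "pm_linear \<phi> \<longleftrightarrow> (\<forall>f g. \<phi> (f + g) = \<phi> f + \<phi> g) \<and> (\<forall>c f. \<phi> (pm_scale c f) = pm_scale c (\<phi> f))"

lemma pm_linearD:
  assumes "pm_linear \<phi>"
  shows "\<phi> (f + g) = \<phi> f + \<phi> g" "\<phi> (pm_scale c f) = pm_scale c (\<phi> f)" "\<phi> 0 = 0"
    "\<phi> (- f) = - \<phi> f" "\<phi> (f - g) = \<phi> f - \<phi> g" "\<phi> (sum F S) = (\<Sum>x\<in>S. \<phi> (F x))"
proof -
  have a: "\<phi> (f + g) = \<phi> f + \<phi> g" for f g using assms by (simp add: pm_linear_def)
  have s: "\<phi> (pm_scale c f) = pm_scale c (\<phi> f)" for c f using assms by (simp add: pm_linear_def)
  have z: "\<phi> 0 = 0" using s[of 0 0] by simp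
  have m: "\<phi> (- f) = - \<phi> f" for f using s[of "-1" f] by (simp add: pm_scale_minus1)
  show "\<phi> (f + g) = \<phi> f + \<phi> g" "\<phi> (pm_scale c f) = pm_scale c (\<phi> f)" "\<phi> 0 = 0" "\<phi> (- f) = - \<phi> f"
    using a s z m by auto
  show "\<phi> (f - g) = \<phi> f - \<phi> g" using a[of f "- g"] m[of g] by simp
  show "\<phi> (sum F S) = (\<Sum>x\<in>S. \<phi> (F x))"
    by (induction S rule: infinite_finite_induct) (auto simp: a z)
qed

text \<open>Testing only the support of \<open>f\<close> makes the rule fit identities that hold on
  a span such as \<open>PF_span n\<close> but not on the whole space.\<close>

lemma pm_linear_eqI:
  assumes "pm_linear \<phi>" "pm_linear \<psi>" "\<And>x. x \<in> Poly_Mapping.keys f \<Longrightarrow> \<phi> (Poly_Mapping.single x 1) = \<psi> (Poly_Mapping.single x 1)"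
  shows "\<phi> f = \<psi> f"
proof -
  define c where "c = Poly_Mapping.lookup f"
  have f: "f = (\<Sum>x\<in>Poly_Mapping.keys f. pm_scale (c x) (Poly_Mapping.single x 1))"
    using pm_expand[of "Poly_Mapping.keys f" f] by (simp add: c_def)
  have \<phi>: "\<phi> f = (\<Sum>x\<in>Poly_Mapping.keys f. pm_scale (c x) (\<phi> (Poly_Mapping.single x 1)))"
    if "pm_linear \<phi>" for \<phi> :: "('a \<Rightarrow>\<^sub>0 'b) \<Rightarrow> ('c \<Rightarrow>\<^sub>0 'b)"
    using arg_cong[OF f, of \<phi>] by (simp only: pm_linearD[OF that])
  show ?thesis
    unfolding \<phi>[OF assms(1)] \<phi>[OF assms(2)] by (intro sum.cong) (simp_all only: assms(3))
qed

lemma pm_linear_compose: "pm_linear \<phi> \<Longrightarrow> pm_linear \<psi> \<Longrightarrow> pm_linear (\<lambda>f. \<phi> (\<psi> f))"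
  by (simp add: pm_linear_def)

definition lin_ext :: "('m \<Rightarrow> ('l \<Rightarrow>\<^sub>0 'k)) \<Rightarrow> ('m \<Rightarrow>\<^sub>0 'k::field) \<Rightarrow> ('l \<Rightarrow>\<^sub>0 'k)" where
  "lin_ext \<phi> f = (\<Sum>x\<in>Poly_Mapping.keys f. pm_scale (Poly_Mapping.lookup f x) (\<phi> x))"

lemma lin_ext_superset:
  assumes "finite S" "Poly_Mapping.keys f \<subseteq> S"
  shows "lin_ext \<phi> f = (\<Sum>x\<in>S. pm_scale (Poly_Mapping.lookup f x) (\<phi> x))"
  unfolding lin_ext_def using assms by (intro sum.mono_neutral_left) (auto simp: in_keys_iff)

lemma pm_linear_lin_ext: "pm_linear (lin_ext \<phi>)"
  unfolding pm_linear_def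
proof (intro conjI allI)
  fix f g :: "'a \<Rightarrow>\<^sub>0 'b" and c :: 'b
  let ?S = "Poly_Mapping.keys f \<union> Poly_Mapping.keys g"
  have S: "finite ?S" "Poly_Mapping.keys (f + g) \<subseteq> ?S" "Poly_Mapping.keys f \<subseteq> ?S" "Poly_Mapping.keys g \<subseteq> ?S"
    using Poly_Mapping.keys_add[of f g] by auto
  show "lin_ext \<phi> (f + g) = lin_ext \<phi> f + lin_ext \<phi> g"
    unfolding lin_ext_superset[OF S(1,2)] lin_ext_superset[OF S(1,3)] lin_ext_superset[OF S(1,4)]
    by (simp add: lookup_add pm_scale_add_left sum.distrib)
  show "lin_ext \<phi> (pm_scale c f) = pm_scale c (lin_ext \<phi> f)"
    by (subst lin_ext_superset[OF finite_keys keys_pm_scale]) (simp add: lin_ext_def pm_scale_sum)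
qed

lemma lin_ext_single [simp]: "lin_ext \<phi> (Poly_Mapping.single x c) = pm_scale c (\<phi> x)"
  by (simp add: lin_ext_def)

lemma bilinear_ext_eq_left: "bilinear_ext b f g = lin_ext (\<lambda>x. lin_ext (b x) g) f"
  by (simp add: bilinear_ext_def lin_ext_def pm_scale_sum)

lemma bilinear_ext_eq_right: "bilinear_ext b f g = lin_ext (\<lambda>y. lin_ext (\<lambda>x. b x y) f) g"
  unfolding bilinear_ext_def lin_ext_def
  by (subst sum.swap) (simp add: pm_scale_sum mult.commute)

lemma pm_linear_bilinear_left: "pm_linear (\<lambda>f. bilinear_ext b f g)"
  by (simp add: bilinear_ext_eq_left pm_linear_lin_ext)

lemma pm_linear_bilinear_right: "pm_linear (bilinear_ext b f)"
  by (simp add: bilinear_ext_eq_right[abs_def] pm_linear_lin_ext)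

lemma bilinear_ext_single [simp]:
  "bilinear_ext b (Poly_Mapping.single x c) (Poly_Mapping.single y d) = pm_scale (c * d) (b x y)"
  by (simp add: bilinear_ext_eq_left)

lemma lookup_bilinear_ext:
  "Poly_Mapping.lookup (bilinear_ext b f g) m = (\<Sum>x\<in>Poly_Mapping.keys f. \<Sum>y\<in>Poly_Mapping.keys g.
     Poly_Mapping.lookup f x * Poly_Mapping.lookup g y * Poly_Mapping.lookup (b x y) m)"
  by (simp add: bilinear_ext_def lookup_sum)

lemma keys_bilinear_ext:
  assumes "\<And>x y. x \<in> Poly_Mapping.keys f \<Longrightarrow> y \<in> Poly_Mapping.keys g \<Longrightarrow> Poly_Mapping.keys (b x y) \<subseteq> T"
  shows "Poly_Mapping.keys (bilinear_ext b f g) \<subseteq> T"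
  unfolding bilinear_ext_def by (intro keys_sum_subset subset_trans[OF keys_pm_scale] assms)

text \<open>Serves \<open>push\<close> and \<open>sum_restr\<close>, whose multiplicativity is
  established only for paths of the quiver and for members of \<open>PF n\<close>; hence the
  restriction to the supports.\<close>

lemma bilinear_ext_map:
  assumes "pm_linear \<phi>" "\<And>x y. x \<in> Poly_Mapping.keys f \<Longrightarrow> y \<in> Poly_Mapping.keys g \<Longrightarrow>
    \<phi> (b x y) = bilinear_ext b' (\<phi> (Poly_Mapping.single x 1)) (\<phi> (Poly_Mapping.single y 1))"
  shows "\<phi> (bilinear_ext b f g) = bilinear_ext b' (\<phi> f) (\<phi> g)"
proof (rule pm_linear_eqI[where f = f])
  show "pm_linear (\<lambda>f. \<phi> (bilinear_ext b f g))"
    by (rule pm_linear_compose[OF assms(1) pm_linear_bilinear_left])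
  show "pm_linear (\<lambda>f. bilinear_ext b' (\<phi> f) (\<phi> g))"
    by (rule pm_linear_compose[OF pm_linear_bilinear_left assms(1)])
next
  fix x assume x: "x \<in> Poly_Mapping.keys f"
  show "\<phi> (bilinear_ext b (Poly_Mapping.single x 1) g) = bilinear_ext b' (\<phi> (Poly_Mapping.single x 1)) (\<phi> g)"
  proof (rule pm_linear_eqI[where f = g])
    show "pm_linear (\<lambda>g. \<phi> (bilinear_ext b (Poly_Mapping.single x 1) g))"
      by (rule pm_linear_compose[OF assms(1) pm_linear_bilinear_right])
    show "pm_linear (\<lambda>g. bilinear_ext b' (\<phi> (Poly_Mapping.single x 1)) (\<phi> g))"
      by (rule pm_linear_compose[OF pm_linear_bilinear_right assms(1)])
  qed (simp add: assms(2) x)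
qed

lemma bilinear_ext_assoc:
  assumes "\<And>x y z. x \<in> Poly_Mapping.keys e \<Longrightarrow> y \<in> Poly_Mapping.keys f \<Longrightarrow> z \<in> Poly_Mapping.keys g \<Longrightarrow>
    bilinear_ext b (b x y) (Poly_Mapping.single z 1) = bilinear_ext b (Poly_Mapping.single x 1) (b y z)"
  shows "bilinear_ext b (bilinear_ext b e f) g = bilinear_ext b e (bilinear_ext b f g)"
proof (rule pm_linear_eqI[where f = e])
  fix x assume x: "x \<in> Poly_Mapping.keys e"
  let ?s = "\<lambda>x. Poly_Mapping.single x 1"
  show "bilinear_ext b (bilinear_ext b (?s x) f) g = bilinear_ext b (?s x) (bilinear_ext b f g)"
  proof (rule pm_linear_eqI[where f = f])
    fix y assume y: "y \<in> Poly_Mapping.keys f"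
    show "bilinear_ext b (bilinear_ext b (?s x) (?s y)) g = bilinear_ext b (?s x) (bilinear_ext b (?s y) g)"
    proof (rule pm_linear_eqI[where f = g])
      show "pm_linear (\<lambda>g. bilinear_ext b (?s x) (bilinear_ext b (?s y) g))"
        by (rule pm_linear_compose[OF pm_linear_bilinear_right pm_linear_bilinear_right])
    qed (use x y assms in \<open>simp_all add: pm_linear_bilinear_right\<close>)
  qed (intro pm_linear_compose[OF pm_linear_bilinear_left pm_linear_bilinear_right]
      pm_linear_compose[OF pm_linear_bilinear_right pm_linear_bilinear_left])+
qed (intro pm_linear_compose[OF pm_linear_bilinear_left pm_linear_bilinear_left] pm_linear_bilinear_left)+

section \<open>Quotients of linear categories\<close>

text \<open>First isomorphism theorem for linear categories: \<open>\<rho>\<close> is the kernel of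
  the functor with hom maps \<open>\<Phi>\<close>, which are onto.\<close>

lemma lincat_iso_quot:
  assumes bij: "bij_betw \<phi> (lobj C) (lobj D)"
    and ker: "\<And>u v. u \<in> lobj C \<Longrightarrow> v \<in> lobj C \<Longrightarrow>
      \<rho> u v = {(f, g). f \<in> lhom C u v \<and> g \<in> lhom C u v \<and> \<Phi> u v f = \<Phi> u v g}"
    and img: "\<And>u v. u \<in> lobj C \<Longrightarrow> v \<in> lobj C \<Longrightarrow> \<Phi> u v ` lhom C u v = lhom D (\<phi> u) (\<phi> v)"
    and id: "\<And>u. u \<in> lobj C \<Longrightarrow> lid C u \<in> lhom C u u \<and> \<Phi> u u (lid C u) = lid D (\<phi> u)"
    and add: "\<And>u v f g. u \<in> lobj C \<Longrightarrow> v \<in> lobj C \<Longrightarrow> f \<in> lhom C u v \<Longrightarrow> g \<in> lhom C u v \<Longrightarrow>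
      ladd C u v f g \<in> lhom C u v \<and> \<Phi> u v (ladd C u v f g) = ladd D (\<phi> u) (\<phi> v) (\<Phi> u v f) (\<Phi> u v g)"
    and scale: "\<And>u v c f. u \<in> lobj C \<Longrightarrow> v \<in> lobj C \<Longrightarrow> f \<in> lhom C u v \<Longrightarrow>
      lscale C u v c f \<in> lhom C u v \<and> \<Phi> u v (lscale C u v c f) = lscale D (\<phi> u) (\<phi> v) c (\<Phi> u v f)"
    and comp: "\<And>u v w f g. u \<in> lobj C \<Longrightarrow> v \<in> lobj C \<Longrightarrow> w \<in> lobj C \<Longrightarrow> f \<in> lhom C u v \<Longrightarrow>
      g \<in> lhom C v w \<Longrightarrow> lcomp C u v w g f \<in> lhom C u w \<and>
        \<Phi> u w (lcomp C u v w g f) = lcomp D (\<phi> u) (\<phi> v) (\<phi> w) (\<Phi> v w g) (\<Phi> u v f)"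
  shows "lincat_iso (lincat_quot C \<rho>) D \<phi>"
proof -
  \<comment> \<open>The map \<open>\<Phi>\<close> is constant on a class, so the image of the class
    is a singleton.\<close>
  define F where "F u v X = the_elem (\<Phi> u v ` X)" for u v X
  have cls: "\<rho> u v `` {f} = {g \<in> lhom C u v. \<Phi> u v g = \<Phi> u v f}"
    if "u \<in> lobj C" "v \<in> lobj C" "f \<in> lhom C u v" for u v f
    using that ker by auto
  have F: "F u v (\<rho> u v `` {f}) = \<Phi> u v f" if "u \<in> lobj C" "v \<in> lobj C" "f \<in> lhom C u v" for u v f
  proof -
    have "\<Phi> u v ` (\<rho> u v `` {f}) = {\<Phi> u v f}" using that by (auto simp: cls)
    then show ?thesis by (simp add: F_def)
  qed
  \<comment> \<open>The operations of \<open>lincat_quot\<close> return the image under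
    \<open>\<rho>\<close> of all results on representatives; a nonempty subset of one class has that
    class as image.\<close>
  have img_cls: "\<rho> u v `` S = \<rho> u v `` {f}"
    if "u \<in> lobj C" "v \<in> lobj C" "f \<in> S" "S \<subseteq> {g \<in> lhom C u v. \<Phi> u v g = \<Phi> u v f}" for u v f S
    using that ker by auto
  have quot: "X \<in> lhom C u v // \<rho> u v \<longleftrightarrow> (\<exists>f\<in>lhom C u v. X = \<rho> u v `` {f})" for X u v
    by (auto simp: quotient_def)
  have inj: "bij_betw (F u v) (lhom C u v // \<rho> u v) (lhom D (\<phi> u) (\<phi> v))"
    if uv: "u \<in> lobj C" "v \<in> lobj C" for u v
  proof (rule bij_betw_imageI)
    show "inj_on (F u v) (lhom C u v // \<rho> u v)"
    proof (rule inj_onI)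
      fix X Y assume "X \<in> lhom C u v // \<rho> u v" "Y \<in> lhom C u v // \<rho> u v" and XY: "F u v X = F u v Y"
      then obtain f g where "f \<in> lhom C u v" "X = \<rho> u v `` {f}" "g \<in> lhom C u v" "Y = \<rho> u v `` {g}"
        unfolding quot by blast
      then show "X = Y" using XY uv by (simp add: F) (simp add: cls)
    qed
    show "F u v ` (lhom C u v // \<rho> u v) = lhom D (\<phi> u) (\<phi> v)"
    proof -
      have "F u v ` (lhom C u v // \<rho> u v) = (\<lambda>f. F u v (\<rho> u v `` {f})) ` lhom C u v"
        by (auto simp: quotient_def)
      also have "\<dots> = \<Phi> u v ` lhom C u v" using F uv by simp
      finally show ?thesis using img uv by simp
    qed
  qed
  show ?thesis
    unfolding lincat_iso_def
  proof (intro conjI exI[of _ F] ballI allI)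
    show "bij_betw \<phi> (lobj (lincat_quot C \<rho>)) (lobj D)" using bij by (simp add: lincat_quot_def)
  next
    fix u assume "u \<in> lobj (lincat_quot C \<rho>)"
    then show "F u u (lid (lincat_quot C \<rho>) u) = lid D (\<phi> u)"
      using id by (simp add: lincat_quot_def F)
  next
    fix u v assume "u \<in> lobj (lincat_quot C \<rho>)" "v \<in> lobj (lincat_quot C \<rho>)"
    then have uv: "u \<in> lobj C" "v \<in> lobj C" by (auto simp: lincat_quot_def)
    show "bij_betw (F u v) (lhom (lincat_quot C \<rho>) u v) (lhom D (\<phi> u) (\<phi> v))"
      using inj[OF uv] by (simp add: lincat_quot_def)
    fix X assume "X \<in> lhom (lincat_quot C \<rho>) u v"
    then obtain f where f: "f \<in> lhom C u v" "X = \<rho> u v `` {f}" by (auto simp: lincat_quot_def quot)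
    show "F u v (lscale (lincat_quot C \<rho>) u v c X) = lscale D (\<phi> u) (\<phi> v) c (F u v X)" for c
    proof -
      have "\<rho> u v `` {lscale C u v c f' |f'. f' \<in> X} = \<rho> u v `` {lscale C u v c f}"
        by (rule img_cls) (use uv f scale[OF uv] in \<open>auto simp: cls\<close>)
      then show ?thesis using scale[OF uv f(1)] f uv by (simp add: lincat_quot_def F)
    qed
    show "F u v (ladd (lincat_quot C \<rho>) u v X Y) = ladd D (\<phi> u) (\<phi> v) (F u v X) (F u v Y)"
      if Y: "Y \<in> lhom (lincat_quot C \<rho>) u v" for Y
    proof -
      obtain g where g: "g \<in> lhom C u v" "Y = \<rho> u v `` {g}" using Y by (auto simp: lincat_quot_def quot)
      have "\<rho> u v `` {ladd C u v f' g' |f' g'. f' \<in> X \<and> g' \<in> Y} = \<rho> u v `` {ladd C u v f g}"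
        by (rule img_cls) (use uv f g add[OF uv] in \<open>auto simp: cls\<close>)
      then show ?thesis using add[OF uv f(1) g(1)] uv f g by (simp add: lincat_quot_def F)
    qed
    show "F u w (lcomp (lincat_quot C \<rho>) u v w Y X) = lcomp D (\<phi> u) (\<phi> v) (\<phi> w) (F v w Y) (F u v X)"
      if wY: "w \<in> lobj (lincat_quot C \<rho>)" "Y \<in> lhom (lincat_quot C \<rho>) v w" for w Y
    proof -
      have w: "w \<in> lobj C" using wY by (simp add: lincat_quot_def)
      obtain g where g: "g \<in> lhom C v w" "Y = \<rho> v w `` {g}" using wY by (auto simp: lincat_quot_def quot)
      have "\<rho> u w `` {lcomp C u v w g' f' |g' f'. g' \<in> Y \<and> f' \<in> X} = \<rho> u w `` {lcomp C u v w g f}"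
        by (rule img_cls) (use uv w f g comp[OF uv w] in \<open>auto simp: cls\<close>)
      then show ?thesis using comp[OF uv w f(1) g(1)] uv w f g by (simp add: lincat_quot_def F)
    qed
  qed
qed

section \<open>Bases of quotient spaces\<close>

text \<open>Here \<open>V\<close> is a quotient of \<open>W\<close> in which elements with the same
  coordinates \<open>\<kappa> d\<close> are identified, and the \<open>\<beta> d\<close> are dual to
  these coordinates. The vector space axioms of \<open>V\<close> are carried over from
  \<open>W\<close> along \<open>q\<close>.\<close>

lemma quotient_basis:
  fixes V :: "('k::field, 'v) module" and q :: "('m \<Rightarrow>\<^sub>0 'k) \<Rightarrow> 'v" and \<kappa> :: "'d \<Rightarrow> ('m \<Rightarrow>\<^sub>0 'k) \<Rightarrow> 'k"
  assumes V: "carrier V = q ` W" "zero V = q 0"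
      "\<And>x y. x \<in> W \<Longrightarrow> y \<in> W \<Longrightarrow> q x \<oplus>\<^bsub>V\<^esub> q y = q (x + y)"
      "\<And>c x. x \<in> W \<Longrightarrow> c \<odot>\<^bsub>V\<^esub> q x = q (pm_scale c x)"
    and W: "0 \<in> W" "\<And>x y. x \<in> W \<Longrightarrow> y \<in> W \<Longrightarrow> x + y \<in> W" "\<And>c x. x \<in> W \<Longrightarrow> pm_scale c x \<in> W"
    and \<kappa>: "\<And>d x y. \<kappa> d (x + y) = \<kappa> d x + \<kappa> d y" "\<And>d c x. \<kappa> d (pm_scale c x) = c * \<kappa> d x"
    and q: "\<And>x y. x \<in> W \<Longrightarrow> y \<in> W \<Longrightarrow> q x = q y \<longleftrightarrow> (\<forall>d\<in>D. \<kappa> d x = \<kappa> d y)"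
    and D: "finite D" "\<And>d. d \<in> D \<Longrightarrow> \<beta> d \<in> W"
      "\<And>d d'. d \<in> D \<Longrightarrow> d' \<in> D \<Longrightarrow> \<kappa> d (\<beta> d') = (if d = d' then 1 else 0)"
  shows "inj_on (\<lambda>d. q (\<beta> d)) D \<and> vectorspace.basis class_ring V ((\<lambda>d. q (\<beta> d)) ` D)"
proof
  let ?B = "(\<lambda>d. q (\<beta> d)) ` D"
  show inj: "inj_on (\<lambda>d. q (\<beta> d)) D"
  proof (rule inj_onI)
    fix d d' assume d: "d \<in> D" "d' \<in> D" "q (\<beta> d) = q (\<beta> d')"
    then have "\<kappa> d (\<beta> d) = \<kappa> d (\<beta> d')" using q D(2) by blast
    then show "d = d'" using d D(3) by (auto split: if_splits)
  qed
  have ab: "abelian_group V"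
  proof (rule abelian_groupI)
    fix x assume "x \<in> carrier V"
    then obtain a where a: "a \<in> W" "x = q a" by (auto simp: V)
    have "pm_scale (-1) a + a = 0" by (simp add: pm_scale_minus1)
    then show "\<exists>y\<in>carrier V. y \<oplus>\<^bsub>V\<^esub> x = \<zero>\<^bsub>V\<^esub>"
      using a V W by (intro bexI[of _ "q (pm_scale (-1) a)"]) (auto simp del: pm_scale_simps)
  qed (auto simp: V W add_ac)
  have mod: "module class_ring V"
  proof (intro module.intro module_axioms.intro ab)
    show "cring (class_ring :: 'k ring)" using class_field
      by (auto simp: field_def domain_def)
  qed (auto simp: V W class_ring_simps pm_scale_add pm_scale_add_left)
  interpret vectorspace class_ring V
    by (intro vectorspace.intro mod class_field)
  have BV: "?B \<subseteq> carrier V" using D V by auto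
  have sumW: "finite T \<Longrightarrow> T \<subseteq> D \<Longrightarrow> (\<Sum>d\<in>T. pm_scale (a (q (\<beta> d))) (\<beta> d)) \<in> W \<and>
      lincomb a ((\<lambda>d. q (\<beta> d)) ` T) = q (\<Sum>d\<in>T. pm_scale (a (q (\<beta> d))) (\<beta> d))" for a T
  proof (induction T rule: finite_induct)
    case empty
    then show ?case using V W by (simp add: lincomb_def)
  next
    case (insert d T)
    have "q (\<beta> d) \<notin> (\<lambda>d. q (\<beta> d)) ` T" using insert inj by (auto simp: inj_on_def)
    moreover have "(\<lambda>v. a v \<odot>\<^bsub>V\<^esub> v) \<in> (\<lambda>d. q (\<beta> d)) ` T \<rightarrow> carrier V" using insert D V W by auto
    moreover have "a (q (\<beta> d)) \<odot>\<^bsub>V\<^esub> q (\<beta> d) \<in> carrier V" using insert D V W by auto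
    ultimately show ?case using insert D V W by (simp add: lincomb_def M.finsum_insert)
  qed
  \<comment> \<open>The coefficients of a representation must be the coordinates; this yields both
    existence and uniqueness in \<open>basis_criterion\<close>.\<close>
  have lc: "lincomb a ?B = q x \<longleftrightarrow> (\<forall>d\<in>D. a (q (\<beta> d)) = \<kappa> d x)" if "x \<in> W" for a x
  proof -
    have \<kappa>0: "\<kappa> d 0 = 0" for d using \<kappa>(2)[of d 0 0] by simp
    have \<kappa>s: "\<kappa> d (sum f T) = (\<Sum>t\<in>T. \<kappa> d (f t))" if "finite T" for d T and f :: "'d \<Rightarrow> 'm \<Rightarrow>\<^sub>0 'k"
      using that by (induction T rule: finite_induct) (auto simp: \<kappa> \<kappa>0)
    have "\<kappa> d (\<Sum>t\<in>D. pm_scale (a (q (\<beta> t))) (\<beta> t)) = a (q (\<beta> d))" if "d \<in> D" for d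
    proof -
      have "\<kappa> d (\<Sum>t\<in>D. pm_scale (a (q (\<beta> t))) (\<beta> t)) = (\<Sum>t\<in>D. if d = t then a (q (\<beta> t)) else 0)"
        unfolding \<kappa>s[OF D(1)] using that D by (intro sum.cong) (auto simp: \<kappa>)
      then show ?thesis using that D by simp
    qed
    then show ?thesis using sumW[of D a] D q[OF _ that] by auto
  qed
  show "basis ?B"
    unfolding basis_criterion[OF finite_imageI[OF D(1)] BV]
  proof (intro allI impI ex_ex1I)
    fix v assume "v \<in> carrier V"
    then obtain x where x: "x \<in> W" "v = q x" by (auto simp: V)
    \<comment> \<open>The criterion speaks of extensional coefficient functions, hence the
      restriction to \<open>?B\<close>.\<close>
    let ?a = "restrict (\<lambda>v. \<kappa> (the_inv_into D (\<lambda>d. q (\<beta> d)) v) x) ?B"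
    show "\<exists>a. a \<in> ?B \<rightarrow>\<^sub>E carrier class_ring \<and> lincomb a ?B = v"
      using x lc the_inv_into_f_f[OF inj] by (intro exI[of _ ?a]) (auto simp: class_ring_simps)
    fix a a' assume "a \<in> ?B \<rightarrow>\<^sub>E carrier class_ring \<and> lincomb a ?B = v"
      "a' \<in> ?B \<rightarrow>\<^sub>E carrier class_ring \<and> lincomb a' ?B = v"
    then show "a = a'" using lc x by (intro PiE_ext[of a ?B "\<lambda>_. carrier class_ring"]) auto
  qed
qed

section \<open>Order-decreasing functions and paths\<close>

definition word_map :: "nat set \<Rightarrow> (nat \<times> nat) list \<Rightarrow> (nat \<rightharpoonup> nat)" where
  "word_map A w = (\<lambda>x. if x \<in> A then Some (word_act w x) else None)"

lemma dom_word_map [simp]: "dom (word_map A w) = A"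
  by (auto simp: word_map_def split: if_splits)

lemma ran_word_map: "valid_word A w \<Longrightarrow> ran (word_map A w) = endpoint A w"
  by (auto simp: word_map_def ran_def endpoint_eq_image split: if_splits)

lemma PF_I:
  assumes "dom f \<subseteq> {1..n}" "\<And>x y. f x = Some y \<Longrightarrow> 1 \<le> y \<and> y \<le> x"
  shows "f \<in> PF n"
proof -
  have "y \<in> {1..n}" if "f x = Some y" for x y
    using assms(1) assms(2)[OF that] domI[of f x y] that by (auto simp: subset_iff)
  then show ?thesis using assms by (auto simp: PF_def ran_def)
qed

lemma PF_D:
  assumes "f \<in> PF n"
  shows "dom f \<subseteq> {1..n}" "ran f \<subseteq> {1..n}" "f x = Some y \<Longrightarrow> 1 \<le> y \<and> y \<le> x" "finite (dom f)"
proof -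
  show d: "dom f \<subseteq> {1..n}" and r: "ran f \<subseteq> {1..n}" using assms by (auto simp: PF_def)
  show "f x = Some y \<Longrightarrow> 1 \<le> y \<and> y \<le> x" using assms r ranI[of f x y] by (auto simp: PF_def)
  show "finite (dom f)" using d finite_subset by blast
qed

lemma word_map_PF: "valid_word A w \<Longrightarrow> A \<subseteq> {1..n} \<Longrightarrow> word_map A w \<in> PF n"
  using word_act_bounds[of A w] by (intro PF_I) (auto simp: word_map_def split: if_splits)

lemma word_map_append:
  "valid_word A u \<Longrightarrow> word_map A (u @ v) = word_map (endpoint A u) v \<circ>\<^sub>m word_map A u"
  by (auto simp: word_map_def word_act_append endpoint_eq_image map_comp_def)

lemma word_map_Nil: "word_map A [] = Some |` A"
  by (auto simp: word_map_def restrict_map_def)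

lemma word_map_single: "word_map A [(i, j)] = d_map (i, j, A)"
  by (auto simp: word_map_def d_map_def)

lemma PF_word:
  assumes "f \<in> PF n"
  obtains w where "valid_word (dom f) w" "f = word_map (dom f) w"
proof -
  have "\<exists>w. valid_word (dom f) w \<and> (\<forall>x\<in>dom f. word_act w x = the (f x))"
    using PF_D[OF assms] by (intro word_exists) auto
  then obtain w where w: "valid_word (dom f) w" "\<forall>x\<in>dom f. word_act w x = the (f x)" by blast
  then have "f = word_map (dom f) w" by (auto simp: word_map_def fun_eq_iff domIff)
  with w that show thesis by blast
qed

lemma word_cong_iff_word_map:
  assumes "A \<subseteq> {1..n}" "valid_word A w" "valid_word A v" "word_map A w = word_map A v"
  shows "word_cong A w v"
proof (rule word_cong_complete)
  show "finite A" using assms(1) finite_subset by blast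
  have "word_act w x = word_act v x" if "x \<in> A" for x
    using fun_cong[OF assms(4), of x] that by (simp add: word_map_def)
  then show "\<forall>x\<in>A. word_act w x = word_act v x" by blast
qed (use assms in auto)

lemma restrict_id_simps [simp]:
  "dom (Some |` A) = A" "ran (Some |` A) = A"
  "(f \<circ>\<^sub>m (Some |` dom f)) = f" "((Some |` ran f) \<circ>\<^sub>m f) = f"
  by (auto simp: restrict_map_def ran_def map_comp_def dom_def fun_eq_iff split: option.splits if_splits)

lemma eq_restrict_id_I: "(\<And>x. x \<in> dom f \<Longrightarrow> f x = Some x) \<Longrightarrow> f = Some |` dom f"
  by (auto simp: restrict_map_def fun_eq_iff domIff)

lemma id_PF: "A \<subseteq> {1..n} \<Longrightarrow> Some |` A \<in> PF n"
  by (intro PF_I) (auto simp: restrict_map_def split: if_splits)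

lemma comp_PF: "f \<in> PF n \<Longrightarrow> g \<in> PF n \<Longrightarrow> f \<circ>\<^sub>m g \<in> PF n"
proof (rule PF_I)
  assume fg: "f \<in> PF n" "g \<in> PF n"
  have "dom (f \<circ>\<^sub>m g) \<subseteq> dom g" by (auto simp: dom_def map_comp_Some_iff)
  then show "dom (f \<circ>\<^sub>m g) \<subseteq> {1..n}" using PF_D(1)[OF fg(2)] by blast
  fix x y assume "(f \<circ>\<^sub>m g) x = Some y"
  then obtain z where "g x = Some z" "f z = Some y" by (auto simp: map_comp_Some_iff)
  then show "1 \<le> y \<and> y \<le> x" using PF_D(3)[OF fg(1), of z y] PF_D(3)[OF fg(2), of x z] by simp
qed

lemma dom_ran_comp:
  assumes "dom f = ran g"
  shows "dom (f \<circ>\<^sub>m g) = dom g" "ran (f \<circ>\<^sub>m g) = ran f"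
proof -
  have *: "\<exists>z. f y = Some z" if "g x = Some y" for x y
  proof -
    have "y \<in> dom f" using that assms by (auto intro: ranI)
    then show ?thesis by blast
  qed
  show "dom (f \<circ>\<^sub>m g) = dom g"
  proof (intro equalityI subsetI)
    fix x assume "x \<in> dom g"
    then obtain y where "g x = Some y" by blast
    with * show "x \<in> dom (f \<circ>\<^sub>m g)" by (auto simp: map_comp_Some_iff)
  qed (auto simp: map_comp_Some_iff)
  show "ran (f \<circ>\<^sub>m g) = ran f"
  proof (intro equalityI subsetI)
    fix z assume "z \<in> ran f"
    then obtain y where y: "f y = Some z" by (auto simp: ran_def)
    then have "y \<in> ran g" using assms by blast
    then obtain x where "g x = Some y" by (auto simp: ran_def)
    with y have "(f \<circ>\<^sub>m g) x = Some z" by simp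
    then show "z \<in> ran (f \<circ>\<^sub>m g)" by (rule ranI)
  qed (auto simp: ran_def map_comp_Some_iff)
qed

lemma partial_comp_assoc: "(f \<circ>\<^sub>m g) \<circ>\<^sub>m h = f \<circ>\<^sub>m (g \<circ>\<^sub>m h)"
  by (auto simp: map_comp_def fun_eq_iff split: option.splits)

lemma finite_PF: "finite (PF n)"
proof (rule finite_subset)
  show "PF n \<subseteq> (\<Union>A\<in>Pow {1..n}. {f. dom f = A \<and> ran f \<subseteq> {1..n}})"
  proof
    fix f assume "f \<in> PF n"
    then have "dom f \<in> Pow {1..n}" "ran f \<subseteq> {1..n}" using PF_D(1,2) by simp_all
    then show "f \<in> (\<Union>A\<in>Pow {1..n}. {f. dom f = A \<and> ran f \<subseteq> {1..n}})" by simp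
  qed
  have "finite {f :: nat \<rightharpoonup> nat. dom f = A \<and> ran f \<subseteq> {1..n}}" if "A \<in> Pow {1..n}" for A
    using that by (intro finite_set_of_finite_maps finite_subset[of A "{1..n}"]) simp_all
  then show "finite (\<Union>A\<in>Pow {1..n}. {f :: nat \<rightharpoonup> nat. dom f = A \<and> ran f \<subseteq> {1..n}})"
    by (intro finite_UN_I) simp_all
qed

text \<open>Passing to the range loses repeated values, and no value exceeds its argument. Equality
  of the sums therefore fixes every point.\<close>

lemma sum_ran_le:
  assumes "f \<in> PF n"
  shows "\<Sum>(ran f) \<le> \<Sum>(dom f)" "\<Sum>(ran f) = \<Sum>(dom f) \<Longrightarrow> f = Some |` dom f"
proof -
  note PF = PF_D[OF assms]
  have "ran f = (\<lambda>x. the (f x)) ` dom f" by (force simp: ran_def dom_def)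
  then have 1: "\<Sum>(ran f) \<le> (\<Sum>x\<in>dom f. the (f x))"
    using sum_image_le[OF PF(4), of "\<lambda>x. x" "\<lambda>x. the (f x)"] by simp
  have 2: "the (f x) \<le> x" if "x \<in> dom f" for x using that PF(3) by auto
  show "\<Sum>(ran f) \<le> \<Sum>(dom f)" using 1 sum_mono[OF 2] by (rule order_trans)
  assume eq: "\<Sum>(ran f) = \<Sum>(dom f)"
  have "the (f x) = x" if "x \<in> dom f" for x
  proof (rule ccontr)
    assume "the (f x) \<noteq> x"
    then have "the (f x) < x" using 2[OF that] by simp
    then have "(\<Sum>x\<in>dom f. the (f x)) < \<Sum>(dom f)"
      using 2 that PF(4) by (intro sum_strict_mono_ex1) auto
    then show False using 1 eq by simp
  qed
  then show "f = Some |` dom f" by (intro eq_restrict_id_I) (metis domD option.sel)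
qed

text \<open>So \<open>EF_cat\<close> has no endomorphisms besides identities, which makes the vertex
  idempotents primitive.\<close>

lemma endo_PF: "f \<in> PF n \<Longrightarrow> ran f = dom f \<Longrightarrow> f = Some |` dom f"
  by (rule sum_ran_le(2)) auto

text \<open>The sum of points cannot rise along \<open>g\<close> and \<open>f\<close>, yet it
  returns to its initial value; so neither factor lowers it.\<close>

lemma comp_eq_id:
  assumes "f \<in> PF n" "g \<in> PF n" "dom f = ran g" "f \<circ>\<^sub>m g = Some |` A"
  shows "f = Some |` A" "g = Some |` A"
proof -
  have A: "dom g = A" "ran f = A"
    using dom_ran_comp[OF assms(3)] unfolding assms(4) by auto
  then have "\<Sum>(ran f) = \<Sum>(dom f)" "\<Sum>(ran g) = \<Sum>(dom g)"
    using sum_ran_le(1)[OF assms(1)] sum_ran_le(1)[OF assms(2)] assms(3) by auto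
  then show "f = Some |` A" "g = Some |` A"
    using sum_ran_le(2)[OF assms(1)] sum_ran_le(2)[OF assms(2)] A assms(3) by auto
qed

section \<open>Arrows as the irreducible morphisms\<close>

lemma arrow_defined_iff: "arrow_defined n (i, j, A) \<longleftrightarrow> A \<subseteq> {1..n} \<and> valid_word A [(i, j)]"
  using tri_mem[of A i j] tri_less[of A i j] by (auto simp: arrow_defined_def)

abbreviation arrows :: "nat \<Rightarrow> (nat \<rightharpoonup> nat) set" where
  "arrows n \<equiv> d_map ` {a. arrow_defined n a}"

lemma arrow_not_id:
  assumes "arrow_defined n (i, j, A)"
  shows "d_map (i, j, A) \<in> PF n" "d_map (i, j, A) \<noteq> Some |` B"
proof -
  have v: "A \<subseteq> {1..n}" "valid_word A [(i, j)]" using assms arrow_defined_iff by auto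
  show "d_map (i, j, A) \<in> PF n" using word_map_PF[OF v(2,1)] by (simp add: word_map_single)
  have "i < j" "j \<in> A" using v tri_less tri_mem by auto
  then have "d_map (i, j, A) j \<noteq> (Some |` B) j" by (simp add: d_map_def restrict_map_def)
  then show "d_map (i, j, A) \<noteq> Some |` B" by metis
qed

text \<open>For \<open>x \<noteq> j\<close> the value \<open>g x\<close> is squeezed between
  \<open>f (g x) = x\<close> and \<open>x\<close>, so both factors fix \<open>x\<close>. The point
  \<open>j\<close> goes to \<open>i\<close> through some \<open>k\<close>; if \<open>k\<close> were
  strictly between, it would lie in \<open>A\<close> by \<open>tri\<close> and be fixed by
  \<open>f\<close>.\<close>

lemma arrow_irreducible:
  assumes "arrow_defined n (i, j, A)" "f \<in> PF n" "g \<in> PF n" "dom f = ran g" "f \<circ>\<^sub>m g = d_map (i, j, A)"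
  shows "f = Some |` dom f \<or> g = Some |` dom g"
proof -
  have v: "i < j" "j \<in> A" "\<And>x. i < x \<Longrightarrow> x \<le> j \<Longrightarrow> x \<in> A"
    using assms(1) by (auto simp: arrow_defined_def tri_def)
  have g: "dom g = A" using dom_ran_comp(1)[OF assms(4)] unfolding assms(5) by (simp add: d_map_dom)
  have fg: "\<exists>y. g x = Some y \<and> f y = Some (if x = j then i else x) \<and> (if x = j then i else x) \<le> y \<and> y \<le> x"
    if "x \<in> A" for x
    using fun_cong[OF assms(5), of x] that PF_D(3)[OF assms(2)] PF_D(3)[OF assms(3)]
    by (auto simp: d_map_def map_comp_Some_iff split: if_splits)
  have fx: "g x = Some x \<and> f x = Some x" if "x \<in> A" "x \<noteq> j" for x
    using fg[OF that(1)] that(2) by (auto dest: antisym)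
  obtain k where k: "g j = Some k" "f k = Some i" "i \<le> k" "k \<le> j" using fg[OF v(2)] by auto
  consider "k = j" | "k = i" | "i < k" "k < j" using k by linarith
  then show ?thesis
  proof cases
    case 1
    then have "\<And>x. x \<in> dom g \<Longrightarrow> g x = Some x" using fx k g by metis
    then show ?thesis by (intro disjI2 eq_restrict_id_I)
  next
    case 2
    have "f y = Some y" if y: "y \<in> dom f" for y
    proof -
      obtain x where x: "g x = Some y" using y assms(4) by (auto simp: ran_def)
      then have "x \<in> A" using g by auto
      then show ?thesis using fx[of x] k 2 x by (cases "x = j") auto
    qed
    then show ?thesis by (intro disjI1 eq_restrict_id_I)
  next
    case 3
    then show ?thesis using fx[of k] v(3)[of k] k by auto
  qed
qed

text \<open>Splits off the first arrow of a word for \<open>m\<close>; were the rest an identity,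
  \<open>m\<close> would be that arrow.\<close>

lemma non_arrow_factors:
  assumes "m \<in> PF n" "m \<noteq> Some |` dom m" "m \<notin> arrows n"
  obtains f g where "f \<in> PF n" "g \<in> PF n" "dom f = ran g" "m = f \<circ>\<^sub>m g"
    "f \<noteq> Some |` dom f" "g \<noteq> Some |` dom g"
proof -
  define A where "A = dom m"
  have A: "A \<subseteq> {1..n}" using PF_D[OF assms(1)] by (simp add: A_def)
  obtain w where w: "valid_word A w" "m = word_map A w" by (rule PF_word[OF assms(1), folded A_def])
  have "w \<noteq> []" using w(2) assms(2) word_map_Nil[of A] unfolding A_def by metis
  then obtain i j v where v: "w = (i, j) # v" by (cases w) auto
  have a: "arrow_defined n (i, j, A)" using w A by (simp add: v arrow_defined_iff)
  let ?B = "A\<langle>i,j\<rangle>"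
  have e: "m = word_map ?B v \<circ>\<^sub>m d_map (i, j, A)"
    using word_map_append[of A "[(i, j)]" v] w by (simp add: v word_map_single)
  have r: "ran (d_map (i, j, A)) = ?B" using d_map_ran[OF a] .
  have B: "?B \<subseteq> {1..n}" using PF_D(2)[OF arrow_not_id(1)[OF a]] r by simp
  show thesis
  proof (rule that[of "word_map ?B v" "d_map (i, j, A)"])
    show "word_map ?B v \<in> PF n" using w B by (intro word_map_PF) (auto simp: v)
    show "d_map (i, j, A) \<in> PF n" "d_map (i, j, A) \<noteq> Some |` dom (d_map (i, j, A))"
      using arrow_not_id[OF a] by auto
    show "word_map ?B v \<noteq> Some |` dom (word_map ?B v)"
    proof
      assume "word_map ?B v = Some |` dom (word_map ?B v)"
      then have "word_map ?B v = Some |` ran (d_map (i, j, A))" using r by simp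
      then have "m = d_map (i, j, A)" using e by simp
      then show False using assms(3) a by blast
    qed
  qed (use e r in auto)
qed

section \<open>Paths of the quiver and relations between them, as words\<close>

definition word_path :: "nat set \<Rightarrow> (nat \<times> nat) list \<Rightarrow> nat set \<times> (nat \<rightharpoonup> nat) list \<times> nat set" where
  "word_path A w = (A, map d_map (word_arrows A w), endpoint A w)"

definition path_map :: "nat set \<times> (nat \<rightharpoonup> nat) list \<times> nat set \<Rightarrow> (nat \<rightharpoonup> nat)" where
  "path_map = (\<lambda>(A, p, B). foldl (\<lambda>f d. d \<circ>\<^sub>m f) (Some |` A) p)"

lemma path_map_word_path: "valid_word A w \<Longrightarrow> path_map (word_path A w) = word_map A w"
proof (induction w rule: rev_induct)
  case Nil
  then show ?case by (simp add: path_map_def word_path_def word_map_Nil)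
next
  case (snoc m w)
  obtain i j where m: "m = (i, j)" by force
  show ?case using snoc word_map_append[of A w "[(i, j)]"]
    by (simp add: m valid_word_append path_map_def word_path_def word_arrows_append word_map_single)
qed

text \<open>Arcs are bare partial functions. The upper index of an arc is its domain, which is the
  point the walk has reached, so a walk carries the same data as a valid word.\<close>

lemma awalk_EF_quiver:
  assumes "A \<subseteq> {1..n}"
  shows "pre_digraph.awalk (EF_quiver n) A p B \<longleftrightarrow> (\<exists>w. valid_word A w \<and> (A, p, B) = word_path A w)"
  using assms
proof (induction p arbitrary: A)
  case Nil
  have w: "w = []" if "word_arrows A w = []" for w using that by (cases w) auto
  show ?case
  proof
    assume "pre_digraph.awalk (EF_quiver n) A [] B"
    then show "\<exists>w. valid_word A w \<and> (A, [], B) = word_path A w"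
      by (intro exI[of _ "[]"]) (simp add: pre_digraph.awalk_def pre_digraph.cas.simps word_path_def)
  next
    assume "\<exists>w. valid_word A w \<and> (A, [], B) = word_path A w"
    then obtain v where "word_arrows A v = []" "B = endpoint A v" by (auto simp: word_path_def)
    then have "A = B" using w[of v] by simp
    then show "pre_digraph.awalk (EF_quiver n) A [] B" using Nil
      by (auto simp: pre_digraph.awalk_def pre_digraph.cas.simps EF_quiver_def word_path_def)
  qed
next
  case (Cons d p)
  have ind: "pre_digraph.awalk (EF_quiver n) A (d # p) B \<longleftrightarrow>
    d \<in> arrows n \<and> dom d = A \<and> pre_digraph.awalk (EF_quiver n) (ran d) p B"
  proof -
    have "d \<in> arrows n \<Longrightarrow> ran d \<subseteq> {1..n}" using PF_D(2)[OF arrow_not_id(1)] by force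
    then show ?thesis using Cons.prems
      by (auto simp: pre_digraph.awalk_def pre_digraph.cas.simps EF_quiver_def)
  qed
  show ?case
  proof
    assume "pre_digraph.awalk (EF_quiver n) A (d # p) B"
    then have d: "d \<in> arrows n" "dom d = A" and p: "pre_digraph.awalk (EF_quiver n) (ran d) p B"
      using ind by auto
    then obtain i j where ij: "d = d_map (i, j, A)" "arrow_defined n (i, j, A)"
      by (force simp: d_map_dom)
    then have r: "ran d = A\<langle>i,j\<rangle>" "ran d \<subseteq> {1..n}"
      using d_map_ran[OF ij(2)] PF_D(2)[OF arrow_not_id(1)[OF ij(2)]] by auto
    then obtain w where "valid_word (A\<langle>i,j\<rangle>) w" "(A\<langle>i,j\<rangle>, p, B) = word_path (A\<langle>i,j\<rangle>) w"
      using Cons.IH[OF r(2)] p by auto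
    then show "\<exists>w. valid_word A w \<and> (A, d # p, B) = word_path A w"
      using ij by (intro exI[of _ "(i, j) # w"]) (auto simp: word_path_def arrow_defined_iff)
  next
    assume "\<exists>w. valid_word A w \<and> (A, d # p, B) = word_path A w"
    then obtain w where w: "valid_word A w" "(A, d # p, B) = word_path A w" by blast
    then obtain i j v where v: "w = (i, j) # v" by (cases w) (auto simp: word_path_def)
    have ij: "d = d_map (i, j, A)" "arrow_defined n (i, j, A)"
      using w Cons.prems by (auto simp: v word_path_def arrow_defined_iff)
    then have r: "ran d = A\<langle>i,j\<rangle>" "ran d \<subseteq> {1..n}"
      using d_map_ran[OF ij(2)] PF_D(2)[OF arrow_not_id(1)[OF ij(2)]] by auto
    then show "pre_digraph.awalk (EF_quiver n) A (d # p) B"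
      using Cons.IH[OF r(2)] w ij unfolding ind by (auto simp: v word_path_def d_map_dom)
  qed
qed

lemma word_arrows_defined: "valid_word A w \<Longrightarrow> A \<subseteq> {1..n} \<Longrightarrow> a \<in> set (word_arrows A w) \<Longrightarrow> arrow_defined n a"
proof (induction w arbitrary: A)
  case (Cons m w)
  obtain i j where m: "m = (i, j)" by force
  have a: "arrow_defined n (i, j, A)" using Cons.prems by (auto simp: m arrow_defined_iff)
  have "A\<langle>i,j\<rangle> \<subseteq> {1..n}" using PF_D(2)[OF arrow_not_id(1)[OF a]] d_map_ran[OF a] by simp
  then show ?case using Cons a by (auto simp: m)
qed auto

lemma ran_last_arrow: "valid_word A w \<Longrightarrow> A \<subseteq> {1..n} \<Longrightarrow> w \<noteq> [] \<Longrightarrow> ran (d_map (last (word_arrows A w))) = endpoint A w"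
proof (induction w rule: rev_induct)
  case (snoc m w)
  obtain i j where m: "m = (i, j)" by force
  have "arrow_defined n (i, j, endpoint A w)"
    using snoc.prems endpoint_subset[of A w n] by (auto simp: m arrow_defined_iff valid_word_append)
  then show ?case using snoc.prems d_map_ran by (simp add: m word_arrows_append endpoint_append)
qed auto

text \<open>The side conditions match because validity of the left word makes all arrows defined,
  and because the words are nonempty, so the range of the leftmost symbol is the endpoint.\<close>

lemma EF_relations_iff:
  "(f, g) \<in> EF_relations n A B \<longleftrightarrow> A \<subseteq> {1..n} \<and> (\<exists>l r. word_rel A l r \<and> valid_word A l \<and> B = endpoint A l \<and>
     f = Poly_Mapping.single (word_path A l) 1 \<and> g = Poly_Mapping.single (word_path A r) 1)"
proof
  assume "(f, g) \<in> EF_relations n A B"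
  then obtain L R where LR: "A \<subseteq> {1..n}" "EF_rel A L R" "\<forall>a\<in>set L \<union> set R. arrow_defined n a"
    "B = ran (d_map (hd L))" "f = Poly_Mapping.single (A, rev (map d_map L), B) 1"
    "g = Poly_Mapping.single (A, rev (map d_map R), B) 1"
    unfolding EF_relations_def mem_Collect_eq prod.inject by (elim exE conjE) (rule that)
  obtain l r where lr: "word_rel A l r" "valid_word A l" "L = rev (word_arrows A l)" "R = rev (word_arrows A r)"
    by (rule EF_rel_word_rel[OF LR(2,3)])
  have "l \<noteq> []" using lr(1) by cases simp_all
  then have "B = endpoint A l" using LR lr ran_last_arrow[of A l n] by (simp add: hd_rev)
  moreover have "endpoint A r = endpoint A l" using word_rel_EF_rel[OF lr(1,2)] by simp
  ultimately show "A \<subseteq> {1..n} \<and> (\<exists>l r. word_rel A l r \<and> valid_word A l \<and> B = endpoint A l \<and>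
     f = Poly_Mapping.single (word_path A l) 1 \<and> g = Poly_Mapping.single (word_path A r) 1)"
    using LR(1,5,6) lr by (intro conjI exI[of _ l] exI[of _ r]) (simp_all add: word_path_def rev_map)
next
  assume "A \<subseteq> {1..n} \<and> (\<exists>l r. word_rel A l r \<and> valid_word A l \<and> B = endpoint A l \<and>
     f = Poly_Mapping.single (word_path A l) 1 \<and> g = Poly_Mapping.single (word_path A r) 1)"
  then obtain l r where lr: "A \<subseteq> {1..n}" "word_rel A l r" "valid_word A l" "B = endpoint A l"
     "f = Poly_Mapping.single (word_path A l) 1" "g = Poly_Mapping.single (word_path A r) 1" by blast
  have e: "EF_rel A (rev (word_arrows A l)) (rev (word_arrows A r))" "valid_word A r" "endpoint A r = endpoint A l"
    using word_rel_EF_rel[OF lr(2,3)] by auto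
  have "l \<noteq> []" using lr(2) by cases simp_all
  then have "B = ran (d_map (hd (rev (word_arrows A l))))" using lr ran_last_arrow[of A l n] by (simp add: hd_rev)
  moreover have "f = Poly_Mapping.single (A, rev (map d_map (rev (word_arrows A l))), B) 1"
    "g = Poly_Mapping.single (A, rev (map d_map (rev (word_arrows A r))), B) 1"
    using lr e by (auto simp: word_path_def rev_map)
  moreover have "\<forall>a\<in>set (rev (word_arrows A l)) \<union> set (rev (word_arrows A r)). arrow_defined n a"
    using word_arrows_defined lr e by auto
  ultimately show "(f, g) \<in> EF_relations n A B"
    unfolding EF_relations_def using lr(1) e(1)
    by (intro CollectI exI[of _ "rev (word_arrows A l)"] exI[of _ "rev (word_arrows A r)"] conjI) (simp_all only: prod.inject simp_thms)
qed

section \<open>The congruence on path spaces\<close>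

abbreviation path_lincat :: "nat \<Rightarrow> (nat set, 'k::field, nat set \<times> (nat \<rightharpoonup> nat) list \<times> nat set \<Rightarrow>\<^sub>0 'k) lincat" where
  "path_lincat n \<equiv> linearization (free_cat (EF_quiver n))"

lemma lobj_path_lincat [simp]: "lobj (path_lincat n) = Pow {1..n}"
  by (simp add: linearization_def free_cat_def EF_quiver_def)

lemma lhom_path_lincat:
  assumes "A \<subseteq> {1..n}"
  shows "lhom (path_lincat n) A B = {f. Poly_Mapping.keys f \<subseteq> {word_path A w | w. valid_word A w \<and> endpoint A w = B}}"
proof -
  have "{m \<in> mor (free_cat (EF_quiver n)). src (free_cat (EF_quiver n)) m = A \<and> tgt (free_cat (EF_quiver n)) m = B}
    = {word_path A w | w. valid_word A w \<and> endpoint A w = B}" (is "?L = ?R")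
  proof (rule Set.set_eqI)
    fix m :: "nat set \<times> (nat \<rightharpoonup> nat) list \<times> nat set"
    obtain u p v where m: "m = (u, p, v)" by (cases m)
    have "m \<in> ?L \<longleftrightarrow> u = A \<and> v = B \<and> pre_digraph.awalk (EF_quiver n) A p B"
      by (auto simp: m free_cat_def)
    also have "\<dots> \<longleftrightarrow> m \<in> ?R"
      unfolding awalk_EF_quiver[OF assms] by (auto simp: m word_path_def)
    finally show "m \<in> ?L \<longleftrightarrow> m \<in> ?R" .
  qed
  then show ?thesis by (simp add: linearization_def)
qed

lemma lin_ops_path_lincat [simp]:
  "ladd (path_lincat n) u v = (+)" "lscale (path_lincat n) u v = pm_scale"
  "lcomp (path_lincat n) u v w = cat_prod (free_cat (EF_quiver n))"
  "lid (path_lincat n) u = Poly_Mapping.single (u, [], u) 1"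
  by (simp_all add: linearization_def free_cat_def)

lemma keys_add_subset: "Poly_Mapping.keys f \<subseteq> S \<Longrightarrow> Poly_Mapping.keys g \<subseteq> S \<Longrightarrow> Poly_Mapping.keys (f + g) \<subseteq> S"
  using Poly_Mapping.keys_add[of f g] by blast

lemma cat_prod_word_paths:
  assumes "valid_word A w"
  shows "cat_prod (free_cat (EF_quiver n)) (Poly_Mapping.single (word_path (endpoint A w) v) c)
    (Poly_Mapping.single (word_path A w) d) = Poly_Mapping.single (word_path A (w @ v)) (c * d)"
  by (simp add: cat_prod_def free_cat_def word_path_def word_arrows_append endpoint_append)

lemma lhom_closed:
  assumes "A \<subseteq> {1..n}"
  shows "f \<in> lhom (path_lincat n) A B \<Longrightarrow> g \<in> lhom (path_lincat n) A B \<Longrightarrow> f + g \<in> lhom (path_lincat n) A B"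
    "f \<in> lhom (path_lincat n) A B \<Longrightarrow> pm_scale c f \<in> lhom (path_lincat n) A B"
    "f \<in> lhom (path_lincat n) A B \<Longrightarrow> B \<subseteq> {1..n} \<Longrightarrow> g \<in> lhom (path_lincat n) B C \<Longrightarrow>
      cat_prod (free_cat (EF_quiver n)) g f \<in> lhom (path_lincat n) A C"
    "valid_word A w \<Longrightarrow> endpoint A w = B \<Longrightarrow> Poly_Mapping.single (word_path A w) c \<in> lhom (path_lincat n) A B"
proof -
  show "f + g \<in> lhom (path_lincat n) A B" if "f \<in> lhom (path_lincat n) A B" "g \<in> lhom (path_lincat n) A B"
    using that unfolding lhom_path_lincat[OF assms] by (simp add: keys_add_subset)
  show "pm_scale c f \<in> lhom (path_lincat n) A B" if "f \<in> lhom (path_lincat n) A B"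
    using that unfolding lhom_path_lincat[OF assms] by (simp add: subset_trans[OF keys_pm_scale])
  show "Poly_Mapping.single (word_path A w) c \<in> lhom (path_lincat n) A B" if "valid_word A w" "endpoint A w = B"
    using that unfolding lhom_path_lincat[OF assms] by auto
  assume f: "f \<in> lhom (path_lincat n) A B" and B: "B \<subseteq> {1..n}" and g: "g \<in> lhom (path_lincat n) B C"
  show "cat_prod (free_cat (EF_quiver n)) g f \<in> lhom (path_lincat n) A C"
    unfolding lhom_path_lincat[OF assms] mem_Collect_eq cat_prod_def
  proof (rule keys_bilinear_ext)
    fix x y assume "x \<in> Poly_Mapping.keys g" "y \<in> Poly_Mapping.keys f"
    then obtain v w where "x = word_path B v" "valid_word B v" "endpoint B v = C"
      "y = word_path A w" "valid_word A w" "endpoint A w = B"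
      using f g unfolding lhom_path_lincat[OF assms] lhom_path_lincat[OF B] by blast
    then show "Poly_Mapping.keys (if src (free_cat (EF_quiver n)) x = tgt (free_cat (EF_quiver n)) y
        then Poly_Mapping.single (cmp (free_cat (EF_quiver n)) x y) (1 :: 'a) else 0)
        \<subseteq> {word_path A w |w. valid_word A w \<and> endpoint A w = C}"
      by (auto simp: free_cat_def word_path_def word_arrows_append endpoint_append valid_word_append
          intro!: exI[of _ "w @ v"])
  qed
qed

definition push :: "(nat set \<times> (nat \<rightharpoonup> nat) list \<times> nat set \<Rightarrow>\<^sub>0 'k::field) \<Rightarrow> ((nat \<rightharpoonup> nat) \<Rightarrow>\<^sub>0 'k)" where
  "push = lin_ext (\<lambda>p. Poly_Mapping.single (path_map p) 1)"

lemma pm_linear_push: "pm_linear push"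
  by (simp add: push_def pm_linear_lin_ext)

lemma push_single [simp]: "push (Poly_Mapping.single p c) = Poly_Mapping.single (path_map p) c"
  by (simp add: push_def)

lemma push_comp:
  assumes A: "A \<subseteq> {1..n}" and B: "B \<subseteq> {1..n}"
    and f: "f \<in> lhom (path_lincat n) A B" and g: "g \<in> lhom (path_lincat n) B C"
  shows "push (cat_prod (free_cat (EF_quiver n)) g f) = cat_prod (EF_cat n) (push g) (push f)"
  unfolding cat_prod_def
proof (rule bilinear_ext_map[OF pm_linear_push])
  fix x y assume "x \<in> Poly_Mapping.keys g" "y \<in> Poly_Mapping.keys f"
  then obtain v w where vw: "x = word_path B v" "valid_word B v"
    "y = word_path A w" "valid_word A w" "endpoint A w = B"
    using f g unfolding lhom_path_lincat[OF A] lhom_path_lincat[OF B] by blast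
  have "cmp (free_cat (EF_quiver n)) x y = word_path A (w @ v)" "src (free_cat (EF_quiver n)) x = tgt (free_cat (EF_quiver n)) y"
    using vw by (auto simp: free_cat_def word_path_def word_arrows_append endpoint_append)
  moreover have "path_map (word_path A (w @ v)) = path_map x \<circ>\<^sub>m path_map y" "dom (path_map x) = ran (path_map y)"
    using vw by (auto simp: path_map_word_path valid_word_append word_map_append ran_word_map)
  ultimately show "push (if src (free_cat (EF_quiver n)) x = tgt (free_cat (EF_quiver n)) y
      then Poly_Mapping.single (cmp (free_cat (EF_quiver n)) x y) (1 :: 'a) else 0) =
    bilinear_ext (\<lambda>m' m. if src (EF_cat n) m' = tgt (EF_cat n) m then Poly_Mapping.single (cmp (EF_cat n) m' m) 1 else 0)
      (push (Poly_Mapping.single x 1)) (push (Poly_Mapping.single y 1))"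
    by (simp add: EF_cat_def)
qed

lemma keys_push:
  assumes "A \<subseteq> {1..n}" "f \<in> lhom (path_lincat n) A B"
  shows "Poly_Mapping.keys (push f) \<subseteq> {m \<in> PF n. dom m = A \<and> ran m = B}"
  unfolding push_def lin_ext_def
proof (intro keys_sum_subset subset_trans[OF keys_pm_scale])
  fix x assume "x \<in> Poly_Mapping.keys f"
  then obtain w where "x = word_path A w" "valid_word A w" "endpoint A w = B"
    using assms unfolding lhom_path_lincat[OF assms(1)] by blast
  then show "Poly_Mapping.keys (Poly_Mapping.single (path_map x) (1 :: 'a)) \<subseteq> {m \<in> PF n. dom m = A \<and> ran m = B}"
    using assms(1) by (simp add: path_map_word_path ran_word_map word_map_PF)
qed

abbreviation ef_cong where
  "ef_cong n \<equiv> gen_cong (path_lincat n) (EF_relations n)"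

text \<open>The congruence is contained in the kernel of \<open>push\<close>; the reverse inclusion
  comes from \<open>ef_cong_norm\<close>.\<close>

lemma ef_cong_sound:
  assumes "ef_cong n A B f g"
  shows "A \<subseteq> {1..n} \<and> B \<subseteq> {1..n} \<and> f \<in> lhom (path_lincat n) A B \<and> g \<in> lhom (path_lincat n) A B \<and> push f = push g"
  using assms
proof induction
  case (base A B f g)
  then obtain l r where lr: "A \<subseteq> {1..n}" "word_rel A l r" "valid_word A l" "B = endpoint A l"
    "f = Poly_Mapping.single (word_path A l) 1" "g = Poly_Mapping.single (word_path A r) 1"
    unfolding EF_relations_iff by blast
  have "word_cong A l r" using lr by (intro word_cong.rel)
  from word_cong_sound[OF this] have r: "valid_word A r" "endpoint A r = B" "word_map A l = word_map A r"
    using lr by (auto simp: word_map_def)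
  then show ?case using lr base(2) by (simp add: path_map_word_path lhom_closed)
next
  case (add A B f f' g g')
  then show ?case by (simp add: pm_linearD[OF pm_linear_push] lhom_closed)
next
  case (scale A B f g c)
  then show ?case by (simp add: pm_linearD[OF pm_linear_push] lhom_closed)
next
  case (comp A B f f' C g g')
  then show ?case by (simp add: push_comp[of A n B _ _ C] lhom_closed(3)[of A n _ B])
qed auto

lemma ef_cong_words:
  assumes "word_cong A w v" "A \<subseteq> {1..n}"
  shows "ef_cong n A (endpoint A w) (Poly_Mapping.single (word_path A w) 1) (Poly_Mapping.single (word_path A v) (1 :: 'k::field))"
  using assms
proof (induction rule: word_cong.induct)
  case (rel A l r)
  have "endpoint A l \<in> Pow {1..n}" using rel endpoint_subset by blast
  moreover have "(Poly_Mapping.single (word_path A l) (1 :: 'k), Poly_Mapping.single (word_path A r) 1) \<in> EF_relations n A (endpoint A l)"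
    unfolding EF_relations_iff using rel by blast
  ultimately show ?case using rel by (intro gen_cong.base) auto
next
  case (refl A w)
  then show ?case using endpoint_subset[of A w n] by (intro gen_cong.refl) (auto simp: lhom_closed)
next
  case (sym A v w)
  then show ?case using word_cong_sound[OF sym(1)] by (auto intro: gen_cong.sym)
next
  case (trans A u v w)
  then show ?case using word_cong_sound[OF trans(1)] by (auto intro: gen_cong.trans)
next
  case (app A u v u' v')
  have s: "valid_word A u" "valid_word A v" "endpoint A v = endpoint A u" using word_cong_sound[OF app(1)] by auto
  have "endpoint A u \<subseteq> {1..n}" using s app endpoint_subset by blast
  from gen_cong.comp[OF app(3)[OF app.prems] app(4)[OF this]]
  show ?case
    using cat_prod_word_paths[OF s(1), of n u' "1 :: 'k" 1] cat_prod_word_paths[OF s(2), of n v' "1 :: 'k" 1] s(3)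
    by (simp add: endpoint_append)
qed

text \<open>Any word for \<open>m\<close> would do, since all of them are congruent.\<close>

definition norm_word :: "(nat \<rightharpoonup> nat) \<Rightarrow> (nat \<times> nat) list" where
  "norm_word m = (SOME w. valid_word (dom m) w \<and> m = word_map (dom m) w)"

lemma norm_word: "m \<in> PF n \<Longrightarrow> valid_word (dom m) (norm_word m) \<and> m = word_map (dom m) (norm_word m)"
  unfolding norm_word_def by (rule someI_ex) (meson PF_word)

definition norm_path :: "((nat \<rightharpoonup> nat) \<Rightarrow>\<^sub>0 'k::field) \<Rightarrow> (nat set \<times> (nat \<rightharpoonup> nat) list \<times> nat set \<Rightarrow>\<^sub>0 'k)" where
  "norm_path = lin_ext (\<lambda>m. Poly_Mapping.single (word_path (dom m) (norm_word m)) 1)"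

lemma pm_linear_norm_path: "pm_linear norm_path"
  by (simp add: norm_path_def pm_linear_lin_ext)

lemma norm_path_single:
  "norm_path (Poly_Mapping.single m c) = Poly_Mapping.single (word_path (dom m) (norm_word m)) c"
  by (simp add: norm_path_def)

lemma norm_path_hom:
  assumes "A \<subseteq> {1..n}" "Poly_Mapping.keys f \<subseteq> {m \<in> PF n. dom m = A \<and> ran m = B}"
  shows "norm_path f \<in> lhom (path_lincat n) A B" "push (norm_path f) = f"
proof -
  show "norm_path f \<in> lhom (path_lincat n) A B"
    unfolding norm_path_def lin_ext_def lhom_path_lincat[OF assms(1)] mem_Collect_eq
  proof (intro keys_sum_subset subset_trans[OF keys_pm_scale])
    fix m assume "m \<in> Poly_Mapping.keys f"
    then have m: "m \<in> PF n" "dom m = A" "ran m = B" using assms(2) by auto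
    let ?w = "norm_word m"
    have w: "valid_word A ?w" "m = word_map A ?w" using norm_word[OF m(1)] m(2) by auto
    then have "endpoint A ?w = B" using ran_word_map[OF w(1)] m(3) by metis
    then show "Poly_Mapping.keys (Poly_Mapping.single (word_path (dom m) ?w) (1 :: 'a))
      \<subseteq> {word_path A w |w. valid_word A w \<and> endpoint A w = B}"
      using w(1) m(2) by auto
  qed
  show "push (norm_path f) = f"
  proof (rule pm_linear_eqI[where f = f])
    show "pm_linear (\<lambda>f. push (norm_path f))" by (rule pm_linear_compose[OF pm_linear_push pm_linear_norm_path])
    show "pm_linear (\<lambda>f :: (nat \<rightharpoonup> nat) \<Rightarrow>\<^sub>0 'a. f)" by (simp add: pm_linear_def)
    fix m assume "m \<in> Poly_Mapping.keys f"
    then have "m \<in> PF n" using assms(2) by auto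
    from norm_word[OF this] show "push (norm_path (Poly_Mapping.single m 1)) = Poly_Mapping.single m 1"
      by (simp add: norm_path_single path_map_word_path)
  qed
qed

text \<open>A path and the chosen path with the same composite are parallel, hence congruent by
  completeness on words; linearity extends this to \<open>f\<close>. As the right side depends on
  \<open>push f\<close> only, elements with equal image are congruent.\<close>

lemma ef_cong_norm:
  assumes A: "A \<subseteq> {1..n}" and B: "B \<subseteq> {1..n}" and f: "f \<in> lhom (path_lincat n) A B"
  shows "ef_cong n A B f (norm_path (push f))"
proof -
  have sum: "ef_cong n A B (\<Sum>x\<in>S. pm_scale (c x) (F x)) (\<Sum>x\<in>S. pm_scale (c x) (G x))"
    if "finite S" "\<And>x. x \<in> S \<Longrightarrow> ef_cong n A B (F x) (G x)" for S c and F G :: "'x \<Rightarrow> _ \<Rightarrow>\<^sub>0 'a"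
    using that
  proof (induction S rule: finite_induct)
    case empty
    have "(0 :: _ \<Rightarrow>\<^sub>0 'a) \<in> lhom (path_lincat n) A B" by (simp add: lhom_path_lincat[OF A])
    then show ?case using A B by (auto intro: gen_cong.refl)
  next
    case (insert x S)
    have "ef_cong n A B (pm_scale (c x) (F x)) (pm_scale (c x) (G x))"
      using gen_cong.scale[of "path_lincat n" "EF_relations n" A B "F x" "G x" "c x"] insert by simp
    from gen_cong.add[OF this insert.IH] insert show ?case by simp
  qed
  let ?s = "\<lambda>p. Poly_Mapping.single p (1 :: 'a)"
  let ?c = "Poly_Mapping.lookup f"
  have 1: "f = (\<Sum>p\<in>Poly_Mapping.keys f. pm_scale (?c p) (?s p))"
    using pm_expand[of "Poly_Mapping.keys f" f] by simp
  have 2: "norm_path (push f) = (\<Sum>p\<in>Poly_Mapping.keys f. pm_scale (?c p) (norm_path (push (?s p))))"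
    by (subst 1) (simp only: pm_linearD[OF pm_linear_push] pm_linearD[OF pm_linear_norm_path])
  have 3: "ef_cong n A B (?s p) (norm_path (push (?s p)))" if pf: "p \<in> Poly_Mapping.keys f" for p
  proof -
    obtain w where w: "p = word_path A w" "valid_word A w" "endpoint A w = B"
      using f pf unfolding lhom_path_lincat[OF A] by blast
    let ?m = "word_map A w"
    have m: "valid_word A (norm_word ?m)" "?m = word_map A (norm_word ?m)"
      using norm_word[OF word_map_PF[OF w(2) A]] by auto
    have "word_cong A w (norm_word ?m)" using word_cong_iff_word_map[OF A w(2) m(1)] m(2) by simp
    from ef_cong_words[OF this A] show ?thesis
      by (simp add: w path_map_word_path norm_path_single)
  qed
  show ?thesis by (subst (1) 1, subst 2) (intro sum 3 finite_keys)
qed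

lemma cong_rel_ef:
  assumes "A \<subseteq> {1..n}" "B \<subseteq> {1..n}"
  shows "cong_rel (path_lincat n) (EF_relations n) A B =
    {(f, g). f \<in> lhom (path_lincat n) A B \<and> g \<in> lhom (path_lincat n) A B \<and> push f = push g}"
proof -
  have "ef_cong n A B f g" if "f \<in> lhom (path_lincat n) A B" "g \<in> lhom (path_lincat n) A B" "push f = push g" for f g :: "_ \<Rightarrow>\<^sub>0 'a"
    using ef_cong_norm[OF assms that(1)] ef_cong_norm[OF assms that(2)] that(3)
    by (auto intro: gen_cong.sym gen_cong.trans)
  then show ?thesis using ef_cong_sound unfolding cong_rel_def by blast
qed

lemma EF_relations_hom:
  "EF_relations n A B \<subseteq> lhom (path_lincat n) A B \<times> lhom (path_lincat n) A B"
proof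
  fix fg assume "fg \<in> EF_relations n A B"
  moreover obtain f g where fg: "fg = (f, g)" by force
  ultimately obtain l r where lr: "A \<subseteq> {1..n}" "word_rel A l r" "valid_word A l" "B = endpoint A l"
    "f = Poly_Mapping.single (word_path A l) 1" "g = Poly_Mapping.single (word_path A r) 1"
    by (auto simp: EF_relations_iff)
  then have "B \<subseteq> {1..n}" using endpoint_subset by blast
  with lr fg \<open>fg \<in> _\<close> show "fg \<in> lhom (path_lincat n) A B \<times> lhom (path_lincat n) A B"
    using ef_cong_sound[OF gen_cong.base[of A "path_lincat n" B f g "EF_relations n"]] by simp
qed

section \<open>The category algebra\<close>

declare One_nat_def [simp del]

definition PF_span :: "nat \<Rightarrow> ((nat \<rightharpoonup> nat) \<Rightarrow>\<^sub>0 'k::field) set" where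
  "PF_span n = {f. Poly_Mapping.keys f \<subseteq> PF n}"

lemma PF_spanD: "f \<in> PF_span n \<Longrightarrow> x \<in> Poly_Mapping.keys f \<Longrightarrow> x \<in> PF n"
  by (auto simp: PF_span_def)

abbreviation ef_prod :: "nat \<Rightarrow> ((nat \<rightharpoonup> nat) \<Rightarrow>\<^sub>0 'k::field) \<Rightarrow> ((nat \<rightharpoonup> nat) \<Rightarrow>\<^sub>0 'k) \<Rightarrow> ((nat \<rightharpoonup> nat) \<Rightarrow>\<^sub>0 'k)" where
  "ef_prod n \<equiv> cat_prod (EF_cat n)"

lemma ef_prod_eq: "ef_prod n =
    bilinear_ext (\<lambda>f g. if dom f = ran g then Poly_Mapping.single (f \<circ>\<^sub>m g) 1 else 0)"
  by (simp add: cat_prod_def EF_cat_def cong: if_cong)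

lemma pm_linear_ef_prod: "pm_linear (\<lambda>f. ef_prod n f g)" "pm_linear (ef_prod n f)"
  by (simp_all add: ef_prod_eq pm_linear_bilinear_left pm_linear_bilinear_right)

lemma ef_prod_single: "ef_prod n (Poly_Mapping.single f c) (Poly_Mapping.single g d) =
    (if dom f = ran g then Poly_Mapping.single (f \<circ>\<^sub>m g) (c * d) else 0)"
  by (simp add: ef_prod_eq)

lemma ef_prod_assoc: "ef_prod n (ef_prod n f g) h = ef_prod n f (ef_prod n g h)"
  unfolding ef_prod_eq
  by (rule bilinear_ext_assoc)
    (auto simp: dom_ran_comp partial_comp_assoc pm_linearD[OF pm_linear_bilinear_left] pm_linearD[OF pm_linear_bilinear_right])

lemma ef_prod_closed: "f \<in> PF_span n \<Longrightarrow> g \<in> PF_span n \<Longrightarrow> ef_prod n f g \<in> PF_span n"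
  unfolding ef_prod_eq PF_span_def mem_Collect_eq by (rule keys_bilinear_ext) (auto intro!: comp_PF)

definition ef_one :: "nat \<Rightarrow> ((nat \<rightharpoonup> nat) \<Rightarrow>\<^sub>0 'k::field)" where
  "ef_one n = (\<Sum>U\<in>Pow {1..n}. Poly_Mapping.single (Some |` U) 1)"

lemma ef_one_closed: "ef_one n \<in> PF_span n"
  unfolding ef_one_def PF_span_def mem_Collect_eq by (rule keys_sum_subset) (simp add: id_PF)

lemma ef_prod_one:
  assumes "f \<in> PF_span n"
  shows "ef_prod n (ef_one n) f = f" "ef_prod n f (ef_one n) = f"
proof -
  show "ef_prod n (ef_one n) f = f"
  proof (rule pm_linear_eqI[where f = f])
    fix m assume "m \<in> Poly_Mapping.keys f"
    then have m: "ran m \<in> Pow {1..n}" using PF_D(2)[OF PF_spanD[OF assms]] by simp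
    show "ef_prod n (ef_one n) (Poly_Mapping.single m 1) = Poly_Mapping.single m 1"
      using m by (simp add: ef_one_def pm_linearD[OF pm_linear_ef_prod(1)] ef_prod_single sum.delta)
  qed (simp_all add: pm_linear_ef_prod pm_linear_def[of "\<lambda>f. f"])
  show "ef_prod n f (ef_one n) = f"
  proof (rule pm_linear_eqI[where f = f])
    fix m assume "m \<in> Poly_Mapping.keys f"
    then have m: "dom m \<in> Pow {1..n}" using PF_D(1)[OF PF_spanD[OF assms]] by simp
    show "ef_prod n (Poly_Mapping.single m 1) (ef_one n) = Poly_Mapping.single m 1"
      using m by (simp add: ef_one_def pm_linearD[OF pm_linear_ef_prod(2)] ef_prod_single sum.delta')
  qed (simp_all add: pm_linear_ef_prod pm_linear_def[of "\<lambda>f. f"])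
qed

lemma lookup_ef_prod: "Poly_Mapping.lookup (ef_prod n f g) m =
    (\<Sum>x\<in>Poly_Mapping.keys f. \<Sum>y\<in>Poly_Mapping.keys g.
      if dom x = ran y \<and> x \<circ>\<^sub>m y = m then Poly_Mapping.lookup f x * Poly_Mapping.lookup g y else 0)"
  unfolding ef_prod_eq lookup_bilinear_ext
  by (intro sum.cong) (auto simp: lookup_single when_def)

text \<open>By \<open>comp_eq_id\<close> an identity arises only as its own square, so its
  coefficient is multiplicative: each object yields a character of the algebra.\<close>

lemma lookup_ef_prod_id:
  assumes "f \<in> PF_span n" "g \<in> PF_span n"
  shows "Poly_Mapping.lookup (ef_prod n f g) (Some |` U) =
    Poly_Mapping.lookup f (Some |` U) * Poly_Mapping.lookup g (Some |` U)"
proof -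
  let ?i = "Some |` U" let ?c = "Poly_Mapping.lookup f ?i * Poly_Mapping.lookup g ?i"
  have "(if dom x = ran y \<and> x \<circ>\<^sub>m y = ?i then Poly_Mapping.lookup f x * Poly_Mapping.lookup g y else 0) =
      (if x = ?i then if y = ?i then ?c else 0 else 0)"
    if "x \<in> Poly_Mapping.keys f" "y \<in> Poly_Mapping.keys g" for x y
  proof -
    have xy: "x \<in> PF n" "y \<in> PF n" using that assms PF_spanD by blast+
    have "dom ?i = ran ?i" "?i \<circ>\<^sub>m ?i = ?i"
      using restrict_id_simps(3)[of ?i] unfolding restrict_id_simps(1,2) by blast+
    then have "dom x = ran y \<and> x \<circ>\<^sub>m y = ?i \<longleftrightarrow> x = ?i \<and> y = ?i"
      using comp_eq_id[OF xy, of U] by metis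
    then show ?thesis by simp
  qed
  then have "Poly_Mapping.lookup (ef_prod n f g) ?i =
    (\<Sum>x\<in>Poly_Mapping.keys f. \<Sum>y\<in>Poly_Mapping.keys g. if x = ?i then if y = ?i then ?c else 0 else 0)"
    unfolding lookup_ef_prod by (intro sum.cong[OF HOL.refl]) blast
  also have "\<dots> = (\<Sum>x\<in>Poly_Mapping.keys f. if x = ?i then \<Sum>y\<in>Poly_Mapping.keys g. if y = ?i then ?c else 0 else 0)"
    by (intro sum.cong[OF HOL.refl]) simp
  also have "\<dots> = ?c" by (simp add: in_keys_iff)
  finally show ?thesis .
qed

text \<open>Irreducibility in terms of coefficients: two non-identities from the supports never
  compose to \<open>m\<close>.\<close>

lemma lookup_ef_prod_arrow:
  assumes "f \<in> PF_span n" "g \<in> PF_span n" "m \<in> arrows n"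
    and "\<And>U. Poly_Mapping.lookup f (Some |` U) = 0" "\<And>U. Poly_Mapping.lookup g (Some |` U) = 0"
  shows "Poly_Mapping.lookup (ef_prod n f g) m = 0"
  unfolding lookup_ef_prod
proof (intro sum.neutral ballI)
  fix x y assume x: "x \<in> Poly_Mapping.keys f" and y: "y \<in> Poly_Mapping.keys g"
  obtain i j A where "m = d_map (i, j, A)" "arrow_defined n (i, j, A)" using assms(3) by auto
  moreover have "x \<in> PF n" "y \<in> PF n" using x y assms PF_spanD by blast+
  moreover have "x \<noteq> Some |` dom x" "y \<noteq> Some |` dom y"
    using x y assms(4)[of "dom x"] assms(5)[of "dom y"] by (metis in_keys_iff)+
  ultimately have "\<not> (dom x = ran y \<and> x \<circ>\<^sub>m y = m)" using arrow_irreducible[of n i j A x y] by blast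
  then show "(if dom x = ran y \<and> x \<circ>\<^sub>m y = m then Poly_Mapping.lookup f x * Poly_Mapping.lookup g y else 0) = 0"
    by (rule if_not_P)
qed

text \<open>The Peirce projection onto the hom-space from \<open>U\<close> to
  \<open>V\<close>.\<close>

lemma lookup_ef_prod_sandwich:
  "Poly_Mapping.lookup (ef_prod n (ef_prod n (Poly_Mapping.single (Some |` V) 1) f) (Poly_Mapping.single (Some |` U) 1)) m =
    (if dom m = U \<and> ran m = V then Poly_Mapping.lookup f m else 0)"
proof -
  let ?\<phi> = "\<lambda>f. ef_prod n (ef_prod n (Poly_Mapping.single (Some |` V) 1) f) (Poly_Mapping.single (Some |` U) 1)"
  let ?\<psi> = "lin_ext (\<lambda>m. if dom m = U \<and> ran m = V then Poly_Mapping.single m 1 else 0)"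
  have "?\<phi> f = ?\<psi> f"
  proof (rule pm_linear_eqI[where f = f])
    show "pm_linear ?\<phi>" by (rule pm_linear_compose[OF pm_linear_ef_prod(1) pm_linear_ef_prod(2)])
    fix x show "?\<phi> (Poly_Mapping.single x 1) = ?\<psi> (Poly_Mapping.single x 1)"
      by (cases "V = ran x"; cases "dom x = U")
        (auto simp: ef_prod_single pm_linearD[OF pm_linear_ef_prod(1)])
  qed (rule pm_linear_lin_ext)
  moreover have "Poly_Mapping.lookup (?\<psi> f) m = (\<Sum>x\<in>Poly_Mapping.keys f. if x = m then
      if dom m = U \<and> ran m = V then Poly_Mapping.lookup f m else 0 else 0)"
    unfolding lin_ext_def lookup_sum by (intro sum.cong) (auto simp: lookup_single)
  ultimately show ?thesis by (simp add: in_keys_iff)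
qed

section \<open>Algebras isomorphic to the category algebra\<close>

text \<open>Both algebras live on the same space \<open>PF_span n\<close> and differ in their
  products only. The parameter \<open>h\<close> is the isomorphism to the category algebra: the
  identity for that algebra itself, and \<open>sum_restr\<close> for the monoid algebra. All
  coefficients below are taken after \<open>h\<close>.\<close>

locale ef_algebra =
  fixes n :: nat and A :: "('k::field, (nat \<rightharpoonup> nat) \<Rightarrow>\<^sub>0 'k) module"
    and h :: "((nat \<rightharpoonup> nat) \<Rightarrow>\<^sub>0 'k) \<Rightarrow> ((nat \<rightharpoonup> nat) \<Rightarrow>\<^sub>0 'k)"
  assumes carrier_A: "carrier A = PF_span n"
    and A_ops: "add A = (+)" "zero A = 0" "smult A = pm_scale"
    and h_linear: "pm_linear h" and h_bij: "bij_betw h (PF_span n) (PF_span n)"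
    and mult_closed: "x \<in> PF_span n \<Longrightarrow> y \<in> PF_span n \<Longrightarrow> x \<otimes>\<^bsub>A\<^esub> y \<in> PF_span n"
    and h_mult: "x \<in> PF_span n \<Longrightarrow> y \<in> PF_span n \<Longrightarrow> h (x \<otimes>\<^bsub>A\<^esub> y) = ef_prod n (h x) (h y)"
    and one_closed: "\<one>\<^bsub>A\<^esub> \<in> PF_span n" and h_one: "h \<one>\<^bsub>A\<^esub> = ef_one n"
begin

definition h_inv :: "((nat \<rightharpoonup> nat) \<Rightarrow>\<^sub>0 'k) \<Rightarrow> ((nat \<rightharpoonup> nat) \<Rightarrow>\<^sub>0 'k)" where
  "h_inv = the_inv_into (PF_span n) h"

definition coef :: "((nat \<rightharpoonup> nat) \<Rightarrow>\<^sub>0 'k) \<Rightarrow> (nat \<rightharpoonup> nat) \<Rightarrow> 'k" where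
  "coef x = Poly_Mapping.lookup (h x)"

definition basis_elem :: "(nat \<rightharpoonup> nat) \<Rightarrow> ((nat \<rightharpoonup> nat) \<Rightarrow>\<^sub>0 'k)" where
  "basis_elem m = h_inv (Poly_Mapping.single m 1)"

abbreviation vertex_idem :: "nat set \<Rightarrow> ((nat \<rightharpoonup> nat) \<Rightarrow>\<^sub>0 'k)" where
  "vertex_idem U \<equiv> basis_elem (Some |` U)"

lemma h_closed: "x \<in> PF_span n \<Longrightarrow> h x \<in> PF_span n"
  using h_bij by (auto simp: bij_betw_def)

lemma h_inj: "x \<in> PF_span n \<Longrightarrow> y \<in> PF_span n \<Longrightarrow> h x = h y \<Longrightarrow> x = y"
  using h_bij by (auto simp: bij_betw_def inj_on_def)

lemma h_inv_closed: "f \<in> PF_span n \<Longrightarrow> h_inv f \<in> PF_span n"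
  using bij_betw_the_inv_into[OF h_bij] by (auto simp: h_inv_def bij_betw_def)

lemma h_h_inv: "f \<in> PF_span n \<Longrightarrow> h (h_inv f) = f"
  unfolding h_inv_def by (rule f_the_inv_into_f_bij_betw[OF h_bij]) auto

lemma h_inv_h: "x \<in> PF_span n \<Longrightarrow> h_inv (h x) = x"
  using h_inj h_inv_closed h_closed h_h_inv by blast

lemma span_closed:
  "0 \<in> PF_span n" "x \<in> PF_span n \<Longrightarrow> y \<in> PF_span n \<Longrightarrow> x + y \<in> PF_span n"
  "x \<in> PF_span n \<Longrightarrow> - x \<in> PF_span n" "x \<in> PF_span n \<Longrightarrow> y \<in> PF_span n \<Longrightarrow> x - y \<in> PF_span n"
  "x \<in> PF_span n \<Longrightarrow> pm_scale c x \<in> PF_span n" "(\<And>t. t \<in> S \<Longrightarrow> F t \<in> PF_span n) \<Longrightarrow> sum F S \<in> PF_span n"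
  for x y :: "(nat \<rightharpoonup> nat) \<Rightarrow>\<^sub>0 'k"
proof -
  show a: "x + y \<in> PF_span n" if "x \<in> PF_span n" "y \<in> PF_span n" for x y :: "(nat \<rightharpoonup> nat) \<Rightarrow>\<^sub>0 'k"
    using that Poly_Mapping.keys_add[of x y] unfolding PF_span_def by blast
  show m: "- x \<in> PF_span n" if "x \<in> PF_span n" for x :: "(nat \<rightharpoonup> nat) \<Rightarrow>\<^sub>0 'k"
    using that by (auto simp: PF_span_def in_keys_iff)
  show "x - y \<in> PF_span n" if "x \<in> PF_span n" "y \<in> PF_span n"
    using a[OF that(1) m[OF that(2)]] by simp
  show "pm_scale c x \<in> PF_span n" if "x \<in> PF_span n"
    using that subset_trans[OF keys_pm_scale[of c x]] by (simp add: PF_span_def)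
  show "sum F S \<in> PF_span n" if "\<And>t. t \<in> S \<Longrightarrow> F t \<in> PF_span n"
    using that keys_sum_subset[of S F "PF n"] by (simp add: PF_span_def)
qed (simp add: PF_span_def)

lemma coef_simps:
  "coef (x + y) m = coef x m + coef y m" "coef (x - y) m = coef x m - coef y m" "coef 0 m = 0"
  "coef (pm_scale c x) m = c * coef x m" "coef (- x) m = - coef x m"
  "coef (sum F S) m = (\<Sum>t\<in>S. coef (F t) m)"
  by (simp_all add: coef_def pm_linearD[OF h_linear] lookup_add lookup_minus lookup_sum)

lemma coef_eqI: "x \<in> PF_span n \<Longrightarrow> y \<in> PF_span n \<Longrightarrow> (\<And>m. coef x m = coef y m) \<Longrightarrow> x = y"
  unfolding coef_def by (rule h_inj) (auto intro: poly_mapping_eqI)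

lemma coef_outside: "x \<in> PF_span n \<Longrightarrow> m \<notin> PF n \<Longrightarrow> coef x m = 0"
  using h_closed[of x] by (auto simp: coef_def in_keys_iff PF_span_def)

lemma b_closed: "m \<in> PF n \<Longrightarrow> basis_elem m \<in> PF_span n"
  unfolding basis_elem_def by (rule h_inv_closed) (simp add: PF_span_def)

lemma h_b: "m \<in> PF n \<Longrightarrow> h (basis_elem m) = Poly_Mapping.single m 1"
  unfolding basis_elem_def by (rule h_h_inv) (simp add: PF_span_def)

lemma coef_b: "m \<in> PF n \<Longrightarrow> coef (basis_elem m) m' = (if m = m' then 1 else 0)"
  by (simp add: coef_def h_b lookup_single when_def)

lemma b_mult: "f \<in> PF n \<Longrightarrow> k \<in> PF n \<Longrightarrow> dom f = ran k \<Longrightarrow> basis_elem f \<otimes>\<^bsub>A\<^esub> basis_elem k = basis_elem (f \<circ>\<^sub>m k)"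
  by (rule h_inj) (simp_all add: mult_closed b_closed comp_PF h_mult h_b ef_prod_single)

lemma mult_linear:
  assumes "x \<in> PF_span n" "y \<in> PF_span n" "z \<in> PF_span n"
  shows "(x + y) \<otimes>\<^bsub>A\<^esub> z = x \<otimes>\<^bsub>A\<^esub> z + y \<otimes>\<^bsub>A\<^esub> z" "z \<otimes>\<^bsub>A\<^esub> (x + y) = z \<otimes>\<^bsub>A\<^esub> x + z \<otimes>\<^bsub>A\<^esub> y"
    "pm_scale c x \<otimes>\<^bsub>A\<^esub> z = pm_scale c (x \<otimes>\<^bsub>A\<^esub> z)" "x \<otimes>\<^bsub>A\<^esub> pm_scale c z = pm_scale c (x \<otimes>\<^bsub>A\<^esub> z)"
  by (rule h_inj; use assms in \<open>simp add: span_closed mult_closed h_mult pm_linearD[OF h_linear]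
      pm_linearD[OF pm_linear_ef_prod(1)] pm_linearD[OF pm_linear_ef_prod(2)]\<close>)+

lemma mult_monoid:
  assumes "x \<in> PF_span n" "y \<in> PF_span n" "z \<in> PF_span n"
  shows "(x \<otimes>\<^bsub>A\<^esub> y) \<otimes>\<^bsub>A\<^esub> z = x \<otimes>\<^bsub>A\<^esub> (y \<otimes>\<^bsub>A\<^esub> z)" "\<one>\<^bsub>A\<^esub> \<otimes>\<^bsub>A\<^esub> x = x" "x \<otimes>\<^bsub>A\<^esub> \<one>\<^bsub>A\<^esub> = x"
  by (rule h_inj; use assms h_closed[OF assms(1)] in \<open>simp add: mult_closed one_closed h_mult h_one ef_prod_assoc ef_prod_one
     \<close>)+

lemma ring_A: "ring A"
proof (rule ringI)
  show "abelian_group A"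
  proof (rule abelian_groupI)
    fix x assume "x \<in> carrier A"
    then show "\<exists>y\<in>carrier A. y \<oplus>\<^bsub>A\<^esub> x = \<zero>\<^bsub>A\<^esub>"
      unfolding carrier_A A_ops by (intro bexI[of _ "- x"] span_closed) simp
  qed (simp_all add: carrier_A A_ops span_closed add_ac)
  show "Group.monoid A"
    by (rule monoidI) (simp_all add: carrier_A mult_closed one_closed mult_monoid)
qed (simp_all add: carrier_A A_ops mult_linear)

sublocale A: ring A by (rule ring_A)

lemma k_algebra_A: "k_algebra A"
proof -
  have "module class_ring A"
  proof (intro module.intro module_axioms.intro A.abelian_group_axioms)
    show "cring (class_ring :: 'k ring)" using class_field by (auto simp: field_def domain_def)
  qed (simp_all add: carrier_A A_ops span_closed class_ring_simps pm_scale_add pm_scale_add_left)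
  then have "vectorspace class_ring A" by (intro vectorspace.intro class_field)
  then show ?thesis unfolding k_algebra_def
    using ring_A by (simp add: carrier_A A_ops mult_linear)
qed

section \<open>Left ideals, and coordinates with respect to the transported basis\<close>

lemma a_inv_A: "x \<in> PF_span n \<Longrightarrow> \<ominus>\<^bsub>A\<^esub> x = - x"
  by (rule A.minus_equality) (simp_all add: carrier_A A_ops span_closed)

lemma additive_subgroup_A: "additive_subgroup I A \<longleftrightarrow>
    I \<subseteq> PF_span n \<and> 0 \<in> I \<and> (\<forall>x\<in>I. \<forall>y\<in>I. x + y \<in> I) \<and> (\<forall>x\<in>I. - x \<in> I)"
proof
  assume "additive_subgroup I A"
  then interpret additive_subgroup I A .
  have "- x \<in> I" if "x \<in> I" for x
  proof -
    have "x \<in> PF_span n" using that a_subset carrier_A by blast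
    from a_inv_A[OF this] show ?thesis using a_inv_closed[OF that] by simp
  qed
  then show "I \<subseteq> PF_span n \<and> 0 \<in> I \<and> (\<forall>x\<in>I. \<forall>y\<in>I. x + y \<in> I) \<and> (\<forall>x\<in>I. - x \<in> I)"
    using a_subset zero_closed a_closed by (simp add: carrier_A A_ops)
next
  assume I: "I \<subseteq> PF_span n \<and> 0 \<in> I \<and> (\<forall>x\<in>I. \<forall>y\<in>I. x + y \<in> I) \<and> (\<forall>x\<in>I. - x \<in> I)"
  have "inv\<^bsub>add_monoid A\<^esub> x \<in> I" if "x \<in> I" for x
    using a_inv_A[of x] I that by (auto simp: a_inv_def)
  then show "additive_subgroup I A"
    using I by (intro additive_subgroupI subgroup.intro) (auto simp: carrier_A A_ops)
qed

lemma left_ideal_A: "left_ideal I A \<longleftrightarrow>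
    I \<subseteq> PF_span n \<and> 0 \<in> I \<and> (\<forall>x\<in>I. \<forall>y\<in>I. x + y \<in> I) \<and> (\<forall>a\<in>PF_span n. \<forall>x\<in>I. a \<otimes>\<^bsub>A\<^esub> x \<in> I)"
    (is "_ \<longleftrightarrow> ?R")
proof
  assume ?R
  have "- x \<in> I" if "x \<in> I" for x
  proof -
    have x: "x \<in> PF_span n" using \<open>?R\<close> that by blast
    have "pm_scale (-1) \<one>\<^bsub>A\<^esub> \<otimes>\<^bsub>A\<^esub> x \<in> I" using \<open>?R\<close> that one_closed span_closed(5) by blast
    moreover have "pm_scale (-1) \<one>\<^bsub>A\<^esub> \<otimes>\<^bsub>A\<^esub> x = - x"
      using mult_linear(3)[OF one_closed one_closed x] mult_monoid(2)[OF x x x] by (simp add: pm_scale_minus1[of x])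
    ultimately show ?thesis by metis
  qed
  then show "left_ideal I A" using \<open>?R\<close> by (simp add: left_ideal_def additive_subgroup_A carrier_A)
qed (simp add: left_ideal_def additive_subgroup_A carrier_A)

lemma left_idealD:
  assumes "left_ideal I A"
  shows "x \<in> I \<Longrightarrow> x \<in> PF_span n" "0 \<in> I" "x \<in> I \<Longrightarrow> y \<in> I \<Longrightarrow> x + y \<in> I"
    "a \<in> PF_span n \<Longrightarrow> x \<in> I \<Longrightarrow> a \<otimes>\<^bsub>A\<^esub> x \<in> I"
  using assms[unfolded left_ideal_A] by auto

text \<open>The definition of a left ideal mentions no scalars; they act through multiples of the
  unit.\<close>

lemma left_ideal_scale:
  assumes "left_ideal I A" "x \<in> I"
  shows "pm_scale c x \<in> I"
proof -
  have x: "x \<in> PF_span n" by (rule left_idealD(1)[OF assms])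
  have "pm_scale c \<one>\<^bsub>A\<^esub> \<otimes>\<^bsub>A\<^esub> x \<in> I"
    by (rule left_idealD(4)[OF assms(1) span_closed(5)[OF one_closed] assms(2)])
  then show ?thesis
    using mult_linear(3)[OF one_closed one_closed x] mult_monoid(2)[OF x x x] by simp
qed

lemma left_ideal_sum:
  assumes "left_ideal I A" "\<And>t. t \<in> S \<Longrightarrow> F t \<in> I"
  shows "sum F S \<in> I"
  using assms(2) by (induction S rule: infinite_finite_induct) (simp_all add: left_idealD[OF assms(1)])

lemma basis_expansion:
  assumes "x \<in> PF_span n"
  shows "x = (\<Sum>m\<in>PF n. pm_scale (coef x m) (basis_elem m))"
proof (rule coef_eqI[OF assms])
  show "(\<Sum>m\<in>PF n. pm_scale (coef x m) (basis_elem m)) \<in> PF_span n"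
    by (intro span_closed b_closed)
  fix m
  have "coef (\<Sum>m\<in>PF n. pm_scale (coef x m) (basis_elem m)) m = (\<Sum>k\<in>PF n. if k = m then coef x m else 0)"
    by (auto simp: coef_simps coef_b intro!: sum.cong)
  then show "coef x m = coef (\<Sum>m\<in>PF n. pm_scale (coef x m) (basis_elem m)) m"
    using coef_outside[OF assms, of m] finite_PF[of n] by simp
qed

lemma coef_mult_id:
  "x \<in> PF_span n \<Longrightarrow> y \<in> PF_span n \<Longrightarrow> coef (x \<otimes>\<^bsub>A\<^esub> y) (Some |` U) = coef x (Some |` U) * coef y (Some |` U)"
  unfolding coef_def by (simp add: h_mult lookup_ef_prod_id h_closed)

lemma coef_one: "coef \<one>\<^bsub>A\<^esub> m = (if \<exists>U\<subseteq>{1..n}. m = Some |` U then 1 else 0)"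
proof -
  have eq: "Some |` U = m \<longleftrightarrow> U = dom m \<and> m = Some |` dom m" for U :: "nat set" and m
    by (metis restrict_id_simps(1))
  have "coef \<one>\<^bsub>A\<^esub> m = (\<Sum>U\<in>Pow {1..n}. if U = dom m then if m = Some |` dom m then 1 else 0 else 0)"
    unfolding coef_def h_one ef_one_def lookup_sum
    by (intro sum.cong HOL.refl) (auto simp: lookup_single when_def eq)
  also have "\<dots> = (if \<exists>U\<subseteq>{1..n}. m = Some |` U then 1 else 0)"
  proof (cases "\<exists>U\<subseteq>{1..n}. m = Some |` U")
    case True
    then obtain U where "U \<subseteq> {1..n}" "m = Some |` U" by blast
    moreover from this have "dom m = U" by simp
    ultimately show ?thesis using True by simp
  next
    case False
    then have "\<not> (m = Some |` dom m \<and> dom m \<subseteq> {1..n})" by blast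
    then show ?thesis using False by simp
  qed
  finally show ?thesis .
qed

section \<open>The radical\<close>

definition coef_rad :: "((nat \<rightharpoonup> nat) \<Rightarrow>\<^sub>0 'k) set" where
  "coef_rad = {x \<in> PF_span n. \<forall>U. coef x (Some |` U) = 0}"

definition coef_rad2 :: "((nat \<rightharpoonup> nat) \<Rightarrow>\<^sub>0 'k) set" where
  "coef_rad2 = {x \<in> coef_rad. \<forall>d\<in>arrows n. coef x d = 0}"

text \<open>The kernel of a character has codimension one: an element outside it, suitably rescaled,
  differs from any given \<open>x\<close> by an element of the kernel.\<close>

lemma maximal_left_ideal_coef:
  assumes "U \<subseteq> {1..n}"
  shows "maximal_left_ideal {x \<in> PF_span n. coef x (Some |` U) = 0} A"
  unfolding maximal_left_ideal_def
proof (intro conjI allI impI)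
  let ?M = "{x \<in> PF_span n. coef x (Some |` U) = 0}"
  show "left_ideal ?M A"
    unfolding left_ideal_A using span_closed(1,2) mult_closed by (auto simp: coef_simps coef_mult_id)
  have "\<one>\<^bsub>A\<^esub> \<notin> ?M" using assms by (auto simp: coef_one)
  then show "?M \<noteq> carrier A" using one_closed carrier_A by blast
  fix J assume J: "left_ideal J A \<and> ?M \<subseteq> J"
  show "J = ?M \<or> J = carrier A"
  proof (rule disjCI)
    assume "J \<noteq> carrier A"
    have JA: "J \<subseteq> PF_span n" using left_idealD(1) J by auto
    show "J = ?M"
    proof (rule ccontr)
      assume "J \<noteq> ?M"
      then obtain y where y: "y \<in> J" "coef y (Some |` U) \<noteq> 0" "y \<in> PF_span n" using J JA by blast
      have "x \<in> J" if x: "x \<in> PF_span n" for x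
      proof -
        define z where "z = pm_scale (coef x (Some |` U) / coef y (Some |` U)) y"
        have z: "z \<in> J" unfolding z_def using J y by (intro left_ideal_scale) auto
        have "x - z \<in> ?M" using x y(2) z JA span_closed(4)[OF x, of z] by (auto simp: coef_simps z_def)
        then have "(x - z) + z \<in> J" using J z left_idealD(3)[of J "x - z" z] by auto
        then show ?thesis by simp
      qed
      then show False using \<open>J \<noteq> carrier A\<close> JA carrier_A by blast
    qed
  qed
qed

text \<open>Multiplication by an element of \<open>coef_rad\<close> on the right raises the sum of the points of the domain,
  so \<open>1 - y\<close> generates every basis element by downward induction.\<close>

lemma left_ideal_one_minus:
  assumes "left_ideal M A" "y \<in> coef_rad" "\<one>\<^bsub>A\<^esub> - y \<in> M"
  shows "M = PF_span n"
proof -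
  have y: "y \<in> PF_span n" "\<And>U. coef y (Some |` U) = 0" using assms(2) by (auto simp: coef_rad_def)
  have M: "M \<subseteq> PF_span n" "\<And>x y. x \<in> M \<Longrightarrow> y \<in> M \<Longrightarrow> x + y \<in> M"
    "\<And>a x. a \<in> PF_span n \<Longrightarrow> x \<in> M \<Longrightarrow> a \<otimes>\<^bsub>A\<^esub> x \<in> M"
    using left_idealD[OF assms(1)] by auto
  have expand: "x \<in> M" if "x \<in> PF_span n" "\<And>m. m \<in> PF n \<Longrightarrow> coef x m \<noteq> 0 \<Longrightarrow> basis_elem m \<in> M" for x
  proof -
    have "pm_scale (coef x m) (basis_elem m) \<in> M" if "m \<in> PF n" for m
      using left_ideal_scale[OF assms(1) \<open>\<And>m. m \<in> PF n \<Longrightarrow> coef x m \<noteq> 0 \<Longrightarrow> basis_elem m \<in> M\<close>[OF that]]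
        left_idealD(2)[OF assms(1)] by (cases "coef x m = 0") simp_all
    then show ?thesis by (subst basis_expansion[OF \<open>x \<in> PF_span n\<close>]) (rule left_ideal_sum[OF assms(1)])
  qed
  \<comment> \<open>The element is recovered as its product with \<open>1 - y\<close> plus its
    product with \<open>y\<close>, whose terms have domains of larger sum. The measure uses
    truncated subtraction, which is genuine here because domains lie in
    \<open>{1..n}\<close>.\<close>
  have bM: "basis_elem m \<in> M" if "m \<in> PF n" for m
    using that
  proof (induction "\<Sum>{1..n} - \<Sum>(dom m)" arbitrary: m rule: less_induct)
    case less
    have le: "\<Sum>(dom k) \<le> \<Sum>{1..n}" if "k \<in> PF n" for k
      using PF_D(1)[OF that] by (intro sum_mono2) auto
    have "basis_elem m \<otimes>\<^bsub>A\<^esub> y \<in> M"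
    proof (rule expand)
      show "basis_elem m \<otimes>\<^bsub>A\<^esub> y \<in> PF_span n" using less.prems y by (intro mult_closed b_closed)
      fix k assume k: "k \<in> PF n" "coef (basis_elem m \<otimes>\<^bsub>A\<^esub> y) k \<noteq> 0"
      have "\<exists>z\<in>PF n. dom m = ran z \<and> m \<circ>\<^sub>m z = k \<and> coef y z \<noteq> 0"
      proof (rule ccontr)
        assume no: "\<not> ?thesis"
        have "coef (basis_elem m \<otimes>\<^bsub>A\<^esub> y) k = 0"
          unfolding coef_def h_mult[OF b_closed[OF less.prems] y(1)] lookup_ef_prod
        proof (intro sum.neutral ballI)
          fix x' z assume "x' \<in> Poly_Mapping.keys (h (basis_elem m))" "z \<in> Poly_Mapping.keys (h y)"
          then have "x' = m" "z \<in> PF n" "coef y z \<noteq> 0"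
            using h_b[OF less.prems] PF_spanD[OF h_closed[OF y(1)], of z] by (auto simp: coef_def in_keys_iff split: if_splits)
          then show "(if dom x' = ran z \<and> x' \<circ>\<^sub>m z = k then Poly_Mapping.lookup (h (basis_elem m)) x' * Poly_Mapping.lookup (h y) z else 0) = 0"
            using no by auto
        qed
        then show False using k by simp
      qed
      then obtain z where z: "z \<in> PF n" "dom m = ran z" "m \<circ>\<^sub>m z = k" "coef y z \<noteq> 0" by blast
      have "z \<noteq> Some |` dom z" using z(4) y(2)[of "dom z"] by auto
      then have "\<Sum>(ran z) < \<Sum>(dom z)" using sum_ran_le[OF z(1)] by fastforce
      moreover have "dom k = dom z" using dom_ran_comp(1)[OF z(2)] z(3) by simp
      ultimately have "\<Sum>{1..n} - \<Sum>(dom k) < \<Sum>{1..n} - \<Sum>(dom m)"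
        using z(2) le[OF k(1)] by simp
      then show "basis_elem k \<in> M" using less.hyps k(1) by blast
    qed
    moreover have "basis_elem m \<otimes>\<^bsub>A\<^esub> (\<one>\<^bsub>A\<^esub> - y) \<in> M" by (rule M(3)[OF b_closed[OF less.prems] assms(3)])
    ultimately have "basis_elem m \<otimes>\<^bsub>A\<^esub> (\<one>\<^bsub>A\<^esub> - y) + basis_elem m \<otimes>\<^bsub>A\<^esub> y \<in> M" by (simp add: M(2))
    moreover have "basis_elem m \<otimes>\<^bsub>A\<^esub> (\<one>\<^bsub>A\<^esub> - y) + basis_elem m \<otimes>\<^bsub>A\<^esub> y = basis_elem m"
      using mult_linear(2)[OF span_closed(4)[OF one_closed y(1)] y(1) b_closed[OF less.prems]]
        mult_monoid(3)[OF b_closed[OF less.prems] y(1) y(1)] by simp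
    ultimately show ?case by simp
  qed
  then show ?thesis using expand M(1) by auto
qed

lemma coef_rad_closed:
  "0 \<in> coef_rad" "x \<in> coef_rad \<Longrightarrow> y \<in> coef_rad \<Longrightarrow> x + y \<in> coef_rad" "x \<in> coef_rad \<Longrightarrow> - x \<in> coef_rad" "x \<in> coef_rad \<Longrightarrow> pm_scale c x \<in> coef_rad"
  "a \<in> PF_span n \<Longrightarrow> x \<in> coef_rad \<Longrightarrow> a \<otimes>\<^bsub>A\<^esub> x \<in> coef_rad" "a \<in> PF_span n \<Longrightarrow> x \<in> coef_rad \<Longrightarrow> x \<otimes>\<^bsub>A\<^esub> a \<in> coef_rad"
  unfolding coef_rad_def using span_closed(1-3,5) mult_closed by (simp_all add: coef_simps coef_mult_id)

text \<open>The kernels of the coefficients at identities are maximal left ideals, which bounds the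
  radical from above. Conversely, if a maximal \<open>M\<close> missed \<open>x\<close>, then
  \<open>M + A x\<close> would be everything, so \<open>M\<close> would contain
  \<open>1 - a x\<close> for some \<open>a\<close>, contradicting
  \<open>left_ideal_one_minus\<close>.\<close>

lemma Rad_A: "Rad A = coef_rad"
proof (intro equalityI subsetI)
  fix x assume x: "x \<in> Rad A"
  then have xA: "x \<in> PF_span n" by (simp add: Rad_def carrier_A)
  have "coef x (Some |` U) = 0" for U
  proof (cases "U \<subseteq> {1..n}")
    case True
    then show ?thesis using x maximal_left_ideal_coef[OF True] unfolding Rad_def by blast
  next
    case False
    then have "Some |` U \<notin> PF n" using PF_D(1)[of "Some |` U" n] by auto
    then show ?thesis using coef_outside[OF xA] by blast
  qed
  then show "x \<in> coef_rad" using xA by (simp add: coef_rad_def)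
next
  fix x assume x: "x \<in> coef_rad"
  then have xA: "x \<in> PF_span n" by (simp add: coef_rad_def)
  have "x \<in> M" if M: "maximal_left_ideal M A" for M
  proof (rule ccontr)
    assume "x \<notin> M"
    have L: "left_ideal M A" and ne: "M \<noteq> PF_span n" using M by (auto simp: maximal_left_ideal_def carrier_A)
    note LM = left_idealD[OF L]
    define J where "J = {m + a \<otimes>\<^bsub>A\<^esub> x | m a. m \<in> M \<and> a \<in> PF_span n}"
    have J_I: "m + a \<otimes>\<^bsub>A\<^esub> x \<in> J" if "m \<in> M" "a \<in> PF_span n" for m a using that J_def by blast
    have zx: "0 \<otimes>\<^bsub>A\<^esub> x = 0" using A.l_null[of x] xA by (simp add: carrier_A A_ops)
    have "left_ideal J A"
      unfolding left_ideal_A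
    proof (intro conjI ballI)
      show "J \<subseteq> PF_span n" unfolding J_def using LM(1) span_closed(2) mult_closed[OF _ xA] by auto
      show "0 \<in> J" using J_I[of 0 0] LM(2) span_closed(1) zx by simp
    next
      fix u v :: "(nat \<rightharpoonup> nat) \<Rightarrow>\<^sub>0 'k" assume "u \<in> J" "v \<in> J"
      then obtain m a m' a' where *: "u = m + a \<otimes>\<^bsub>A\<^esub> x" "m \<in> M" "a \<in> PF_span n"
        "v = m' + a' \<otimes>\<^bsub>A\<^esub> x" "m' \<in> M" "a' \<in> PF_span n" unfolding J_def by blast
      have "u + v = (m + m') + (a + a') \<otimes>\<^bsub>A\<^esub> x"
        using * xA by (simp add: mult_linear add_ac)
      moreover have "m + m' \<in> M" "a + a' \<in> PF_span n" using *(2,3,5,6) LM(3) span_closed(2) by auto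
      ultimately show "u + v \<in> J" using J_I by metis
    next
      fix c u :: "(nat \<rightharpoonup> nat) \<Rightarrow>\<^sub>0 'k" assume c: "c \<in> PF_span n" and "u \<in> J"
      then obtain m a where *: "u = m + a \<otimes>\<^bsub>A\<^esub> x" "m \<in> M" "a \<in> PF_span n" unfolding J_def by blast
      have mA: "m \<in> PF_span n" by (rule LM(1)[OF *(2)])
      have "c \<otimes>\<^bsub>A\<^esub> u = c \<otimes>\<^bsub>A\<^esub> m + (c \<otimes>\<^bsub>A\<^esub> a) \<otimes>\<^bsub>A\<^esub> x"
        using * xA c mA by (simp add: mult_linear mult_monoid mult_closed)
      moreover have "c \<otimes>\<^bsub>A\<^esub> m \<in> M" "c \<otimes>\<^bsub>A\<^esub> a \<in> PF_span n" using *(2,3) LM(4) c mult_closed by auto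
      ultimately show "c \<otimes>\<^bsub>A\<^esub> u \<in> J" using J_I by metis
    qed
    moreover have "M \<subseteq> J" using J_I[OF _ span_closed(1)] zx by auto
    moreover have "x \<in> J" using J_I[of 0 "\<one>\<^bsub>A\<^esub>"] LM(2) one_closed mult_monoid(2)[OF xA xA xA] by simp
    ultimately have "J = PF_span n" using M \<open>x \<notin> M\<close> unfolding maximal_left_ideal_def carrier_A by metis
    then obtain m a where ma: "\<one>\<^bsub>A\<^esub> = m + a \<otimes>\<^bsub>A\<^esub> x" "m \<in> M" "a \<in> PF_span n"
      using one_closed unfolding J_def by blast
    have "\<one>\<^bsub>A\<^esub> - a \<otimes>\<^bsub>A\<^esub> x \<in> M" using ma by simp
    then have "M = PF_span n" using left_ideal_one_minus[OF L coef_rad_closed(5)[OF ma(3) x]] by blast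
    then show False using ne by blast
  qed
  then show "x \<in> Rad A" using xA by (simp add: Rad_def carrier_A)
qed

lemma coef_rad2_closed:
  "0 \<in> coef_rad2" "x \<in> coef_rad2 \<Longrightarrow> y \<in> coef_rad2 \<Longrightarrow> x + y \<in> coef_rad2" "x \<in> coef_rad2 \<Longrightarrow> - x \<in> coef_rad2" "x \<in> coef_rad2 \<Longrightarrow> pm_scale c x \<in> coef_rad2"
  unfolding coef_rad2_def using coef_rad_closed(1-4) by (simp_all add: coef_simps)

text \<open>Arrow coefficients vanish on products of radical elements by irreducibility. Conversely,
  a basis element that is neither an identity nor an arrow is a product of two belonging to
  non-identities.\<close>

lemma Rad2_A: "Rad2 A = coef_rad2"
proof (intro equalityI subsetI)
  fix x assume "x \<in> Rad2 A"
  then have "x \<in> ideal_prod A coef_rad coef_rad" by (simp add: Rad2_def Rad_A)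
  then show "x \<in> coef_rad2"
  proof induction
    case (prod i j)
    then have ij: "i \<in> PF_span n" "j \<in> PF_span n" "\<And>U. coef i (Some |` U) = 0" "\<And>U. coef j (Some |` U) = 0"
      by (auto simp: coef_rad_def)
    have "coef (i \<otimes>\<^bsub>A\<^esub> j) d = 0" if "d \<in> arrows n" for d
      using lookup_ef_prod_arrow[OF h_closed[OF ij(1)] h_closed[OF ij(2)] that] ij
      by (simp add: coef_def h_mult)
    then show ?case using coef_rad_closed(5)[OF ij(1) prod(2)] by (simp add: coef_rad2_def)
  next
    case (sum s t)
    then show ?case using coef_rad2_closed(2) by (simp add: A_ops)
  qed
next
  fix x assume x: "x \<in> coef_rad2"
  then have xA: "x \<in> PF_span n" by (simp add: coef_rad2_def coef_rad_def)
  \<comment> \<open>The inductive set \<open>ideal_prod\<close> is generated by products and sums,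
    so zero has to be exhibited as a product.\<close>
  have z: "0 \<in> ideal_prod A coef_rad coef_rad"
    using ideal_prod.prod[OF coef_rad_closed(1) coef_rad_closed(1), of A] A.l_null[of 0] by (simp add: carrier_A A_ops span_closed)
  have s: "u + v \<in> ideal_prod A coef_rad coef_rad" if "u \<in> ideal_prod A coef_rad coef_rad" "v \<in> ideal_prod A coef_rad coef_rad" for u v
    using ideal_prod.sum[OF that] by (simp add: A_ops)
  have "pm_scale (coef x m) (basis_elem m) \<in> ideal_prod A coef_rad coef_rad" if m: "m \<in> PF n" for m
  proof (cases "coef x m = 0")
    case True
    then show ?thesis using z by simp
  next
    case False
    moreover have "coef x (Some |` dom m) = 0" using x by (simp add: coef_rad2_def coef_rad_def)
    ultimately have "m \<noteq> Some |` dom m" by metis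
    moreover have "m \<notin> arrows n" using False x unfolding coef_rad2_def by blast
    ultimately obtain f f' where f: "f \<in> PF n" "f' \<in> PF n" "dom f = ran f'" "m = f \<circ>\<^sub>m f'"
      "f \<noteq> Some |` dom f" "f' \<noteq> Some |` dom f'" by (rule non_arrow_factors[OF m])
    have nid: "k \<noteq> Some |` U" if "k \<noteq> Some |` dom k" for k :: "nat \<rightharpoonup> nat" and U using that by auto
    have bN: "basis_elem f \<in> coef_rad" "basis_elem f' \<in> coef_rad"
      using f nid[OF f(5)] nid[OF f(6)] b_closed by (simp_all add: coef_rad_def coef_b)
    have "pm_scale (coef x m) (basis_elem m) = pm_scale (coef x m) (basis_elem f) \<otimes>\<^bsub>A\<^esub> basis_elem f'"
      using f b_mult mult_linear(3)[OF b_closed[OF f(1)] b_closed[OF f(1)] b_closed[OF f(2)]] by simp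
    then show ?thesis using ideal_prod.prod[OF coef_rad_closed(4)[OF bN(1)] bN(2)] by simp
  qed
  then have "sum (\<lambda>m. pm_scale (coef x m) (basis_elem m)) S \<in> ideal_prod A coef_rad coef_rad" if "S \<subseteq> PF n" for S
    using that z s by (induction S rule: infinite_finite_induct) auto
  then show "x \<in> Rad2 A"
    by (subst basis_expansion[OF xA]) (simp add: Rad2_def Rad_A)
qed

end

section \<open>Idempotents, arrow spaces and the presentation\<close>

lemma ring_field_power: "ring (field_power r :: ('k::field, nat \<Rightarrow> 'k) module)"
proof (rule ringI)
  show "abelian_group (field_power r :: ('k, nat \<Rightarrow> 'k) module)"
  proof (rule abelian_groupI)
    fix x :: "nat \<Rightarrow> 'k" assume "x \<in> carrier (field_power r)"
    then show "\<exists>y\<in>carrier (field_power r). y \<oplus>\<^bsub>field_power r\<^esub> x = \<zero>\<^bsub>field_power r\<^esub>"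
      by (intro bexI[of _ "\<lambda>i\<in>{..<r}. - x i"]) (auto simp: field_power_def fun_eq_iff)
  qed (auto simp: field_power_def fun_eq_iff PiE_iff extensional_def)
  show "Group.monoid (field_power r :: ('k, nat \<Rightarrow> 'k) module)"
    by (rule monoidI) (auto simp: field_power_def fun_eq_iff PiE_iff extensional_def)
qed (auto simp: field_power_def fun_eq_iff distrib_left distrib_right)

context ef_algebra
begin

lemma e_closed: "U \<subseteq> {1..n} \<Longrightarrow> vertex_idem U \<in> PF_span n"
  by (rule b_closed[OF id_PF])

lemma coef_e: "U \<subseteq> {1..n} \<Longrightarrow> coef (vertex_idem U) m = (if m = Some |` U then 1 else 0)"
  by (auto simp: coef_b id_PF)

lemma restrict_id_eq_iff: "Some |` U = Some |` V \<longleftrightarrow> U = V" for U V :: "nat set"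
  by (metis restrict_id_simps(1))

lemma restrict_id_comp: "(Some |` U) \<circ>\<^sub>m (Some |` U) = Some |` U" for U :: "nat set"
  using restrict_id_simps(3)[of "Some |` U"] by simp

lemma inj_e: "inj_on vertex_idem (Pow {1..n})"
proof (rule inj_onI)
  fix U V assume "U \<in> Pow {1..n}" "V \<in> Pow {1..n}" "vertex_idem U = vertex_idem V"
  then have "coef (vertex_idem U) (Some |` U) = coef (vertex_idem V) (Some |` U)" by simp
  then show "U = V" using \<open>U \<in> _\<close> \<open>V \<in> _\<close> by (auto simp: coef_e restrict_id_eq_iff split: if_splits)
qed

lemma e_mult:
  assumes "U \<subseteq> {1..n}" "V \<subseteq> {1..n}"
  shows "vertex_idem U \<otimes>\<^bsub>A\<^esub> vertex_idem V = (if U = V then vertex_idem U else 0)"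
proof (rule h_inj)
  show "h (vertex_idem U \<otimes>\<^bsub>A\<^esub> vertex_idem V) = h (if U = V then vertex_idem U else 0)"
    using assms by (simp add: restrict_id_comp h_mult e_closed h_b id_PF ef_prod_single pm_linearD[OF h_linear])
qed (use assms in \<open>auto simp: mult_closed e_closed span_closed\<close>)

lemma coef_sandwich:
  assumes "x \<in> PF_span n" "U \<subseteq> {1..n}" "V \<subseteq> {1..n}"
  shows "coef (vertex_idem V \<otimes>\<^bsub>A\<^esub> x \<otimes>\<^bsub>A\<^esub> vertex_idem U) m = (if dom m = U \<and> ran m = V then coef x m else 0)"
  using assms by (simp add: coef_def h_mult e_closed mult_closed h_b id_PF lookup_ef_prod_sandwich)

text \<open>Orthogonality makes a summand \<open>f\<close> equal to its sandwich between two copies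
  of the idempotent, so \<open>f\<close> is supported on endomorphisms of \<open>U\<close>, that is,
  on the identity. Its coefficient \<open>t\<close> satisfies \<open>t = t * t\<close> and hence is
  0 or 1.\<close>

lemma primitive_e:
  assumes U: "U \<subseteq> {1..n}"
  shows "primitive_idempotent A (vertex_idem U)"
  unfolding primitive_idempotent_def
proof (intro conjI allI impI)
  show "idempotent_in A (vertex_idem U)" using U by (simp add: idempotent_in_def e_mult e_closed carrier_A)
  show "vertex_idem U \<noteq> \<zero>\<^bsub>A\<^esub>"
  proof
    assume "vertex_idem U = \<zero>\<^bsub>A\<^esub>"
    then have "coef (vertex_idem U) (Some |` U) = 0" by (simp add: A_ops coef_simps)
    then show False using U by (simp add: coef_e)
  qed
  fix f k
  assume fk: "idempotent_in A f \<and> idempotent_in A k \<and> f \<otimes>\<^bsub>A\<^esub> k = \<zero>\<^bsub>A\<^esub> \<and> k \<otimes>\<^bsub>A\<^esub> f = \<zero>\<^bsub>A\<^esub> \<and> vertex_idem U = f \<oplus>\<^bsub>A\<^esub> k"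
  then have f: "f \<in> PF_span n" "f \<otimes>\<^bsub>A\<^esub> f = f" and k: "k \<in> PF_span n"
    and fk0: "f \<otimes>\<^bsub>A\<^esub> k = 0" "k \<otimes>\<^bsub>A\<^esub> f = 0" and eq: "vertex_idem U = f + k"
    by (auto simp: idempotent_in_def carrier_A A_ops)
  have "vertex_idem U \<otimes>\<^bsub>A\<^esub> f \<otimes>\<^bsub>A\<^esub> vertex_idem U = f"
    using f k fk0 by (simp add: eq mult_linear)
  then have c: "coef f m = 0" if "\<not> (dom m = U \<and> ran m = U)" for m
    using coef_sandwich[OF f(1) U U, of m] that by simp
  define t where "t = coef f (Some |` U)"
  have c': "coef f m = (if m = Some |` U then t else 0)" for m
  proof (cases "dom m = U \<and> ran m = U \<and> m \<in> PF n")
    case True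
    then have "m = Some |` U" using endo_PF[of m n] by simp
    then show ?thesis by (simp add: t_def)
  next
    case False
    then have "coef f m = 0" using c[of m] coef_outside[OF f(1), of m] by blast
    moreover have "m \<noteq> Some |` U" using False id_PF[OF U] restrict_id_simps(1,2)[of U] by metis
    ultimately show ?thesis by simp
  qed
  have "t = t * t" using coef_mult_id[OF f(1) f(1), of U] unfolding f(2) t_def .
  then consider "t = 0" | "t = 1" using mult_cancel_left1[of t t] by blast
  then show "f = \<zero>\<^bsub>A\<^esub> \<or> k = \<zero>\<^bsub>A\<^esub>"
  proof cases
    case 1
    have "f = 0" using c' 1 by (intro coef_eqI[OF f(1) span_closed(1)]) (simp add: coef_simps)
    then show ?thesis by (simp add: A_ops)
  next
    case 2
    have "f = vertex_idem U" using c' 2 by (intro coef_eqI[OF f(1) e_closed[OF U]]) (simp add: coef_e[OF U])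
    then have "k = 0" using eq by simp
    then show ?thesis by (simp add: A_ops)
  qed
qed

lemma finsum_A: "finite S \<Longrightarrow> F \<in> S \<rightarrow> PF_span n \<Longrightarrow> finsum A F S = sum F S"
proof (induction S rule: finite_induct)
  case empty
  then show ?case by (simp add: A_ops)
next
  case (insert x S)
  then show ?case by (subst A.finsum_insert) (auto simp: carrier_A A_ops)
qed

lemma sum_e: "(\<Sum>U\<in>Pow {1..n}. vertex_idem U) = \<one>\<^bsub>A\<^esub>"
proof (rule h_inj)
  show "(\<Sum>U\<in>Pow {1..n}. vertex_idem U) \<in> PF_span n" by (rule span_closed(6)) (simp add: e_closed)
  have "h (\<Sum>U\<in>Pow {1..n}. vertex_idem U) = (\<Sum>U\<in>Pow {1..n}. Poly_Mapping.single (Some |` U) 1)"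
    unfolding pm_linearD(6)[OF h_linear] by (rule sum.cong) (auto simp: h_b id_PF)
  then show "h (\<Sum>U\<in>Pow {1..n}. vertex_idem U) = h \<one>\<^bsub>A\<^esub>" by (simp add: h_one ef_one_def)
qed (rule one_closed)

lemma complete_e: "complete_primitive_orthogonal A (vertex_idem ` Pow {1..n})"
  unfolding complete_primitive_orthogonal_def
proof (intro conjI ballI impI)
  show "x \<otimes>\<^bsub>A\<^esub> y = \<zero>\<^bsub>A\<^esub>" if "x \<in> vertex_idem ` Pow {1..n}" "y \<in> vertex_idem ` Pow {1..n}" "x \<noteq> y" for x y
    using that by (auto simp: e_mult A_ops)
  have "(\<Oplus>\<^bsub>A\<^esub>x\<in>vertex_idem ` Pow {1..n}. x) = (\<Sum>x\<in>vertex_idem ` Pow {1..n}. x)"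
    by (rule finsum_A) (auto simp: e_closed)
  also have "\<dots> = \<one>\<^bsub>A\<^esub>" by (simp add: sum.reindex[OF inj_e] sum_e)
  finally show "(\<Oplus>\<^bsub>A\<^esub>x\<in>vertex_idem ` Pow {1..n}. x) = \<one>\<^bsub>A\<^esub>" .
qed (auto simp: primitive_e)

section \<open>Cosets and the semisimple quotient\<close>

lemma coset_A: "K +>\<^bsub>A\<^esub> x = (\<lambda>k. k + x) ` K"
  by (auto simp: a_r_coset_def' A_ops)

lemma coset_eq:
  assumes "0 \<in> K" "\<And>x y. x \<in> K \<Longrightarrow> y \<in> K \<Longrightarrow> x + y \<in> K" "\<And>x. x \<in> K \<Longrightarrow> - x \<in> K"
  shows "K +>\<^bsub>A\<^esub> x = K +>\<^bsub>A\<^esub> y \<longleftrightarrow> x - y \<in> K"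
proof
  assume "K +>\<^bsub>A\<^esub> x = K +>\<^bsub>A\<^esub> y"
  moreover have "x \<in> K +>\<^bsub>A\<^esub> x" using assms(1) by (auto simp: coset_A intro: image_eqI[of _ _ 0])
  ultimately obtain k where "k \<in> K" "x = k + y" by (auto simp: coset_A)
  then show "x - y \<in> K" by simp
next
  assume xy: "x - y \<in> K"
  then have yx: "y - x \<in> K" using assms(3)[OF xy] by simp
  have sub: "K +>\<^bsub>A\<^esub> x \<subseteq> K +>\<^bsub>A\<^esub> y" if xy: "x - y \<in> K" for x y
  proof
    fix z assume "z \<in> K +>\<^bsub>A\<^esub> x"
    then obtain k where k: "k \<in> K" "z = k + x" by (auto simp: coset_A)
    then have "z = (k + (x - y)) + y" by simp
    then show "z \<in> K +>\<^bsub>A\<^esub> y" unfolding coset_A by (rule image_eqI) (rule assms(2)[OF k(1) xy])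
  qed
  show "K +>\<^bsub>A\<^esub> x = K +>\<^bsub>A\<^esub> y"
    using sub[OF xy] sub[OF yx] by (rule equalityI)
qed

text \<open>Scalar multiplication in \<open>alg_quot\<close> is a union over all representatives;
  every one of them contributes the same coset.\<close>

lemma coset_scale:
  assumes "0 \<in> K" "\<And>x y. x \<in> K \<Longrightarrow> y \<in> K \<Longrightarrow> x + y \<in> K" "\<And>x. x \<in> K \<Longrightarrow> - x \<in> K"
    "\<And>c x. x \<in> K \<Longrightarrow> pm_scale c x \<in> K"
  shows "(\<Union>y\<in>K +>\<^bsub>A\<^esub> x. K +>\<^bsub>A\<^esub> (c \<odot>\<^bsub>A\<^esub> y)) = K +>\<^bsub>A\<^esub> pm_scale c x"
proof -
  have "K +>\<^bsub>A\<^esub> (c \<odot>\<^bsub>A\<^esub> y) = K +>\<^bsub>A\<^esub> pm_scale c x" if y: "y \<in> K +>\<^bsub>A\<^esub> x" for y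
  proof -
    obtain k where k: "k \<in> K" "y = k + x" using y by (auto simp: coset_A)
    have "pm_scale c y - pm_scale c x = pm_scale c k" by (simp add: k pm_scale_add)
    then have "pm_scale c y - pm_scale c x \<in> K" using assms(4)[OF k(1)] by simp
    then show ?thesis unfolding A_ops using coset_eq[OF assms(1-3)] by simp
  qed
  moreover have "x \<in> K +>\<^bsub>A\<^esub> x" using assms(1) by (auto simp: coset_A intro: image_eqI[of _ _ 0])
  ultimately show ?thesis by auto
qed

lemma coset_add:
  assumes "0 \<in> K" "\<And>x y. x \<in> K \<Longrightarrow> y \<in> K \<Longrightarrow> x + y \<in> K"
  shows "(K +>\<^bsub>A\<^esub> x) <+>\<^bsub>A\<^esub> (K +>\<^bsub>A\<^esub> y) = K +>\<^bsub>A\<^esub> (x + y)"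
proof (intro equalityI subsetI)
  fix z assume "z \<in> (K +>\<^bsub>A\<^esub> x) <+>\<^bsub>A\<^esub> (K +>\<^bsub>A\<^esub> y)"
  then obtain k l where k: "k \<in> K" "l \<in> K" "z = (k + x) + (l + y)" by (auto simp: set_add_def' coset_A A_ops)
  then have "z = (k + l) + (x + y)" by (simp add: add_ac)
  then show "z \<in> K +>\<^bsub>A\<^esub> (x + y)" unfolding coset_A by (rule image_eqI) (rule assms(2)[OF k(1,2)])
next
  fix z assume "z \<in> K +>\<^bsub>A\<^esub> (x + y)"
  then obtain k where "k \<in> K" "z = (k + x) + (0 + y)" by (auto simp: coset_A add_ac)
  then show "z \<in> (K +>\<^bsub>A\<^esub> x) <+>\<^bsub>A\<^esub> (K +>\<^bsub>A\<^esub> y)"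
    using assms(1) unfolding set_add_def' coset_A A_ops by blast
qed

text \<open>The coefficients at the identities form a homomorphism onto as many copies of the field
  as there are subsets, with kernel \<open>Rad A\<close>. The library gives the induced ring
  isomorphism; scalars are then checked on cosets.\<close>

lemma split_basic_A: "split_basic A"
proof -
  obtain u where u: "bij_betw u {0..<card (Pow {1..n})} (Pow {1..n})"
    using ex_bij_betw_nat_finite[of "Pow {1..n}"] by auto
  define r where "r = card (Pow {1..n})"
  have u: "bij_betw u {..<r} (Pow {1..n})" using u by (simp add: r_def atLeast0LessThan)
  define \<psi> where "\<psi> x = (\<lambda>i\<in>{..<r}. coef x (Some |` u i))" for x
  let ?F = "field_power r :: ('k, nat \<Rightarrow> 'k) module"
  have uU: "u i \<subseteq> {1..n}" if "i < r" for i using u that by (auto simp: bij_betw_def)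
  have hom: "ring_hom_ring A ?F \<psi>"
  proof (rule ring_hom_ringI[OF ring_A ring_field_power])
    have "coef \<one>\<^bsub>A\<^esub> (Some |` u i) = 1" if "i < r" for i
      unfolding coef_one using uU[OF that] by (intro if_P) blast
    then show "\<psi> \<one>\<^bsub>A\<^esub> = \<one>\<^bsub>?F\<^esub>" by (auto simp: \<psi>_def field_power_def fun_eq_iff)
  qed (auto simp: \<psi>_def field_power_def carrier_A A_ops coef_simps coef_mult_id fun_eq_iff)
  interpret ring_hom_ring A ?F \<psi> by (rule hom)
  have ker: "a_kernel A ?F \<psi> = Rad A"
  proof -
    have "\<psi> x = \<zero>\<^bsub>?F\<^esub> \<longleftrightarrow> (\<forall>U. coef x (Some |` U) = 0)" if x: "x \<in> PF_span n" for x
    proof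
      assume z: "\<psi> x = \<zero>\<^bsub>?F\<^esub>"
      show "\<forall>U. coef x (Some |` U) = 0"
      proof
        fix U
        show "coef x (Some |` U) = 0"
        proof (cases "U \<subseteq> {1..n}")
          case True
          then have "U \<in> u ` {..<r}" using u by (simp add: bij_betw_def)
          then obtain i where "i < r" "u i = U" by blast
          then show ?thesis using fun_cong[OF z, of i] by (simp add: \<psi>_def field_power_def)
        next
          case False
          then have "Some |` U \<notin> PF n" using PF_D(1)[of "Some |` U" n] by auto
          then show ?thesis using coef_outside[OF x] by blast
        qed
      qed
    qed (auto simp: \<psi>_def field_power_def)
    then show ?thesis unfolding a_kernel_def' Rad_A coef_rad_def carrier_A by blast
  qed
  have surj: "\<psi> ` carrier A = carrier ?F"
  proof (intro equalityI subsetI)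
    fix f assume f: "f \<in> carrier ?F"
    define x where "x = (\<Sum>j<r. pm_scale (f j) (vertex_idem (u j)))"
    have x: "x \<in> PF_span n" unfolding x_def using uU by (intro span_closed e_closed) auto
    have "coef x (Some |` u i) = f i" if i: "i < r" for i
    proof -
      have "coef x (Some |` u i) = (\<Sum>j<r. if j = i then f j else 0)"
        unfolding x_def coef_simps
      proof (rule sum.cong)
        fix j assume j: "j \<in> {..<r}"
        then have "u i = u j \<longleftrightarrow> j = i" using u i by (auto simp: bij_betw_def inj_on_def)
        then show "f j * coef (vertex_idem (u j)) (Some |` u i) = (if j = i then f j else 0)"
          using j uU[of j] by (simp add: coef_e restrict_id_eq_iff)
      qed simp
      then show ?thesis using i by simp
    qed
    then have "\<psi> x = f" using f by (auto simp: \<psi>_def field_power_def fun_eq_iff PiE_iff extensional_def)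
    then show "f \<in> \<psi> ` carrier A" using x by (auto simp: carrier_A)
  qed (auto simp: \<psi>_def field_power_def split: if_splits)
  define \<Psi> where "\<Psi> X = the_elem (\<psi> ` X)" for X
  have iso: "\<Psi> \<in> ring_iso (A Quot Rad A) ?F"
    using FactRing_iso_set[OF surj] unfolding ker \<Psi>_def .
  have \<Psi>: "\<Psi> (Rad A +>\<^bsub>A\<^esub> x) = \<psi> x" for x
  proof -
    have "\<psi> (k + x) = \<psi> x" if "k \<in> coef_rad" for k
      using that by (simp add: \<psi>_def coef_simps coef_rad_def)
    then have "\<psi> ` (Rad A +>\<^bsub>A\<^esub> x) = {\<psi> x}"
      unfolding coset_A Rad_A image_image using coef_rad_closed(1) by force
    then show ?thesis by (simp add: \<Psi>_def)
  qed
  show ?thesis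
    unfolding split_basic_def alg_isomorphic_def
  proof (intro exI[of _ r] bexI[of _ \<Psi>] allI ballI)
    show "\<Psi> \<in> ring_iso (alg_quot A (Rad A)) ?F"
      using iso by (simp add: ring_iso_def Ring.ring_hom_def alg_quot_def)
    fix c X assume "X \<in> carrier (alg_quot A (Rad A))"
    then obtain x where x: "X = Rad A +>\<^bsub>A\<^esub> x" by (auto simp: alg_quot_def FactRing_def A_RCOSETS_def')
    have "c \<odot>\<^bsub>alg_quot A (Rad A)\<^esub> X = Rad A +>\<^bsub>A\<^esub> pm_scale c x"
      unfolding x alg_quot_def Rad_A using coset_scale[OF coef_rad_closed(1-4)] by simp
    then show "\<Psi> (c \<odot>\<^bsub>alg_quot A (Rad A)\<^esub> X) = c \<odot>\<^bsub>?F\<^esub> \<Psi> X"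
      by (auto simp: \<Psi> x \<psi>_def field_power_def coef_simps)
  qed
qed

text \<open>An instance of \<open>quotient_basis\<close>: \<open>W\<close> is the part of the
  radical supported on morphisms from \<open>U\<close> to \<open>V\<close>, which is the sandwiched
  radical, and the coordinates are the coefficients at arrows, since these alone separate cosets of
  \<open>coef_rad2\<close>.\<close>

lemma arrow_space_basis:
  assumes U: "U \<subseteq> {1..n}" and V: "V \<subseteq> {1..n}"
  defines "D \<equiv> {d \<in> arrows n. dom d = U \<and> ran d = V}"
  shows "inj_on (\<lambda>d. coef_rad2 +>\<^bsub>A\<^esub> basis_elem d) D \<and>
    vectorspace.basis class_ring (arrow_space A (vertex_idem U) (vertex_idem V)) ((\<lambda>d. coef_rad2 +>\<^bsub>A\<^esub> basis_elem d) ` D)"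
proof (rule quotient_basis[where W = "{x \<in> coef_rad. \<forall>m. coef x m \<noteq> 0 \<longrightarrow> dom m = U \<and> ran m = V}"
      and \<kappa> = "\<lambda>d x. coef x d"])
  let ?W = "{x \<in> coef_rad. \<forall>m. coef x m \<noteq> 0 \<longrightarrow> dom m = U \<and> ran m = V}"
  have NP: "x \<in> PF_span n" if "x \<in> coef_rad" for x using that by (simp add: coef_rad_def)
  let ?f = "\<lambda>x. vertex_idem V \<otimes>\<^bsub>A\<^esub> x \<otimes>\<^bsub>A\<^esub> vertex_idem U"
  have W: "?f ` coef_rad = ?W"
  proof (intro equalityI subsetI)
    fix y assume "y \<in> ?f ` coef_rad"
    then obtain x where x: "x \<in> coef_rad" "y = ?f x" by blast
    have "?f x \<in> coef_rad" by (intro coef_rad_closed e_closed U V x(1))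
    then show "y \<in> ?W" unfolding x(2) by (simp add: coef_sandwich[OF NP[OF x(1)] U V])
  next
    fix x assume x: "x \<in> ?W"
    then have xN: "x \<in> coef_rad" by blast
    have "x = ?f x"
    proof (rule coef_eqI)
      show "x \<in> PF_span n" "?f x \<in> PF_span n" by (intro mult_closed e_closed U V NP xN)+
      fix m show "coef x m = coef (?f x) m"
        unfolding coef_sandwich[OF NP[OF xN] U V] using x by auto
    qed
    then show "x \<in> ?f ` coef_rad" using xN by (rule image_eqI)
  qed
  have img: "{coef_rad2 +>\<^bsub>A\<^esub> (vertex_idem V \<otimes>\<^bsub>A\<^esub> x \<otimes>\<^bsub>A\<^esub> vertex_idem U) |x. x \<in> coef_rad} = (\<lambda>x. coef_rad2 +>\<^bsub>A\<^esub> x) ` ?W"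
    unfolding W[symmetric] image_image Setcompr_eq_image by (rule HOL.refl)
  then show "carrier (arrow_space A (vertex_idem U) (vertex_idem V)) = (\<lambda>x. coef_rad2 +>\<^bsub>A\<^esub> x) ` ?W"
    by (simp add: arrow_space_def Rad_A Rad2_A)
  show "zero (arrow_space A (vertex_idem U) (vertex_idem V)) = coef_rad2 +>\<^bsub>A\<^esub> 0"
    by (simp add: arrow_space_def alg_quot_def FactRing_def Rad2_A coset_A)
  show "(coef_rad2 +>\<^bsub>A\<^esub> x) \<oplus>\<^bsub>arrow_space A (vertex_idem U) (vertex_idem V)\<^esub> (coef_rad2 +>\<^bsub>A\<^esub> y) = coef_rad2 +>\<^bsub>A\<^esub> (x + y)" for x y
    using coset_add[OF coef_rad2_closed(1,2)] by (simp add: arrow_space_def alg_quot_def FactRing_def)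
  show "c \<odot>\<^bsub>arrow_space A (vertex_idem U) (vertex_idem V)\<^esub> (coef_rad2 +>\<^bsub>A\<^esub> x) = coef_rad2 +>\<^bsub>A\<^esub> pm_scale c x" for c x
    using coset_scale[OF coef_rad2_closed] by (simp add: arrow_space_def alg_quot_def Rad2_A)
  show "0 \<in> ?W" by (simp add: coef_rad_closed coef_simps)
  show "x + y \<in> ?W" if "x \<in> ?W" "y \<in> ?W" for x y
  proof -
    have "coef x m \<noteq> 0 \<or> coef y m \<noteq> 0" if "coef (x + y) m \<noteq> 0" for m using that by (auto simp: coef_simps)
    then show ?thesis using that coef_rad_closed(2)[of x y] by blast
  qed
  show "pm_scale c x \<in> ?W" if "x \<in> ?W" for c x
    using that by (auto simp: coef_rad_closed coef_simps)
  show "coef_rad2 +>\<^bsub>A\<^esub> x = coef_rad2 +>\<^bsub>A\<^esub> y \<longleftrightarrow> (\<forall>d\<in>D. coef x d = coef y d)" if x: "x \<in> ?W" and y: "y \<in> ?W" for x y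
  proof -
    have "x - y \<in> coef_rad" using coef_rad_closed(2)[of x "- y"] coef_rad_closed(3)[of y] x y by simp
    moreover have "coef x d = coef y d" if "d \<notin> D" "d \<in> arrows n" for d
    proof -
      have "\<not> (dom d = U \<and> ran d = V)" using that by (simp add: D_def)
      then have "coef x d = 0" "coef y d = 0" using x y by blast+
      then show ?thesis by simp
    qed
    moreover have "D \<subseteq> arrows n" by (auto simp: D_def)
    ultimately have "x - y \<in> coef_rad2 \<longleftrightarrow> (\<forall>d\<in>D. coef x d = coef y d)"
      unfolding coef_rad2_def mem_Collect_eq coef_simps right_minus_eq by blast
    then show ?thesis using coset_eq[OF coef_rad2_closed(1-3)] by simp
  qed
  have DP: "d \<in> PF n" "d \<noteq> Some |` X" "dom d = U" "ran d = V" if dD: "d \<in> D" for d X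
  proof -
    obtain i j B where "d = d_map (i, j, B)" "arrow_defined n (i, j, B)" using dD by (auto simp: D_def)
    then show "d \<in> PF n" "d \<noteq> Some |` X" using arrow_not_id by auto
    show "dom d = U" "ran d = V" using dD by (simp_all add: D_def)
  qed
  show "finite D" using DP(1) finite_subset[OF _ finite_PF[of n]] by blast
  show "basis_elem d \<in> ?W" if "d \<in> D" for d
    using DP[OF that] by (auto simp: coef_rad_def b_closed coef_b)
  show "coef (basis_elem d') d = (if d = d' then 1 else 0)" if "d \<in> D" "d' \<in> D" for d d'
    using DP(1)[OF that(2)] by (auto simp: coef_b)
qed (simp_all add: coef_simps)

lemma quiver_via_A: "quiver_via A (vertex_idem ` Pow {1..n}) (EF_quiver n) vertex_idem"
proof -
  have "wf_digraph (EF_quiver n)"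
  proof
    fix d assume "d \<in> arcs (EF_quiver n)"
    then obtain i j X where "d = d_map (i, j, X)" "arrow_defined n (i, j, X)" by (auto simp: EF_quiver_def)
    then have "d \<in> PF n" using arrow_not_id(1) by simp
    then show "tail (EF_quiver n) d \<in> verts (EF_quiver n)" "head (EF_quiver n) d \<in> verts (EF_quiver n)"
      using PF_D(1,2) by (simp_all add: EF_quiver_def)
  qed
  moreover have "bij_betw vertex_idem (verts (EF_quiver n)) (vertex_idem ` Pow {1..n})"
    using inj_e by (simp add: EF_quiver_def bij_betw_def)
  ultimately show ?thesis
    unfolding quiver_via_def using arrow_space_basis
    by (intro conjI exI[of _ "\<lambda>d. coef_rad2 +>\<^bsub>A\<^esub> basis_elem d"] ballI) (simp_all add: EF_quiver_def)
qed

section \<open>The path category modulo the relations and the category of idempotents\<close>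

lemma push_closed: "u \<subseteq> {1..n} \<Longrightarrow> f \<in> lhom (path_lincat n) u v \<Longrightarrow> push f \<in> PF_span n"
  using keys_push[of u n f v] by (auto simp: PF_span_def)

lemma h_inv_linear:
  assumes "x \<in> PF_span n" "y \<in> PF_span n"
  shows "h_inv (x + y) = h_inv x + h_inv y" "h_inv (pm_scale c x) = pm_scale c (h_inv x)" "h_inv (ef_prod n x y) = h_inv x \<otimes>\<^bsub>A\<^esub> h_inv y"
    by (rule h_inj; use assms in \<open>simp add: h_h_inv h_inv_closed span_closed mult_closed ef_prod_closed h_mult
        pm_linearD[OF h_linear]\<close>)+

text \<open>The functor is \<open>push\<close> followed by \<open>h_inv\<close>. Its kernel is the
  congruence by \<open>cong_rel_ef\<close>, and \<open>norm_path\<close> provides preimages.\<close>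

lemma lincat_iso_A: "lincat_iso
    (lincat_quot (path_lincat n) (cong_rel (path_lincat n) (EF_relations n)))
    (idem_cat A (vertex_idem ` Pow {1..n})) vertex_idem"
proof (rule lincat_iso_quot[where \<Phi> = "\<lambda>u v f. h_inv (push f)"])
  show "bij_betw vertex_idem (lobj (path_lincat n)) (lobj (idem_cat A (vertex_idem ` Pow {1..n})))"
    using inj_e by (simp add: idem_cat_def bij_betw_def)
  fix u v assume "u \<in> lobj (path_lincat n)" "v \<in> lobj (path_lincat n)"
  then have u: "u \<subseteq> {1..n}" and v: "v \<subseteq> {1..n}" by auto
  show "cong_rel (path_lincat n) (EF_relations n) u v =
      {(f, f'). f \<in> lhom (path_lincat n) u v \<and> f' \<in> lhom (path_lincat n) u v \<and> h_inv (push f) = h_inv (push f')}"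
  proof -
    have "h_inv (push f) = h_inv (push f') \<longleftrightarrow> push f = push f'"
      if "f \<in> lhom (path_lincat n) u v" "f' \<in> lhom (path_lincat n) u v" for f f'
      using h_h_inv[OF push_closed[OF u that(1)]] h_h_inv[OF push_closed[OF u that(2)]] by metis
    then show ?thesis unfolding cong_rel_ef[OF u v] by blast
  qed
  show "(\<lambda>f. h_inv (push f)) ` lhom (path_lincat n) u v = lhom (idem_cat A (vertex_idem ` Pow {1..n})) (vertex_idem u) (vertex_idem v)"
  proof (intro equalityI subsetI)
    fix x assume "x \<in> (\<lambda>f. h_inv (push f)) ` lhom (path_lincat n) u v"
    then obtain f where f: "f \<in> lhom (path_lincat n) u v" "x = h_inv (push f)" by blast
    have x: "x \<in> PF_span n" using f push_closed[OF u] h_inv_closed by blast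
    have "vertex_idem v \<otimes>\<^bsub>A\<^esub> x \<otimes>\<^bsub>A\<^esub> vertex_idem u = x"
    proof (rule coef_eqI)
      fix m
      have "coef x m \<noteq> 0 \<Longrightarrow> dom m = u \<and> ran m = v"
        using keys_push[OF u f(1)] f(2) h_h_inv[OF push_closed[OF u f(1)]] by (auto simp: coef_def in_keys_iff subset_iff)
      then show "coef (vertex_idem v \<otimes>\<^bsub>A\<^esub> x \<otimes>\<^bsub>A\<^esub> vertex_idem u) m = coef x m"
        by (auto simp: coef_sandwich[OF x u v])
    qed (auto intro!: mult_closed e_closed x u v)
    then show "x \<in> lhom (idem_cat A (vertex_idem ` Pow {1..n})) (vertex_idem u) (vertex_idem v)"
      using x by (auto simp: idem_cat_def carrier_A intro!: exI[of _ x])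
  next
    fix x assume "x \<in> lhom (idem_cat A (vertex_idem ` Pow {1..n})) (vertex_idem u) (vertex_idem v)"
    then obtain a where a: "a \<in> PF_span n" "x = vertex_idem v \<otimes>\<^bsub>A\<^esub> a \<otimes>\<^bsub>A\<^esub> vertex_idem u"
      by (auto simp: idem_cat_def carrier_A)
    have x: "x \<in> PF_span n" unfolding a(2) by (intro mult_closed e_closed a u v)
    have k: "Poly_Mapping.keys (h x) \<subseteq> {m \<in> PF n. dom m = u \<and> ran m = v}"
    proof
      fix m assume m: "m \<in> Poly_Mapping.keys (h x)"
      then have "coef x m \<noteq> 0" by (simp add: coef_def in_keys_iff)
      then show "m \<in> {m \<in> PF n. dom m = u \<and> ran m = v}"
        using coef_sandwich[OF a(1) u v, of m] PF_spanD[OF h_closed[OF x] m] by (auto simp: a(2) split: if_splits)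
    qed
    from norm_path_hom[OF u k] have "norm_path (h x) \<in> lhom (path_lincat n) u v" "x = h_inv (push (norm_path (h x)))"
      using h_inv_h[OF x] by auto
    then show "x \<in> (\<lambda>f. h_inv (push f)) ` lhom (path_lincat n) u v" by blast
  qed
next
  fix u assume "u \<in> lobj (path_lincat n)"
  then have u: "u \<subseteq> {1..n}" by simp
  have p: "lid (path_lincat n) u = Poly_Mapping.single (word_path u []) 1" by (simp add: word_path_def)
  show "lid (path_lincat n) u \<in> lhom (path_lincat n) u u \<and>
      h_inv (push (lid (path_lincat n) u)) = lid (idem_cat A (vertex_idem ` Pow {1..n})) (vertex_idem u)"
    unfolding p using u
    by (simp add: lhom_closed(4) path_map_word_path word_map_Nil idem_cat_def basis_elem_def)
next
  fix u v and f f' :: "nat set \<times> (nat \<rightharpoonup> nat) list \<times> nat set \<Rightarrow>\<^sub>0 'k" assume "u \<in> lobj (path_lincat n)" "v \<in> lobj (path_lincat n)"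
    and f: "f \<in> lhom (path_lincat n) u v" "f' \<in> lhom (path_lincat n) u v"
  then have u: "u \<subseteq> {1..n}" by simp
  show "ladd (path_lincat n) u v f f' \<in> lhom (path_lincat n) u v \<and> h_inv (push (ladd (path_lincat n) u v f f')) =
      ladd (idem_cat A (vertex_idem ` Pow {1..n})) (vertex_idem u) (vertex_idem v) (h_inv (push f)) (h_inv (push f'))"
    using f h_inv_linear(1)[OF push_closed[OF u f(1)] push_closed[OF u f(2)]] lhom_closed(1)[OF u f]
    by (simp add: pm_linearD[OF pm_linear_push] idem_cat_def A_ops)
next
  fix u v c and f :: "nat set \<times> (nat \<rightharpoonup> nat) list \<times> nat set \<Rightarrow>\<^sub>0 'k" assume "u \<in> lobj (path_lincat n)" "v \<in> lobj (path_lincat n)"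
    and f: "f \<in> lhom (path_lincat n) u v"
  then have u: "u \<subseteq> {1..n}" by simp
  show "lscale (path_lincat n) u v c f \<in> lhom (path_lincat n) u v \<and> h_inv (push (lscale (path_lincat n) u v c f)) =
      lscale (idem_cat A (vertex_idem ` Pow {1..n})) (vertex_idem u) (vertex_idem v) c (h_inv (push f))"
    using h_inv_linear(2)[OF push_closed[OF u f] push_closed[OF u f]] lhom_closed(2)[OF u f]
    by (simp add: pm_linearD[OF pm_linear_push] idem_cat_def A_ops)
next
  fix u v w and f f' :: "nat set \<times> (nat \<rightharpoonup> nat) list \<times> nat set \<Rightarrow>\<^sub>0 'k" assume "u \<in> lobj (path_lincat n)" "v \<in> lobj (path_lincat n)" "w \<in> lobj (path_lincat n)"
    and f: "f \<in> lhom (path_lincat n) u v" and f': "f' \<in> lhom (path_lincat n) v w"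
  then have u: "u \<subseteq> {1..n}" and v: "v \<subseteq> {1..n}" by simp_all
  show "lcomp (path_lincat n) u v w f' f \<in> lhom (path_lincat n) u w \<and> h_inv (push (lcomp (path_lincat n) u v w f' f)) =
      lcomp (idem_cat A (vertex_idem ` Pow {1..n})) (vertex_idem u) (vertex_idem v) (vertex_idem w) (h_inv (push f')) (h_inv (push f))"
    using h_inv_linear(3)[OF push_closed[OF v f'] push_closed[OF u f]] lhom_closed(3)[OF u f v f'] push_comp[OF u v f f']
    by (simp add: idem_cat_def)
qed

theorem quiver_presentation_A: "quiver_presentation A (EF_quiver n) (EF_relations n)"
  unfolding quiver_presentation_def
  using k_algebra_A split_basic_A EF_relations_hom complete_e quiver_via_A lincat_iso_A by blast

end

section \<open>The monoid algebra\<close>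

text \<open>The zeta transform for the order of partial functions by restriction; its inverse is
  Moebius inversion over subsets of the domain.\<close>

definition sum_restr :: "((nat \<rightharpoonup> nat) \<Rightarrow>\<^sub>0 'k::field) \<Rightarrow> ((nat \<rightharpoonup> nat) \<Rightarrow>\<^sub>0 'k)" where
  "sum_restr = lin_ext (\<lambda>f. \<Sum>S\<in>Pow (dom f). Poly_Mapping.single (f |` S) 1)"

lemma pm_linear_sum_restr: "pm_linear sum_restr"
  by (simp add: sum_restr_def pm_linear_lin_ext)

lemma sum_restr_single:
  "sum_restr (Poly_Mapping.single f c) = (\<Sum>S\<in>Pow (dom f). Poly_Mapping.single (f |` S) c)"
  by (simp add: sum_restr_def pm_scale_sum)

lemma restrict_PF: "f \<in> PF n \<Longrightarrow> f |` S \<in> PF n"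
proof (rule PF_I)
  assume f: "f \<in> PF n"
  show "dom (f |` S) \<subseteq> {1..n}" using PF_D(1)[OF f] by auto
  show "1 \<le> y \<and> y \<le> x" if "(f |` S) x = Some y" for x y
    using that PF_D(3)[OF f, of x y] by (simp add: restrict_map_def split: if_splits)
qed

lemma sum_restr_closed: "f \<in> PF_span n \<Longrightarrow> sum_restr f \<in> PF_span n"
  unfolding sum_restr_def lin_ext_def PF_span_def mem_Collect_eq
  by (intro keys_sum_subset subset_trans[OF keys_pm_scale]) (auto simp: restrict_PF)

lemma restrict_dom_self: "f |` dom f = f"
  by (auto simp: restrict_map_def fun_eq_iff domIff)

text \<open>A proper restriction has a strictly smaller domain, so a term of largest domain in the
  support is produced by itself alone.\<close>

lemma lookup_sum_restr_maximal:
  assumes "x \<in> PF_span n" "m \<in> Poly_Mapping.keys x"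
    and max: "\<And>f. f \<in> Poly_Mapping.keys x \<Longrightarrow> card (dom f) \<le> card (dom m)"
  shows "Poly_Mapping.lookup (sum_restr x) m = Poly_Mapping.lookup x m"
proof -
  have "(\<Sum>S\<in>Pow (dom f). Poly_Mapping.lookup (Poly_Mapping.single (f |` S) (1 :: 'a)) m) = (if f = m then 1 else 0)"
    if f: "f \<in> Poly_Mapping.keys x" for f
  proof -
    have fin: "finite (dom f)" using PF_D(4)[OF PF_spanD[OF assms(1) f]] .
    have "f |` S = m \<longleftrightarrow> f = m \<and> S = dom f" if S: "S \<subseteq> dom f" for S
    proof
      assume m: "f |` S = m"
      have "dom m = S" using S unfolding m[symmetric] by auto
      then have "S = dom f" using max[OF f] S fin by (simp add: card_seteq)
      then show "f = m \<and> S = dom f" using m restrict_dom_self[of f] by metis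
    next
      assume "f = m \<and> S = dom f"
      then show "f |` S = m" using restrict_dom_self[of f] by simp
    qed
    then have "(\<Sum>S\<in>Pow (dom f). Poly_Mapping.lookup (Poly_Mapping.single (f |` S) (1 :: 'a)) m) =
        (\<Sum>S\<in>Pow (dom f). if S = dom f then if f = m then 1 else 0 else 0)"
      by (intro sum.cong) (auto simp: lookup_single when_def)
    then show ?thesis using fin by simp
  qed
  then have "Poly_Mapping.lookup (sum_restr x) m =
      (\<Sum>f\<in>Poly_Mapping.keys x. if f = m then Poly_Mapping.lookup x m else 0)"
    unfolding sum_restr_def lin_ext_def lookup_sum lookup_pm_scale by (intro sum.cong) auto
  then show ?thesis using assms(2) by simp
qed

lemma pm_sum_mem:
  assumes "0 \<in> I" "\<And>x y. x \<in> I \<Longrightarrow> y \<in> I \<Longrightarrow> x + y \<in> I" "\<And>t. t \<in> T \<Longrightarrow> F t \<in> I"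
  shows "sum F T \<in> I"
  using assms(3) by (induction T rule: infinite_finite_induct) (simp_all add: assms(1,2))

text \<open>The map is triangular for the size of the domain, with ones on the diagonal: a term of
  largest domain survives, which gives injectivity, and subtracting proper restrictions yields every
  basis element inductively.\<close>

lemma sum_restr_bij: "bij_betw sum_restr (PF_span n) (PF_span n :: (_ \<Rightarrow>\<^sub>0 'k::field) set)"
proof (rule bij_betw_imageI)
  have zero: "x = 0" if x: "x \<in> PF_span n" "sum_restr x = 0" for x :: "_ \<Rightarrow>\<^sub>0 'k"
  proof (rule ccontr)
    assume "x \<noteq> 0"
    then have "Poly_Mapping.keys x \<noteq> {}" by simp
    then have "Max ((\<lambda>f. card (dom f)) ` Poly_Mapping.keys x) \<in> (\<lambda>f. card (dom f)) ` Poly_Mapping.keys x"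
      by (intro Max_in) auto
    then obtain m where m1: "m \<in> Poly_Mapping.keys x"
      and m2: "card (dom m) = Max ((\<lambda>f. card (dom f)) ` Poly_Mapping.keys x)" by auto
    have m: "m \<in> Poly_Mapping.keys x"
      "\<And>f. f \<in> Poly_Mapping.keys x \<Longrightarrow> card (dom f) \<le> card (dom m)"
      using m1 unfolding m2 by (auto intro: Max_ge)
    have "Poly_Mapping.lookup x m = 0"
      using lookup_sum_restr_maximal[OF x(1) m] x(2) by simp
    then show False using m(1) by (simp add: in_keys_iff)
  qed
  show "inj_on sum_restr (PF_span n :: (_ \<Rightarrow>\<^sub>0 'k) set)"
  proof (rule inj_onI)
    fix x y :: "(nat \<rightharpoonup> nat) \<Rightarrow>\<^sub>0 'k" assume xy: "x \<in> PF_span n" "y \<in> PF_span n" "sum_restr x = sum_restr y"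
    have "Poly_Mapping.keys (x - y) \<subseteq> Poly_Mapping.keys x \<union> Poly_Mapping.keys y"
      by (auto simp: in_keys_iff lookup_minus)
    then have "x - y \<in> PF_span n" using xy(1,2) unfolding PF_span_def by blast
    moreover have "sum_restr (x - y) = 0" using xy(3) by (simp add: pm_linearD(5)[OF pm_linear_sum_restr])
    ultimately have "x - y = 0" by (rule zero)
    then show "x = y" by simp
  qed
  let ?I = "sum_restr ` (PF_span n :: (_ \<Rightarrow>\<^sub>0 'k) set)"
  have add: "x + y \<in> ?I" if xI: "x \<in> ?I" and yI: "y \<in> ?I" for x y
  proof -
    obtain u where u: "u \<in> PF_span n" "x = sum_restr u" using xI by (rule imageE)
    obtain v where v: "v \<in> PF_span n" "y = sum_restr v" using yI by (rule imageE)
    have "u + v \<in> PF_span n" using u(1) v(1) keys_add_subset unfolding PF_span_def by blast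
    then have "sum_restr (u + v) \<in> ?I" by (rule imageI)
    then show ?thesis by (simp add: u v pm_linearD(1)[OF pm_linear_sum_restr])
  qed
  have scale: "pm_scale c x \<in> ?I" if xI: "x \<in> ?I" for c x
  proof -
    obtain u where u: "u \<in> PF_span n" "x = sum_restr u" using xI by (rule imageE)
    have "pm_scale c u \<in> PF_span n"
      using u(1) subset_trans[OF keys_pm_scale] unfolding PF_span_def by blast
    then have "sum_restr (pm_scale c u) \<in> ?I" by (rule imageI)
    then show ?thesis by (simp add: u pm_linearD(2)[OF pm_linear_sum_restr])
  qed
  have "0 \<in> PF_span n" by (simp add: PF_span_def)
  then have "sum_restr 0 \<in> ?I" by (rule imageI)
  then have zero_I: "0 \<in> ?I" by (simp add: pm_linearD(3)[OF pm_linear_sum_restr])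
  have single: "Poly_Mapping.single f 1 \<in> ?I" if "f \<in> PF n" for f
    using that
  proof (induction "card (dom f)" arbitrary: f rule: less_induct)
    case less
    let ?s = "\<lambda>f. Poly_Mapping.single f (1 :: 'k)" and ?P = "Pow (dom f) - {dom f}"
    have fin: "finite (dom f)" by (rule PF_D(4)[OF less.prems])
    have eq: "sum_restr (?s f) = ?s f + (\<Sum>S\<in>?P. ?s (f |` S))"
      using fin by (simp add: sum_restr_single sum.remove[of "Pow (dom f)" "dom f"] restrict_dom_self)
    have "(\<Sum>S\<in>?P. ?s (f |` S)) \<in> ?I"
    proof (rule pm_sum_mem[OF zero_I add])
      fix S assume S: "S \<in> ?P"
      then have d: "dom (f |` S) = S" by auto
      have "card S < card (dom f)" using S fin by (intro psubset_card_mono) auto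
      then show "?s (f |` S) \<in> ?I" using less.hyps[of "f |` S"] restrict_PF[OF less.prems] unfolding d by blast
    qed
    then have "pm_scale (-1) (\<Sum>S\<in>?P. ?s (f |` S)) \<in> ?I" by (rule scale)
    moreover have "sum_restr (?s f) \<in> ?I"
      using less.prems by (intro imageI) (simp add: PF_span_def)
    ultimately have "sum_restr (?s f) + pm_scale (-1) (\<Sum>S\<in>?P. ?s (f |` S)) \<in> ?I" by (intro add)
    then show ?case unfolding eq pm_scale_minus1 by simp
  qed
  show "?I = PF_span n"
  proof (intro equalityI subsetI)
    fix x :: "_ \<Rightarrow>\<^sub>0 'k" assume x: "x \<in> PF_span n"
    have "(\<Sum>m\<in>Poly_Mapping.keys x. pm_scale (Poly_Mapping.lookup x m) (Poly_Mapping.single m 1)) \<in> ?I"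
      by (intro pm_sum_mem[OF zero_I add] scale single PF_spanD[OF x])
    then show "x \<in> ?I" using pm_expand[of "Poly_Mapping.keys x" x] by simp
  next
    fix x assume "x \<in> ?I"
    then show "x \<in> PF_span n" by (rule imageE) (simp add: sum_restr_closed)
  qed
qed

lemma dom_comp_eq: "T \<subseteq> dom g \<Longrightarrow> T \<subseteq> dom (f \<circ>\<^sub>m g) \<longleftrightarrow> ran (g |` T) \<subseteq> dom f"
proof
  assume T: "T \<subseteq> dom g" "T \<subseteq> dom (f \<circ>\<^sub>m g)"
  show "ran (g |` T) \<subseteq> dom f"
  proof
    fix y assume "y \<in> ran (g |` T)"
    then obtain x where "x \<in> T" "g x = Some y" by (auto simp: ran_def restrict_map_def split: if_splits)
    moreover obtain z where "(f \<circ>\<^sub>m g) x = Some z" using T(2) \<open>x \<in> T\<close> by blast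
    ultimately show "y \<in> dom f" by (auto simp: map_comp_Some_iff)
  qed
next
  assume T: "T \<subseteq> dom g" "ran (g |` T) \<subseteq> dom f"
  show "T \<subseteq> dom (f \<circ>\<^sub>m g)"
  proof
    fix x assume x: "x \<in> T"
    then obtain y where y: "g x = Some y" using T(1) by blast
    then have "y \<in> ran (g |` T)" using x by (auto simp: ran_def restrict_map_def)
    then obtain z where "f y = Some z" using T(2) by blast
    then show "x \<in> dom (f \<circ>\<^sub>m g)" using y by (auto simp: map_comp_Some_iff)
  qed
qed

lemma restrict_comp: "(f |` ran (g |` T)) \<circ>\<^sub>m (g |` T) = (f \<circ>\<^sub>m g) |` T"
proof
  fix x
  show "((f |` ran (g |` T)) \<circ>\<^sub>m (g |` T)) x = ((f \<circ>\<^sub>m g) |` T) x"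
  proof (cases "x \<in> T")
    case True
    then show ?thesis
    proof (cases "g x")
      case (Some y)
      then have "y \<in> ran (g |` T)" using True by (auto simp: ran_def restrict_map_def)
      then show ?thesis using True Some by (simp add: map_comp_def)
    qed (simp add: map_comp_def)
  qed (simp add: map_comp_def)
qed

text \<open>For fixed \<open>T\<close>, the restriction of \<open>g\<close> to \<open>T\<close>
  composes in \<open>EF_cat\<close> with exactly one restriction of \<open>f\<close>, that to its
  range \<open>S\<close>, provided \<open>S \<subseteq> dom f\<close>. This holds precisely when
  \<open>T\<close> lies in the domain of the composite, so the double sum collapses to the
  restrictions of the composite.\<close>

lemma sum_restr_comp:
  assumes "f \<in> PF n" "g \<in> PF n"
  shows "sum_restr (Poly_Mapping.single (f \<circ>\<^sub>m g) 1) =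
    ef_prod n (sum_restr (Poly_Mapping.single f 1)) (sum_restr (Poly_Mapping.single g (1 :: 'k::field)))"
proof -
  let ?s = "\<lambda>f. Poly_Mapping.single f (1 :: 'k)"
  have fin: "finite (Pow (dom f))" "finite (Pow (dom g))" using PF_D(4) assms by auto
  have dom: "dom (f |` S) = S" if "S \<subseteq> dom f" for S using that by auto
  have "ef_prod n (sum_restr (?s f)) (sum_restr (?s g)) =
      (\<Sum>T\<in>Pow (dom g). \<Sum>S\<in>Pow (dom f). ef_prod n (?s (f |` S)) (?s (g |` T)))"
    by (simp add: sum_restr_single pm_linearD(6)[OF pm_linear_ef_prod(1)] pm_linearD(6)[OF pm_linear_ef_prod(2)])
  also have "\<dots> = (\<Sum>T\<in>Pow (dom g). if T \<subseteq> dom (f \<circ>\<^sub>m g) then ?s ((f \<circ>\<^sub>m g) |` T) else 0)"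
  proof (rule sum.cong[OF HOL.refl])
    fix T assume "T \<in> Pow (dom g)"
    then have T: "T \<subseteq> dom g" by blast
    have "(\<Sum>S\<in>Pow (dom f). ef_prod n (?s (f |` S)) (?s (g |` T))) =
      (\<Sum>S\<in>Pow (dom f). if S = ran (g |` T) then ?s ((f \<circ>\<^sub>m g) |` T) else 0)"
      by (rule sum.cong[OF HOL.refl]) (use dom in \<open>auto simp: ef_prod_single restrict_comp\<close>)
    also have "\<dots> = (if T \<subseteq> dom (f \<circ>\<^sub>m g) then ?s ((f \<circ>\<^sub>m g) |` T) else 0)"
      unfolding dom_comp_eq[OF T, of f] using fin by simp
    finally show "(\<Sum>S\<in>Pow (dom f). ef_prod n (?s (f |` S)) (?s (g |` T))) =
      (if T \<subseteq> dom (f \<circ>\<^sub>m g) then ?s ((f \<circ>\<^sub>m g) |` T) else 0)" .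
  qed
  also have "\<dots> = (\<Sum>T\<in>Pow (dom (f \<circ>\<^sub>m g)). ?s ((f \<circ>\<^sub>m g) |` T))"
  proof (rule sum.mono_neutral_cong_right)
    have "dom (f \<circ>\<^sub>m g) \<subseteq> dom g" by (auto simp: map_comp_Some_iff)
    then show "Pow (dom (f \<circ>\<^sub>m g)) \<subseteq> Pow (dom g)" by blast
  qed (use fin in auto)
  finally show ?thesis by (simp add: sum_restr_single)
qed

lemma ef_algebra_category: "ef_algebra n (category_algebra (EF_cat n) :: ('k::field, _) module) (\<lambda>f. f)"
proof
  let ?A = "category_algebra (EF_cat n) :: ('k, _) module"
  have mult: "mult ?A = ef_prod n" by (simp add: category_algebra_def)
  have one: "\<one>\<^bsub>?A\<^esub> = ef_one n" by (simp add: category_algebra_def EF_cat_def ef_one_def)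
  show "bij_betw (\<lambda>f. f) (PF_span n) (PF_span n :: (_ \<Rightarrow>\<^sub>0 'k) set)" by (rule bij_betw_imageI) auto
  show "carrier ?A = PF_span n" "add ?A = (+)" "zero ?A = 0" "smult ?A = pm_scale"
    by (simp_all add: category_algebra_def EF_cat_def PF_span_def)
  show "x \<otimes>\<^bsub>?A\<^esub> y \<in> PF_span n" if "x \<in> PF_span n" "y \<in> PF_span n" for x y
    unfolding mult by (rule ef_prod_closed[OF that])
  show "x \<otimes>\<^bsub>?A\<^esub> y = ef_prod n x y" for x y by (simp only: mult)
  show "\<one>\<^bsub>?A\<^esub> \<in> PF_span n" unfolding one by (rule ef_one_closed)
  show "\<one>\<^bsub>?A\<^esub> = ef_one n" by (rule one)
qed (simp add: pm_linear_def)

lemma ef_algebra_monoid: "ef_algebra n (monoid_algebra (PF_monoid n) :: ('k::field, _) module) sum_restr"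
proof
  let ?A = "monoid_algebra (PF_monoid n) :: ('k, _) module"
  have mult: "mult ?A = bilinear_ext (\<lambda>f g. Poly_Mapping.single (f \<circ>\<^sub>m g) 1)"
    by (simp add: monoid_algebra_def PF_monoid_def)
  show "x \<otimes>\<^bsub>?A\<^esub> y \<in> PF_span n" if "x \<in> PF_span n" "y \<in> PF_span n" for x y
    using that unfolding mult PF_span_def mem_Collect_eq by (intro keys_bilinear_ext) (auto intro!: comp_PF)
  show "sum_restr (x \<otimes>\<^bsub>?A\<^esub> y) = ef_prod n (sum_restr x) (sum_restr y)"
    if "x \<in> PF_span n" "y \<in> PF_span n" for x y
    unfolding mult ef_prod_eq
  proof (rule bilinear_ext_map[OF pm_linear_sum_restr])
    fix f g assume "f \<in> Poly_Mapping.keys x" "g \<in> Poly_Mapping.keys y"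
    then have "f \<in> PF n" "g \<in> PF n" using that PF_spanD by blast+
    from sum_restr_comp[OF this] show "sum_restr (Poly_Mapping.single (f \<circ>\<^sub>m g) 1) =
      bilinear_ext (\<lambda>f g. if dom f = ran g then Poly_Mapping.single (f \<circ>\<^sub>m g) 1 else 0)
        (sum_restr (Poly_Mapping.single f 1)) (sum_restr (Poly_Mapping.single g (1 :: 'k)))"
      unfolding ef_prod_eq .
  qed
  have one: "\<one>\<^bsub>?A\<^esub> = Poly_Mapping.single (Some |` {1..n}) 1"
    by (simp add: monoid_algebra_def PF_monoid_def)
  show "\<one>\<^bsub>?A\<^esub> \<in> PF_span n" unfolding one using id_PF[of "{1..n}" n] by (simp add: PF_span_def)
  have "(Some |` {1..n}) |` S = Some |` S" if "S \<in> Pow {1..n}" for S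
    using that by (simp add: Int_absorb1)
  then show "sum_restr \<one>\<^bsub>?A\<^esub> = ef_one n"
    unfolding one sum_restr_single ef_one_def restrict_id_simps(1) by (intro sum.cong) auto
  show "carrier ?A = PF_span n" "add ?A = (+)" "zero ?A = 0" "smult ?A = pm_scale"
    by (simp_all add: monoid_algebra_def PF_monoid_def PF_span_def)
qed (rule pm_linear_sum_restr sum_restr_bij)+

theorem theorem4p45:
  fixes n :: nat
  assumes "n \<ge> 1"
  shows "quiver_presentation
           (monoid_algebra (PF_monoid n) :: ('k::field, (nat \<rightharpoonup> nat) \<Rightarrow>\<^sub>0 'k) module)
           (EF_quiver n) (EF_relations n)
       \<and> quiver_presentation
           (category_algebra (EF_cat n) :: ('k, (nat \<rightharpoonup> nat) \<Rightarrow>\<^sub>0 'k) module)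
           (EF_quiver n) (EF_relations n)"
  using ef_algebra.quiver_presentation_A[OF ef_algebra_monoid]
    ef_algebra.quiver_presentation_A[OF ef_algebra_category] by blast

end
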